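(* Let $w$ be a majorant satisfying $$\int_0^1\frac{w^2(t)}{t}\,dt=\infty,$$ but such that $\int_0^1\frac{w^\gamma(t)}{t}\,dt<\infty$ for some $\gamma>2$. Then there exist compact sets $K\subset\partial\mathbb{D}$ of positive Lebesgue measure which satisfy the SA-property with respect to $\mathcal{B}_0$ and almost contain no subset of finite $w$-entropy.
   Context: $\mathbb{D}$ is the open unit disc, $\partial\mathbb{D}$ the unit circle, $|I|$ the normalized Lebesgue measure of an arc $I$. A majorant is a continuous non-decreasing function $w$ on $[0,1]$, positive on $(0,1]$, for which there is $0<\alpha<1$ such that $w(t)/t^\alpha$ increases up to $\infty$ as $t\to0+$. The little Bloch space $\mathcal{B}_0$ is the Banach space of holomorphic $f$ in $\mathbb{D}$ with $\lim_{|z|\to1-}(1-|z|)f'(z)=0$, with norm $\|f\|_{\mathcal{B}}=|f(0)|+\sup_{z\in\mathbb{D}}(1-|z|)|f'(z)|$. For measurable $E\subseteq\partial\mathbb{D}$, $\mathcal{P}_E(\mathcal{B}_0)$ is the closure of $\{(Q,Q):Q\text{ analytic polynomial}\}$ in $\mathcal{B}_0\oplus L^\infty(E)$, with the norm topology on $\mathcal{B}_0$ and the weak-star topology on $L^\infty(E)$. $E$ satisfies the SA-property with respect to $\mathcal{B}_0$ if $\mathcal{P}_E(\mathcal{B}_0)=\mathcal{B}_0\oplus L^\infty(E)$. A set of finite $w$-entropy is a compact set $K\subseteq\partial\mathbb{D}$ of positive Lebesgue measure with $\sum_n|I_n|\log w(|I_n|)>-\infty$, where $\{I_n\}_n$ are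 the connected components of $\partial\mathbb{D}\setminus K$. $K'$ is almost contained in $K$ if $K'\setminus K$ has Lebesgue measure zero. *)

theory Defs
  imports "HOL-Complex_Analysis.Complex_Analysis"
begin

section \<open>Normalized Lebesgue measure on the unit circle\<close>

text \<open>
  The measure lives on all of the complex plane and is carried by the unit circle; the completion
  makes all Lebesgue measurable subsets of the circle measurable.
\<close>

definition circle_measure :: "complex measure" where
  "circle_measure =
     completion (distr (restrict_space lborel {0..<1}) borel (\<lambda>t::real. cis (2 * pi * t)))"

lemma emeasure_circle_measure_sphere: "emeasure circle_measure (sphere 0 1) = 1"
proof -
  have [measurable]: "(\<lambda>t::real. cis (2 * pi * t)) \<in> borel_measurable (restrict_space lborel {0..<1})"
    by (intro measurable_restrict_space1) (simp add: borel_measurable_continuous_onI continuous_intros)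
  have "emeasure circle_measure (sphere 0 1) =
      emeasure (restrict_space lborel {0..<1::real}) {0..<1}"
    unfolding circle_measure_def
    by (simp add: emeasure_distr vimage_def space_restrict_space)
  also have "\<dots> = 1"
    by (simp add: emeasure_restrict_space)
  finally show ?thesis .
qed

section \<open>Majorants and sets of finite entropy\<close>

text \<open>
  Only the values of the majorant on the unit interval matter.
\<close>

definition majorant :: "(real \<Rightarrow> real) \<Rightarrow> bool" where
  "majorant w \<longleftrightarrow>
     continuous_on {0..1} w \<and> mono_on {0..1} w \<and> (\<forall>t\<in>{0<..1}. 0 < w t) \<and>
     (\<exists>\<alpha>. 0 < \<alpha> \<and> \<alpha> < 1 \<and>
        antimono_on {0<..1} (\<lambda>t. w t / t powr \<alpha>) \<and>
        filterlim (\<lambda>t. w t / t powr \<alpha>) at_top (at_right 0))"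

text \<open>
  Since \<open>w\<close> is bounded above and the lengths of the complementary arcs add up to at most \<open>1\<close>,
  the positive part of the entropy sum always converges. Hence the sum is greater than \<open>-\<infinity>\<close>
  if and only if it converges (absolutely).
\<close>

definition finite_entropy_set :: "(real \<Rightarrow> real) \<Rightarrow> complex set \<Rightarrow> bool" where
  "finite_entropy_set w K \<longleftrightarrow>
     compact K \<and> K \<subseteq> sphere 0 1 \<and> 0 < measure circle_measure K \<and>
     (\<lambda>I. measure circle_measure I * ln (w (measure circle_measure I)))
        summable_on components (sphere 0 1 - K)"

definition almost_contained :: "complex set \<Rightarrow> complex set \<Rightarrow> bool" where
  "almost_contained K' K \<longleftrightarrow> K' - K \<in> null_sets circle_measure"

section \<open>The little Bloch space\<close>

text \<open>
  Functions on the unit disc are represented by functions on the complex plane that are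
  \<^term>\<open>undefined\<close> off the disc, so that equality is equality on the disc.
\<close>

definition little_bloch :: "(complex \<Rightarrow> complex) set" where
  "little_bloch =
     {f \<in> extensional (ball 0 1). f holomorphic_on ball 0 1 \<and>
        ((\<lambda>z. of_real (1 - cmod z) * deriv f z) \<longlongrightarrow> 0) (filtercomap cmod (at_left 1))}"

definition bloch_norm :: "(complex \<Rightarrow> complex) \<Rightarrow> real" where
  "bloch_norm f = cmod (f 0) + (SUP z\<in>ball 0 1. (1 - cmod z) * cmod (deriv f z))"

text \<open>
  The value \<open>0\<close> outside the space only serves to make \<^term>\<open>Metric_space.mtopology\<close> applicable,
  as that locale demands nonnegativity and symmetry of the distance everywhere.
\<close>

definition bloch_dist :: "(complex \<Rightarrow> complex) \<Rightarrow> (complex \<Rightarrow> complex) \<Rightarrow> real" where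
  "bloch_dist f g =
     (if f \<in> little_bloch \<and> g \<in> little_bloch then bloch_norm (\<lambda>z. f z - g z) else 0)"

definition bloch_topology :: "(complex \<Rightarrow> complex) topology" where
  "bloch_topology = Metric_space.mtopology little_bloch bloch_dist"

lemma bloch_bdd:
  assumes "f \<in> little_bloch"
  shows "bdd_above ((\<lambda>z. (1 - cmod z) * cmod (deriv f z)) ` ball 0 1)"
proof -
  have hol: "deriv f holomorphic_on ball 0 1"
    using assms by (auto simp: little_bloch_def intro: holomorphic_deriv)
  have "\<forall>\<^sub>F z in filtercomap cmod (at_left 1). dist (of_real (1 - cmod z) * deriv f z) 0 < 1"
    using assms by (intro tendstoD) (auto simp: little_bloch_def)
  then obtain P where P: "eventually P (at_left (1::real))"
    and PQ: "\<And>z. P (cmod z) \<Longrightarrow> dist (of_real (1 - cmod z) * deriv f z) 0 < 1"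
    unfolding eventually_filtercomap by blast
  then obtain b where b: "b < 1" "\<And>r. b < r \<Longrightarrow> r < 1 \<Longrightarrow> P r"
    unfolding eventually_at_left_field by blast
  have "compact ((\<lambda>z. (1 - cmod z) * cmod (deriv f z)) ` cball 0 b)"
    using b(1) by (intro compact_continuous_image continuous_intros compact_cball
        continuous_on_subset[OF holomorphic_on_imp_continuous_on[OF hol]]) auto
  then have "bdd_above ((\<lambda>z. (1 - cmod z) * cmod (deriv f z)) ` cball 0 b)"
    by (intro bounded_imp_bdd_above compact_imp_bounded)
  then obtain C where C: "\<And>z. z \<in> cball 0 b \<Longrightarrow> (1 - cmod z) * cmod (deriv f z) \<le> C"
    unfolding bdd_above_def by blast
  show ?thesis
  proof (rule bdd_aboveI2)
    fix z :: complex assume z: "z \<in> ball 0 1"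
    show "(1 - cmod z) * cmod (deriv f z) \<le> max C 1"
    proof (cases "cmod z \<le> b")
      case True
      then show ?thesis using C by (simp add: le_max_iff_disj)
    next
      case False
      then have "cmod (of_real (1 - cmod z) * deriv f z) < 1"
        using PQ[OF b(2)[of "cmod z"]] z by (simp add: dist_norm)
      then show ?thesis using z by (simp add: norm_mult le_max_iff_disj del: of_real_diff)
    qed
  qed
qed

lemma bloch_deriv_diff:
  assumes "f \<in> little_bloch" "g \<in> little_bloch" "z \<in> ball 0 1"
  shows "deriv (\<lambda>z. f z - g z) z = deriv f z - deriv g z"
  using assms
  by (intro deriv_diff) (auto simp: little_bloch_def intro: holomorphic_on_imp_differentiable_at)

lemma bloch_bdd_diff:
  assumes "f \<in> little_bloch" "g \<in> little_bloch"
  shows "bdd_above ((\<lambda>z. (1 - cmod z) * cmod (deriv (\<lambda>z. f z - g z) z)) ` ball 0 1)"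
proof -
  obtain A where A: "\<And>z. z \<in> ball 0 1 \<Longrightarrow> (1 - cmod z) * cmod (deriv f z) \<le> A"
    using bloch_bdd[OF assms(1)] unfolding bdd_above_def by blast
  obtain B where B: "\<And>z. z \<in> ball 0 1 \<Longrightarrow> (1 - cmod z) * cmod (deriv g z) \<le> B"
    using bloch_bdd[OF assms(2)] unfolding bdd_above_def by blast
  show ?thesis
  proof (rule bdd_aboveI2)
    fix z :: complex assume z: "z \<in> ball 0 1"
    have "(1 - cmod z) * cmod (deriv f z - deriv g z)
        \<le> (1 - cmod z) * (cmod (deriv f z) + cmod (deriv g z))"
      using z by (intro mult_left_mono norm_triangle_ineq4) auto
    also have "\<dots> \<le> A + B"
      using A[OF z] B[OF z] by (simp add: distrib_left)
    finally show "(1 - cmod z) * cmod (deriv (\<lambda>z. f z - g z) z) \<le> A + B"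
      using bloch_deriv_diff[OF assms z] by simp
  qed
qed

lemma bloch_norm_diff_upper:
  assumes "f \<in> little_bloch" "g \<in> little_bloch" "z \<in> ball 0 1"
  shows "(1 - cmod z) * cmod (deriv f z - deriv g z)
          \<le> (SUP z\<in>ball 0 1. (1 - cmod z) * cmod (deriv (\<lambda>z. f z - g z) z))"
  using cSUP_upper[OF assms(3) bloch_bdd_diff[OF assms(1,2)]] bloch_deriv_diff[OF assms] by simp

lemma bloch_SUP_nonneg:
  assumes "f \<in> little_bloch" "g \<in> little_bloch"
  shows "0 \<le> (SUP z\<in>ball 0 1. (1 - cmod z) * cmod (deriv (\<lambda>z. f z - g z) z))"
proof -
  have "0 \<le> (1 - cmod 0) * cmod (deriv f 0 - deriv g 0)"
    by simp
  also have "\<dots> \<le> (SUP z\<in>ball 0 1. (1 - cmod z) * cmod (deriv (\<lambda>z. f z - g z) z))"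
    by (intro bloch_norm_diff_upper assms) auto
  finally show ?thesis .
qed

lemma Metric_space_little_bloch: "Metric_space little_bloch bloch_dist"
proof
  show "0 \<le> bloch_dist f g" for f g
    using bloch_SUP_nonneg[of f g] by (simp add: bloch_dist_def bloch_norm_def)
  show "bloch_dist f g = bloch_dist g f" for f g
    by (auto simp: bloch_dist_def bloch_norm_def bloch_deriv_diff norm_minus_commute
        intro!: SUP_cong)
  show "bloch_dist f g = 0 \<longleftrightarrow> f = g" if fg: "f \<in> little_bloch" "g \<in> little_bloch" for f g
  proof
    assume "f = g"
    then show "bloch_dist f g = 0"
      by (simp add: bloch_dist_def bloch_norm_def)
  next
    assume "bloch_dist f g = 0"
    then have 0: "f 0 = g 0"
      and S: "(SUP z\<in>ball 0 1. (1 - cmod z) * cmod (deriv (\<lambda>z. f z - g z) z)) = 0"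
      using bloch_SUP_nonneg[OF fg] fg
      by (auto simp: bloch_dist_def bloch_norm_def add_nonneg_eq_0_iff)
    have hol: "(\<lambda>z. f z - g z) holomorphic_on ball 0 1"
      using fg by (auto simp: little_bloch_def intro: holomorphic_intros)
    have d0: "deriv (\<lambda>z. f z - g z) z = 0" if z: "z \<in> ball 0 1" for z
    proof -
      have "(1 - cmod z) * cmod (deriv f z - deriv g z) \<le> 0"
        using bloch_norm_diff_upper[OF fg z] S by simp
      then have "cmod (deriv f z - deriv g z) \<le> 0"
        using z by (simp add: mult_le_0_iff)
      then show ?thesis using bloch_deriv_diff[OF fg z] by simp
    qed
    have "((\<lambda>z. f z - g z) has_field_derivative 0) (at z within ball 0 1)"
      if z: "z \<in> ball 0 1" for z
      using holomorphic_derivI[OF hol open_ball z] d0[OF z]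
      by (simp add: has_field_derivative_at_within)
    then have "\<exists>c. \<forall>z\<in>ball 0 1. f z - g z = c"
      by (rule has_field_derivative_zero_constant[OF convex_ball])
    then obtain c where c: "\<And>z. z \<in> ball 0 1 \<Longrightarrow> f z - g z = c"
      by blast
    then have eq: "f z = g z" if "z \<in> ball 0 1" for z
      using c[of 0] c[OF that] 0 by simp
    show "f = g"
      using fg eq by (intro extensionalityI[of f "ball 0 1" g]) (auto simp: little_bloch_def)
  qed
  show "bloch_dist f h \<le> bloch_dist f g + bloch_dist g h"
    if f: "f \<in> little_bloch" and g: "g \<in> little_bloch" and h: "h \<in> little_bloch" for f g h
  proof -
    let ?S = "\<lambda>f g. SUP z\<in>ball 0 1. (1 - cmod z) * cmod (deriv (\<lambda>z. f z - g z) z)"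
    have "?S f h \<le> ?S f g + ?S g h"
    proof (rule cSUP_least)
      fix z :: complex assume z: "z \<in> ball 0 1"
      have "(1 - cmod z) * cmod (deriv f z - deriv h z)
          \<le> (1 - cmod z) * (cmod (deriv f z - deriv g z) + cmod (deriv g z - deriv h z))"
        using z norm_triangle_ineq[of "deriv f z - deriv g z" "deriv g z - deriv h z"]
        by (intro mult_left_mono) auto
      also have "\<dots> \<le> ?S f g + ?S g h"
        using bloch_norm_diff_upper[OF f g z] bloch_norm_diff_upper[OF g h z]
        by (simp add: distrib_left)
      finally show "(1 - cmod z) * cmod (deriv (\<lambda>z. f z - h z) z) \<le> ?S f g + ?S g h"
        using bloch_deriv_diff[OF f h z] by simp
    qed auto
    then show ?thesis
      using f g h norm_triangle_ineq[of "f 0 - g 0" "g 0 - h 0"]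
      by (simp add: bloch_dist_def bloch_norm_def)
  qed
qed

lemma topspace_bloch_topology [simp]: "topspace bloch_topology = little_bloch"
  using Metric_space.topspace_mtopology[OF Metric_space_little_bloch]
  by (simp add: bloch_topology_def)

lemma restrict_poly_in_little_bloch: "restrict (poly Q) (ball 0 1) \<in> little_bloch"
proof -
  have hol: "restrict (poly Q) (ball 0 1) holomorphic_on ball 0 1"
    by (rule holomorphic_transform[where f = "poly Q"]) (auto intro: holomorphic_intros)
  have d: "deriv (restrict (poly Q) (ball 0 1)) z = poly (pderiv Q) z" if z: "z \<in> ball 0 1" for z
  proof (rule DERIV_imp_deriv)
    show "(restrict (poly Q) (ball 0 1) has_field_derivative poly (pderiv Q) z) (at z)"
      by (rule has_field_derivative_transform_within_open[OF poly_DERIV open_ball z]) auto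
  qed
  have "bounded (poly (pderiv Q) ` cball 0 1)"
    by (intro compact_imp_bounded compact_continuous_image continuous_intros compact_cball)
  then obtain C where C: "\<And>z. z \<in> cball 0 1 \<Longrightarrow> cmod (poly (pderiv Q) z) \<le> C"
    unfolding bounded_iff by blast
  let ?F = "filtercomap cmod (at_left (1::real))"
  have "\<forall>\<^sub>F r in at_left (1::real). r < 1"
    by (auto simp: eventually_at_filter)
  then have lt: "\<forall>\<^sub>F z in ?F. cmod z < 1"
    by (rule eventually_filtercomapI)
  have "filterlim cmod (nhds 1) ?F"
    using filterlim_filtercomap[of cmod "at_left (1::real)"] at_within_le_nhds
    by (rule filterlim_mono) auto
  then have "((\<lambda>z. (1 - cmod z) * C) \<longlongrightarrow> (1 - 1) * C) ?F"
    by (intro tendsto_intros)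
  then have lim: "((\<lambda>z. (1 - cmod z) * C) \<longlongrightarrow> 0) ?F"
    by simp
  have "((\<lambda>z. of_real (1 - cmod z) * deriv (restrict (poly Q) (ball 0 1)) z) \<longlongrightarrow> 0) ?F"
  proof (rule Lim_null_comparison[OF _ lim])
    show "\<forall>\<^sub>F z in ?F. cmod (of_real (1 - cmod z) * deriv (restrict (poly Q) (ball 0 1)) z)
            \<le> (1 - cmod z) * C"
      using lt
    proof eventually_elim
      case (elim z)
      have "cmod (of_real (1 - cmod z)) = 1 - cmod z"
        using elim by (simp only: norm_of_real)
      then show ?case
        using elim C[of z] d[of z] by (simp add: norm_mult mult_left_mono del: of_real_diff)
    qed
  qed
  with hol show ?thesis
    by (simp add: little_bloch_def)
qed

section \<open>Essentially bounded functions with the weak-star topology\<close>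

text \<open>
  Elements of \<open>L\<^sup>1(E)\<close> and \<open>L\<^sup>\<infinity>(E)\<close> are given by representatives. The weak-star topology on
  representatives is the pullback of the one on classes modulo equality almost everywhere on \<open>E\<close>;
  functions in the same class are topologically indistinguishable. So closures of sets of
  representatives are exactly the preimages of the closures of the corresponding sets of classes.
\<close>

definition L1_on :: "complex set \<Rightarrow> (complex \<Rightarrow> complex) set" where
  "L1_on E = {g. integrable (restrict_space circle_measure E) g}"

definition Linf_on :: "complex set \<Rightarrow> (complex \<Rightarrow> complex) set" where
  "Linf_on E = {f \<in> borel_measurable (restrict_space circle_measure E).
     \<exists>C. AE z in restrict_space circle_measure E. cmod (f z) \<le> C}"

lemma poly_in_Linf_on:
  assumes "E \<subseteq> sphere 0 1"
  shows "poly Q \<in> Linf_on E"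
proof -
  have "poly Q \<in> borel_measurable borel"
    by (intro borel_measurable_continuous_onI continuous_intros)
  then have meas: "poly Q \<in> borel_measurable (restrict_space circle_measure E)"
    unfolding circle_measure_def
    by (intro measurable_restrict_space1 measurable_completion) simp
  have "bounded (poly Q ` sphere 0 1)"
    by (intro compact_imp_bounded compact_continuous_image continuous_intros compact_sphere)
  then obtain C where C: "\<And>z. z \<in> sphere 0 1 \<Longrightarrow> cmod (poly Q z) \<le> C"
    unfolding bounded_iff by blast
  have "AE z in restrict_space circle_measure E. cmod (poly Q z) \<le> C"
    using assms C by (intro AE_I2) (auto simp: space_restrict_space)
  with meas show ?thesis
    unfolding Linf_on_def by blast
qed

text \<open>The coarsest topology making all the functionals \<open>f \<mapsto> \<integral> f g\<close> continuous, where \<open>g\<close> ranges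
  over \<open>L\<^sup>1(E)\<close>.\<close>

definition weak_star_topology :: "complex set \<Rightarrow> (complex \<Rightarrow> complex) topology" where
  "weak_star_topology E =
     pullback_topology (Linf_on E)
       (\<lambda>f. \<lambda>g\<in>L1_on E. \<integral>z. f z * g z \<partial>restrict_space circle_measure E)
       (product_topology (\<lambda>_. euclidean) (L1_on E))"

lemma topspace_weak_star_topology [simp]: "topspace (weak_star_topology E) = Linf_on E"
  by (auto simp: weak_star_topology_def topspace_pullback_topology)

section \<open>Simultaneous approximation\<close>

definition poly_closure ::
    "complex set \<Rightarrow> ((complex \<Rightarrow> complex) \<times> (complex \<Rightarrow> complex)) set" where
  "poly_closure E =
     prod_topology bloch_topology (weak_star_topology E) closure_of
       {(restrict (poly Q) (ball 0 1), poly Q) | Q. True}"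

definition SA_property :: "complex set \<Rightarrow> bool" where
  "SA_property E \<longleftrightarrow> poly_closure E = little_bloch \<times> Linf_on E"

end

theory Submission
  imports Defs
begin

text \<open>
  Integrability of \<open>w t powr \<gamma> / t\<close> forces \<open>w t \<rightarrow> 0\<close> as \<open>t \<rightarrow> 0\<close>. The key is a polynomial \<open>S\<close> with \<open>S 0 = 0\<close> and small Bloch norm that is close to \<open>1\<close> on the circle outside a set of
  small measure. It is \<open>1 - exp (c (\<psi> - \<psi> 0))\<close> up to a small error, where \<open>u = Re \<psi>\<close> is the end of a
  slow lacunary random walk in \<open>[-1, 1]\<close>: repeatedly \<open>\<psi>\<close> is replaced by \<open>\<psi> + \<eta> z\<^sup>M (1 - u\<^sup>2)\<close> on the
  circle, which is an analytic polynomial if \<open>M\<close> is large. Every step has size at most \<open>\<eta>\<close> and,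
  for huge \<open>M\<close>, interferes with the earlier ones only negligibly, so the Bloch norm stays of order
  \<open>\<eta>\<close>; the energy identity \<open>\<integral> u\<^sub>+\<^sup>2 = \<integral> u\<^sup>2 + \<eta>\<^sup>2/2 \<integral> (1 - u\<^sup>2)\<^sup>2\<close> forces \<open>u\<close> to end near \<open>-1\<close> or \<open>1\<close>.

  Replacing \<open>S z\<close> by \<open>S (z\<^sup>m)\<close> does not increase the Bloch norm, but spreads the exceptional set evenly at
  scale \<open>1/m\<close>, where \<open>m\<close> can be chosen after the measure of that set is known. The set \<open>K\<close> is what remains
  after the exceptional sets of a sequence of such polynomials \<open>T\<^sub>n\<close> are removed. Since \<open>T\<^sub>n\<close> tends to \<open>0\<close>
  in the Bloch norm, tends to \<open>1\<close> uniformly on \<open>K\<close>, and vanishes to high order at \<open>0\<close>, the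
  polynomials \<open>p + q T\<^sub>n\<close> with a polynomial \<open>p\<close> and a trigonometric polynomial \<open>q\<close> give the
  SA-property. A subset of positive measure has at every scale \<open>1/m\<^sub>n\<close> a fixed proportion of the exceptional
  set in short complementary arcs, which makes its entropy infinite.
\<close>

section \<open>The circle measure in the parameter \<open>t\<close>, and the mean value
  property\<close>

section \<open>Lebesgue measure on the circle\<close>

abbreviation circ :: "real \<Rightarrow> complex" where
  "circ t \<equiv> cis (2 * pi * t)"

lemma circ_measurable [measurable]: "circ \<in> borel_measurable borel"
  by (intro borel_measurable_continuous_onI continuous_intros)

lemma circ_add_int: "circ (t + of_int n) = circ t"
proof -
  have "circ (t + of_int n) = circ t * cis (2 * pi * of_int n)"
    by (simp only: cis_mult ring_distribs)
  then show ?thesis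
    using cis_multiple_2pi[of "of_int n"] by simp
qed

lemma circ_surj:
  assumes "z \<in> sphere 0 1"
  obtains t where "0 \<le> t" "t < 1" "z = circ t"
proof -
  have "z = cis (Arg2pi z)"
    using assms Arg2pi_eq[of z] by (simp add: cis_conv_exp mult.commute)
  then have "z = circ (Arg2pi z / (2 * pi))"
    by simp
  moreover have "0 \<le> Arg2pi z / (2 * pi)" "Arg2pi z / (2 * pi) < 1"
    using Arg2pi_ge_0 Arg2pi_lt_2pi by auto
  ultimately show ?thesis
    using that by blast
qed

lemma circ_eq_iff: "circ s = circ t \<longleftrightarrow> (\<exists>n::int. s = t + of_int n)"
proof
  assume "circ s = circ t"
  then have "cos (2 * pi * s) = cos (2 * pi * t) \<and> sin (2 * pi * s) = sin (2 * pi * t)"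
    by (simp add: complex_eq_iff)
  then obtain n :: int where "2 * pi * s = 2 * pi * t + 2 * pi * of_int n"
    using sin_cos_eq_iff[of "2 * pi * s" "2 * pi * t"] by (auto simp: mult_ac)
  then have "2 * pi * s = 2 * pi * (t + of_int n)"
    by (simp add: distrib_left)
  then have "s = t + of_int n"
    by simp
  then show "\<exists>n::int. s = t + of_int n" ..
qed (auto simp: circ_add_int)

lemma space_circle_measure [simp]: "space circle_measure = UNIV"
  by (simp add: circle_measure_def)

lemma borel_sets_circle_measure [intro]:
  "A \<in> sets borel \<Longrightarrow> A \<in> sets circle_measure"
  by (simp add: circle_measure_def)

lemma borel_measurable_circle_measure:
  "f \<in> borel_measurable borel \<Longrightarrow> f \<in> borel_measurable circle_measure"
  unfolding circle_measure_def by (intro measurable_completion) simp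

text \<open>The completion changes nothing on Borel sets, so measures on the circle are lengths of
  parameter sets in \<open>[0, 1)\<close>. Later computations reduce to this formula.\<close>

lemma emeasure_circle_measure:
  assumes "A \<in> sets borel"
  shows "emeasure circle_measure A = emeasure lborel {t \<in> {0..<1}. circ t \<in> A}"
proof -
  have c: "circ \<in> borel_measurable (restrict_space lborel {0..<1})"
    by (intro measurable_restrict_space1) simp
  have "circ -` A \<inter> {0..<1} = {t \<in> {0..<1}. circ t \<in> A}"
    by auto
  moreover have "A \<in> sets (distr (restrict_space lborel {0..<1}) borel circ)"
    using assms by simp
  then have "emeasure circle_measure A =
      emeasure (distr (restrict_space lborel {0..<1}) borel circ) A"
    unfolding circle_measure_def by (simp only: emeasure_completion main_part sets_completionI_sets)
  moreover have "\<dots> = emeasure (restrict_space lborel {0..<1}) (circ -` A \<inter> {0..<1})"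
    using emeasure_distr[OF c assms] by (simp only: space_restrict_space space_lborel space_borel Int_UNIV_right)
  moreover have "\<dots> = emeasure lborel (circ -` A \<inter> {0..<1})"
    by (rule emeasure_restrict_space) (simp_all only: space_lborel sets_lborel space_borel Int_UNIV_left, auto)
  ultimately show ?thesis
    by simp
qed

lemma finite_measure_circle_measure: "finite_measure circle_measure"
proof
  have "{t \<in> {0..<1}. circ t \<in> UNIV} = {0..<1}"
    by auto
  then show "emeasure circle_measure (space circle_measure) \<noteq> \<infinity>"
    using emeasure_circle_measure[of UNIV] by simp
qed

interpretation circle: finite_measure circle_measure
  by (rule finite_measure_circle_measure)

lemma measure_circle_measure:
  assumes "A \<in> sets borel"
  shows "measure circle_measure A = measure lborel {t \<in> {0..<1}. circ t \<in> A}"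
  by (simp add: measure_def emeasure_circle_measure assms)

text \<open>\<open>circ t\<close> never leaves the unit circle, so the rest of the plane is null.
  Estimates valid only for \<open>cmod z = 1\<close> may thus be used under integrals over
  \<open>circle_measure\<close>.\<close>

lemma AE_sphere: "AE z in circle_measure. z \<in> sphere 0 1"
proof (rule AE_I')
  show "- sphere 0 1 \<in> null_sets circle_measure"
    by (auto simp: null_sets_def emeasure_circle_measure)
qed auto

lemma measure_UNIV_circle [simp]: "measure circle_measure UNIV = 1"
proof -
  have "{t \<in> {0..<1}. circ t \<in> UNIV} = {0..<1}"
    by auto
  then show ?thesis
    using measure_circle_measure[of UNIV] by simp
qed

lemma integrable_circle_continuous:
  fixes f :: "complex \<Rightarrow> 'a::{banach,second_countable_topology}"
  assumes "continuous_on UNIV f"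
  shows "integrable circle_measure f"
proof -
  have "bounded (f ` sphere 0 1)"
    using assms by (intro compact_imp_bounded compact_continuous_image compact_sphere)
      (auto intro: continuous_on_subset)
  then obtain C where "\<And>z. z \<in> sphere 0 1 \<Longrightarrow> norm (f z) \<le> C"
    unfolding bounded_iff by blast
  then have "AE z in circle_measure. norm (f z) \<le> C"
    using AE_sphere by (auto elim!: eventually_mono)
  then show ?thesis
    using assms by (intro circle.integrable_const_bound) (auto intro: borel_measurable_continuous_onI borel_measurable_circle_measure)
qed

lemma integral_circle_continuous:
  fixes f :: "complex \<Rightarrow> complex"
  assumes "continuous_on UNIV f"
  shows "integral\<^sup>L circle_measure f = integral {0..1} (\<lambda>t. f (circ t))"
proof -
  have [measurable]: "circ \<in> borel_measurable (restrict_space lborel {0..<1})"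
    by (intro measurable_restrict_space1) simp
  have [measurable]: "f \<in> borel_measurable borel"
    by (rule borel_measurable_continuous_onI[OF assms])
  have c: "continuous_on S (\<lambda>t. f (circ t))" for S
    by (intro continuous_on_compose2[OF assms] continuous_intros) auto
  have "integral\<^sup>L circle_measure f = (LINT t|restrict_space lborel {0..<1}. f (circ t))"
    unfolding circle_measure_def by (simp add: integral_completion integral_distr)
  also have "\<dots> = (LINT t:{0..<1}|lborel. f (circ t))"
    by (subst integral_restrict_space) (auto simp: set_lebesgue_integral_def)
  \<comment> \<open>Adding the null point \<open>1\<close> gives a compact interval, on which the
    continuous integrand has a gauge integral and the fundamental theorem of calculus is
    available.\<close>
  also have "\<dots> = (LINT t:{0..1}|lborel. f (circ t))"
    unfolding set_lebesgue_integral_def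
  proof (rule integral_cong_AE)
    have "AE t in lborel. t \<noteq> (1::real)"
      by (rule AE_lborel_singleton)
    then show "AE t in lborel. indicator {0..<1} t *\<^sub>R f (circ t) = indicator {0..1} t *\<^sub>R f (circ t)"
      by eventually_elim (auto simp: indicator_def)
  qed auto
  also have "\<dots> = integral {0..1} (\<lambda>t. f (circ t))"
    by (intro set_borel_integral_eq_integral borel_integrable_atLeastAtMost' c)
  finally show ?thesis .
qed

text \<open>For \<open>k > 0\<close> the power is \<open>exp (c * t)\<close> in the parameter, and
  its primitive \<open>exp (c * t) / c\<close> takes the same value at \<open>0\<close> and at
  \<open>1\<close>.\<close>

lemma integral_circle_power: "integral\<^sup>L circle_measure (\<lambda>z. z ^ k) = of_bool (k = 0)"
proof (cases "k = 0")
  case False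
  define c where "c = \<i> * of_real (2 * pi * real k)"
  have c0: "c \<noteq> 0"
    using False by (simp add: c_def)
  have eq: "circ t ^ k = exp (c * of_real t)" for t
    unfolding Complex.DeMoivre unfolding cis_conv_exp by (simp add: c_def mult_ac)
  have d: "((\<lambda>t. exp (c * t) / c) has_field_derivative exp (c * t)) (at t within S)" for t S
    using c0 by (auto intro!: derivative_eq_intros)
  have "((\<lambda>t. exp (c * of_real t)) has_integral exp (c * of_real 1) / c - exp (c * of_real 0) / c) {0..1}"
    by (rule fundamental_theorem_of_calculus)
       (auto intro!: has_vector_derivative_real_field d)
  moreover have "exp (c * of_real 1) = 1"
    using eq[of 1] by simp
  ultimately have "((\<lambda>t. circ t ^ k) has_integral 0) {0..1}"
    by (simp add: eq)
  then show ?thesis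
    using False by (subst integral_circle_continuous) (auto intro!: continuous_intros)
qed (simp add: measure_circle_measure)

text \<open>The mean value property at the centre: only the constant term has a nonzero
  mean.\<close>

lemma integral_circle_poly: "integral\<^sup>L circle_measure (poly P) = poly P 0"
proof -
  have "integral\<^sup>L circle_measure (poly P) =
      (\<Sum>i\<le>degree P. coeff P i * integral\<^sup>L circle_measure (\<lambda>z. z ^ i))"
    unfolding poly_altdef
    by (subst Bochner_Integration.integral_sum)
       (auto intro!: integrable_circle_continuous continuous_intros)
  also have "\<dots> = (\<Sum>i\<le>degree P. if i = 0 then coeff P i else 0)"
    by (intro sum.cong) (auto simp: integral_circle_power)
  also have "\<dots> = coeff P 0"
    by (simp only: sum.delta finite_atMost) auto
  finally show ?thesis
    by (simp add: poly_0_coeff_0)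
qed

section \<open>Scaling the parameter: invariance and equidistribution\<close>

lemma emeasure_lborel_affine:
  fixes c :: real
  assumes "c > 0" "B \<in> sets borel"
  shows "emeasure lborel B = ennreal c * emeasure lborel {x. t + c * x \<in> B}"
proof -
  have "emeasure lborel B = emeasure (density (distr lborel borel (\<lambda>x. t + c * x)) (\<lambda>_. ennreal \<bar>c\<bar>)) B"
    using lborel_real_affine[of c t] assms by simp
  also have "\<dots> = ennreal c * emeasure lborel {x. t + c * x \<in> B}"
    using assms by (simp add: emeasure_density_const emeasure_distr vimage_def)
  finally show ?thesis .
qed

lemma sets_circ_preimage [measurable]:
  assumes "A \<in> sets borel" "S \<in> sets borel"
  shows "{t \<in> S. circ (c * t) \<in> A} \<in> sets borel" "{t \<in> S. circ t \<in> A} \<in> sets borel"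
proof -
  have m: "(\<lambda>t. circ (c * t)) \<in> borel_measurable borel" for c
    by (intro borel_measurable_continuous_onI continuous_intros)
  have "{t \<in> S. circ (c * t) \<in> A} \<in> sets borel" for c
    using measurable_sets_borel[OF m assms(1)] assms(2) by (simp add: vimage_def Collect_conj_eq)
  from this[of c] this[of 1]
  show "{t \<in> S. circ (c * t) \<in> A} \<in> sets borel" "{t \<in> S. circ t \<in> A} \<in> sets borel"
    by auto
qed


lemma measure_lborel_affine:
  fixes c :: real
  assumes "c > 0" "B \<in> sets borel"
  shows "measure lborel B = c * measure lborel {x. t + c * x \<in> B}"
  unfolding measure_def using emeasure_lborel_affine[OF assms, of t] assms
  by (simp add: enn2real_mult)

lemma fmeasurable_circ_preimage:
  assumes "A \<in> sets borel" "S \<in> sets borel" "bounded S"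
  shows "{t \<in> S. circ t \<in> A} \<in> fmeasurable lborel" "{t \<in> S. circ (c * t) \<in> A} \<in> fmeasurable lborel"
proof -
  have "S \<in> fmeasurable lborel"
    using assms(2) emeasure_bounded_finite[OF assms(3)] by (simp add: fmeasurable_def)
  then show "{t \<in> S. circ t \<in> A} \<in> fmeasurable lborel" "{t \<in> S. circ (c * t) \<in> A} \<in> fmeasurable lborel"
    using assms by (auto intro!: fmeasurableI2[of S] simp: sets_circ_preimage)
qed

text \<open>Each \<open>[q, q + 1)\<close> is an integer translate of \<open>[0, 1)\<close>, over
  which \<open>circ\<close> runs through the circle once; the periods are added up by
  induction.\<close>

lemma measure_circ_period:
  fixes p q :: int
  assumes A: "A \<in> sets borel" and "p \<le> q"
  shows "measure lborel {t \<in> {of_int p..<of_int q}. circ t \<in> A} = of_int (q - p) * measure circle_measure A"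
  using \<open>p \<le> q\<close>
proof (induction q rule: int_ge_induct)
  case (step q)
  have fin: "{t \<in> {a..<b}. circ t \<in> A} \<in> fmeasurable lborel" for a b
    by (rule fmeasurable_circ_preimage) (use A in auto)
  have "measure lborel {t \<in> {of_int q..<of_int (q + 1)}. circ t \<in> A} =
      1 * measure lborel {x. of_int q + 1 * x \<in> {t \<in> {of_int q..<of_int (q + 1)}. circ t \<in> A}}"
    by (rule measure_lborel_affine) (use A in \<open>auto simp: sets_circ_preimage\<close>)
  also have "{x. of_int q + 1 * x \<in> {t \<in> {of_int q..<of_int (q + 1)}. circ t \<in> A}} =
      {t \<in> {0..<1}. circ t \<in> A}"
    using circ_add_int[of _ q] by (auto simp: add.commute)
  finally have "measure lborel {t \<in> {of_int q..<of_int (q + 1)}. circ t \<in> A} = measure circle_measure A"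
    by (simp add: measure_circle_measure A)
  moreover have "{t \<in> {of_int p..<of_int (q + 1)}. circ t \<in> A} =
      {t \<in> {of_int p..<of_int q}. circ t \<in> A} \<union> {t \<in> {of_int q..<of_int (q + 1)}. circ t \<in> A}"
    using step.hyps by auto
  moreover have "measure lborel ({t \<in> {of_int p..<of_int q}. circ t \<in> A} \<union> {t \<in> {of_int q..<of_int (q + 1)}. circ t \<in> A})
      = measure lborel {t \<in> {of_int p..<of_int q}. circ t \<in> A} + measure lborel {t \<in> {of_int q..<of_int (q + 1)}. circ t \<in> A}"
    by (rule measure_Un2[THEN trans]) (use fin in \<open>auto intro!: arg_cong[where f = "measure lborel"]\<close>)
  ultimately show ?case
    using step.IH by (simp add: algebra_simps)
qed simp

text \<open>The map taking \<open>z\<close> to \<open>z ^ m\<close> preserves the circle measure: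
  \<open>t\<close> to \<open>m * t\<close> stretches \<open>[0, 1)\<close> over exactly
  \<open>m\<close> periods, and rescaling divides by \<open>m\<close> again.\<close>

lemma measure_circ_scaled:
  fixes m :: nat
  assumes A: "A \<in> sets borel" and m: "m > 0"
  shows "measure lborel {t \<in> {0..<1}. circ (real m * t) \<in> A} = measure circle_measure A"
proof -
  have "measure lborel {t \<in> {of_int 0..<of_int (int m)}. circ t \<in> A} =
      real m * measure lborel {x. 0 + real m * x \<in> {t \<in> {of_int 0..<of_int (int m)}. circ t \<in> A}}"
    by (rule measure_lborel_affine) (use A m in \<open>auto simp: sets_circ_preimage\<close>)
  also have "{x. 0 + real m * x \<in> {t \<in> {of_int 0..<of_int (int m)}. circ t \<in> A}} =
      {t \<in> {0..<1}. circ (real m * t) \<in> A}"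
    using m by (auto simp: zero_le_mult_iff)
  finally show ?thesis
    using m measure_circ_period[OF A, of 0 "int m"] by simp
qed

text \<open>Equidistribution at scale \<open>1 / m\<close>: the stretched interval contains all but
  a length of at most \<open>2\<close> in full periods, and this loss becomes \<open>2 / m\<close>
  after rescaling.\<close>

lemma measure_circ_scaled_ge:
  fixes m :: nat
  assumes A: "A \<in> sets borel" and m: "m > 0"
  shows "measure circle_measure A * (b - a - 2 / m) \<le> measure lborel {t \<in> {a<..<b}. circ (real m * t) \<in> A}"
proof (cases "b - a - 2 / m \<le> 0")
  case True
  then show ?thesis
    by (meson measure_nonneg mult_nonneg_nonpos order_trans)
next
  case False
  \<comment> \<open>The full periods inside \<open>(m * a, m * b)\<close>. The \<open>+ 1\<close>
    makes \<open>p\<close> strictly larger than \<open>m * a\<close>, so that the half-open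
    \<open>[p, q)\<close> fits into the open interval.\<close>
  define p q where "p = \<lfloor>m * a\<rfloor> + 1" and "q = \<lfloor>m * b\<rfloor>"
  have "m * (b - a - 2 / m) > 0"
    using False m by simp
  then have *: "m * b - m * a - 2 > 0"
    using m by (simp add: algebra_simps)
  have pq: "of_int p > m * a" "of_int p \<le> m * a + 1" "of_int q \<le> m * b" "of_int q > m * b - 1"
    unfolding p_def q_def by linarith+
  have "real_of_int p < of_int q + 1"
    using * pq by linarith
  then have "p \<le> q"
    by linarith
  let ?B = "{t \<in> {m * a<..<m * b}. circ t \<in> A}"
  have "measure circle_measure A * (b - a - 2 / m) = measure circle_measure A * (m * b - m * a - 2) / m"
    using m by (simp add: field_simps)
  also have "\<dots> \<le> measure lborel ?B / m"
  proof (intro divide_right_mono)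
    have "m * b - m * a - 2 \<le> of_int (q - p)"
      using pq by simp
    then have "measure circle_measure A * (m * b - m * a - 2) \<le> of_int (q - p) * measure circle_measure A"
      by (metis measure_nonneg mult.commute mult_right_mono)
    also have "\<dots> = measure lborel {t \<in> {of_int p..<of_int q}. circ t \<in> A}"
      using measure_circ_period[OF A \<open>p \<le> q\<close>] by simp
    also have "\<dots> \<le> measure lborel ?B"
      using pq A by (intro measure_mono_fmeasurable fmeasurable_circ_preimage) (auto simp: sets_circ_preimage)
    finally show "measure circle_measure A * (m * b - m * a - 2) \<le> measure lborel ?B" .
  qed simp
  also have "\<dots> = measure lborel {x. 0 + real m * x \<in> ?B}"
    using m measure_lborel_affine[of "real m" ?B 0] A by (simp add: sets_circ_preimage)
  also have "{x. 0 + real m * x \<in> ?B} = {t \<in> {a<..<b}. circ (real m * t) \<in> A}"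
    using m by auto
  finally show ?thesis .
qed

section \<open>Laurent polynomials on the circle\<close>

section \<open>Trigonometric polynomials\<close>

text \<open>On the circle \<open>cnj z\<close> is the inverse of \<open>z\<close>, so these are
  Laurent polynomials with a pole of order at most \<open>d\<close> at \<open>0\<close>. The values
  of \<open>q\<close> off the circle are left free.\<close>

definition trig_poly :: "(complex \<Rightarrow> complex) \<Rightarrow> bool" where
  "trig_poly q \<longleftrightarrow> (\<exists>P d. \<forall>z\<in>sphere 0 1. q z = poly P z * cnj z ^ d)"

lemma trig_polyI: "(\<And>z. cmod z = 1 \<Longrightarrow> q z = poly P z * cnj z ^ d) \<Longrightarrow> trig_poly q"
  unfolding trig_poly_def by auto

lemma sphere_mult_cnj: "cmod z = 1 \<Longrightarrow> z ^ n * cnj z ^ n = 1"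
  by (simp add: power_mult_distrib[symmetric] complex_norm_square[symmetric])

lemma trig_poly_poly: "trig_poly (poly P)"
  by (rule trig_polyI[of _ P 0]) simp

lemma trig_poly_const: "trig_poly (\<lambda>z. c)"
  by (rule trig_polyI[of _ "[:c:]" 0]) simp

lemma trig_poly_cnj_ident: "trig_poly cnj"
  by (rule trig_polyI[of _ 1 1]) simp

text \<open>The two powers of \<open>cnj z\<close> are brought to the common exponent
  \<open>a + b\<close> by inserting factors \<open>z ^ n * cnj z ^ n\<close>, which are
  \<open>1\<close> on the circle.\<close>

lemma trig_poly_add:
  assumes "trig_poly p" "trig_poly q"
  shows "trig_poly (\<lambda>z. p z + q z)"
proof -
  obtain P a Q b where P: "\<And>z. z \<in> sphere 0 1 \<Longrightarrow> p z = poly P z * cnj z ^ a"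
    and Q: "\<And>z. z \<in> sphere 0 1 \<Longrightarrow> q z = poly Q z * cnj z ^ b"
    using assms unfolding trig_poly_def by blast
  show ?thesis
  proof (rule trig_polyI)
    fix z :: complex assume z: "cmod z = 1"
    have "p z + q z = poly P z * cnj z ^ a * (z ^ b * cnj z ^ b) + poly Q z * cnj z ^ b * (z ^ a * cnj z ^ a)"
      using P Q z by (simp add: sphere_mult_cnj)
    also have "\<dots> = poly (P * monom 1 b + Q * monom 1 a) z * cnj z ^ (a + b)"
      by (simp add: poly_monom power_add algebra_simps)
    finally show "p z + q z = poly (P * monom 1 b + Q * monom 1 a) z * cnj z ^ (a + b)" .
  qed
qed

lemma trig_poly_mult:
  assumes "trig_poly p" "trig_poly q"
  shows "trig_poly (\<lambda>z. p z * q z)"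
proof -
  obtain P a Q b where P: "\<And>z. z \<in> sphere 0 1 \<Longrightarrow> p z = poly P z * cnj z ^ a"
    and Q: "\<And>z. z \<in> sphere 0 1 \<Longrightarrow> q z = poly Q z * cnj z ^ b"
    using assms unfolding trig_poly_def by blast
  show ?thesis
    by (rule trig_polyI[of _ "P * Q" "a + b"]) (simp add: P Q power_add mult_ac)
qed

lemma trig_poly_cnj_poly: "trig_poly (\<lambda>z. cnj (poly P z))"
  by (induction P) (auto intro!: trig_poly_add trig_poly_mult trig_poly_const trig_poly_cnj_ident)

lemma trig_poly_Re_poly: "trig_poly (\<lambda>z. of_real (Re (poly P z)))"
proof -
  have "trig_poly (\<lambda>z. (1 / 2) * (poly P z + cnj (poly P z)))"
    by (rule trig_poly_mult[OF trig_poly_const trig_poly_add[OF trig_poly_poly trig_poly_cnj_poly]])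
  moreover have "(\<lambda>z. (1 / 2) * (poly P z + cnj (poly P z))) = (\<lambda>z. of_real (Re (poly P z)))"
    by (rule ext) (simp only: complex_add_cnj, simp)
  ultimately show ?thesis
    by (simp only:)
qed

text \<open>A real linear functional on the plane is the real part of \<open>z\<close> times a
  complex constant; constants, sums and products are closure properties. This makes
  Stone-Weierstrass applicable.\<close>

lemma trig_poly_real_polynomial_function:
  "real_polynomial_function g \<Longrightarrow> trig_poly (\<lambda>z. of_real (g z))"
proof (induction g rule: real_polynomial_function.induct)
  case (linear f)
  interpret bounded_linear f by fact
  define a b where "a = f 1" and "b = f \<i>"
  have "f z = Re (poly [:0, of_real a - \<i> * of_real b:] z)" for z
  proof -
    have "f (Re z *\<^sub>R 1 + Im z *\<^sub>R \<i>) = Re z * a + Im z * b"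
      by (simp only: add scaleR real_scaleR_def a_def b_def)
    moreover have "Re z *\<^sub>R 1 + Im z *\<^sub>R \<i> = z"
      by (simp add: complex_eq_iff)
    ultimately show ?thesis
      by simp
  qed
  then show ?case
    by (simp only: trig_poly_Re_poly)
qed (simp_all add: trig_poly_const trig_poly_add trig_poly_mult)

text \<open>Multiplication by \<open>z ^ d\<close> clears the pole. It matters that \<open>P\<close>
  and \<open>d\<close> do not depend on \<open>n\<close>: the frequency can then be raised while
  \<open>P\<close> stays fixed.\<close>

lemma trig_poly_times_power:
  assumes "trig_poly q"
  shows "\<exists>P d. \<forall>n z. cmod z = 1 \<longrightarrow> q z * z ^ (n + d) = poly (P * monom 1 n) z"
proof -
  obtain P d where P: "\<And>z. z \<in> sphere 0 1 \<Longrightarrow> q z = poly P z * cnj z ^ d"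
    using assms unfolding trig_poly_def by blast
  show ?thesis
  proof (intro exI allI impI)
    fix n and z :: complex assume z: "cmod z = 1"
    have "q z * z ^ (n + d) = poly P z * z ^ n * (z ^ d * cnj z ^ d)"
      using P z by (simp add: power_add mult_ac)
    then show "q z * z ^ (n + d) = poly (P * monom 1 n) z"
      using z by (simp add: sphere_mult_cnj poly_monom)
  qed
qed

text \<open>For \<open>M\<close> beyond the order of the pole the integrand is, on the circle, a
  polynomial vanishing at \<open>0\<close>. Continuity supplies measurability off the
  circle.\<close>

lemma trig_poly_integral_eventually_0:
  assumes "trig_poly q" and q: "continuous_on UNIV q"
  shows "\<exists>d. \<forall>M>d. integral\<^sup>L circle_measure (\<lambda>z. q z * z ^ M) = 0"
proof -
  obtain P d where P: "\<And>n z. cmod z = 1 \<Longrightarrow> q z * z ^ (n + d) = poly (P * monom 1 n) z"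
    using trig_poly_times_power[OF assms(1)] by blast
  show ?thesis
  proof (intro exI allI impI)
    fix M assume "M > d"
    then obtain n where M: "M = n + d" "n > 0"
      by (metis add.commute less_imp_add_positive)
    have "integral\<^sup>L circle_measure (\<lambda>z. q z * z ^ M) = integral\<^sup>L circle_measure (poly (P * monom 1 n))"
      using AE_sphere
      by (intro integral_cong_AE borel_measurable_circle_measure borel_measurable_continuous_onI
          continuous_intros q) (auto elim!: eventually_mono simp: P M(1))
    then show "integral\<^sup>L circle_measure (\<lambda>z. q z * z ^ M) = 0"
      using M(2) by (simp add: integral_circle_poly poly_monom)
  qed
qed

section \<open>Bounds on the disc from values on the circle\<close>

section \<open>Polynomials of small Bloch norm that are close to one on most of the circle\<close>

lemma poly_bounded_cball:
  "\<exists>C>0. \<forall>z::complex. cmod z \<le> 1 \<longrightarrow> cmod (poly P z) \<le> C"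
proof -
  have "bounded (poly P ` cball 0 1)"
    by (intro compact_imp_bounded compact_continuous_image continuous_intros compact_cball)
  then obtain C where C: "\<And>z. z \<in> cball 0 1 \<Longrightarrow> cmod (poly P z) \<le> C"
    unfolding bounded_iff by blast
  show ?thesis
  proof (intro exI conjI allI impI)
    show "cmod (poly P z) \<le> max C 1" if "cmod z \<le> 1" for z
      using C[of z] that by simp
  qed auto
qed

text \<open>The bound extends to the disc by the maximum principle; Cauchy's estimate on the disc of
  radius \<open>1 - cmod z\<close> about \<open>z\<close> then costs exactly the Bloch
  weight.\<close>

lemma bloch_bound_of_bounded:
  assumes hol: "f holomorphic_on UNIV" and C: "\<And>z. cmod z = 1 \<Longrightarrow> cmod (f z) \<le> C"
    and z: "cmod z < 1"
  shows "(1 - cmod z) * cmod (deriv f z) \<le> C"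
proof -
  have hol': "f holomorphic_on S" for S
    using hol by (rule holomorphic_on_subset) simp
  have bd: "cmod (f w) \<le> C" if "cmod w \<le> 1" for w
  proof (rule maximum_modulus_frontier[of f "cball 0 1"])
    show "f holomorphic_on interior (cball 0 1)" "continuous_on (closure (cball 0 1)) f"
      by (intro hol' holomorphic_on_imp_continuous_on)+
    show "bounded (cball (0::complex) 1)" "w \<in> cball 0 1"
      using that by (auto simp: bounded_cball)
    show "norm (f z) \<le> C" if "z \<in> frontier (cball 0 1)" for z
      using that C[of z] by simp
  qed
  have "norm ((deriv ^^ 1) f z) \<le> fact 1 * C / (1 - cmod z) ^ 1"
  proof (rule Cauchy_inequality)
    show "f holomorphic_on ball z (1 - cmod z)" "continuous_on (cball z (1 - cmod z)) f"
      by (intro hol' holomorphic_on_imp_continuous_on)+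
    show "norm (f x) \<le> C" if "norm (z - x) = 1 - cmod z" for x
      using that norm_triangle_ineq2[of x z] by (intro bd) (simp add: norm_minus_commute)
  qed (use z in auto)
  then show ?thesis
    using z by (simp add: field_simps)
qed

section \<open>The lacunary random walk and its exponential\<close>

lemma deriv_poly: "deriv (poly P) z = poly (pderiv P) z" for z :: complex
  by (rule DERIV_imp_deriv) (rule poly_DERIV)

text \<open>By the product rule the derivative on the smaller disc is of order
  \<open>n * r ^ (n - 1)\<close>, which tends to \<open>0\<close>.\<close>

lemma pderiv_high_frequency_small:
  fixes P :: "complex poly"
  assumes "0 \<le> r" "r < 1" "e > 0"
  shows "\<forall>\<^sub>F n in sequentially. \<forall>z. cmod z \<le> r \<longrightarrow> cmod (poly (pderiv (P * monom 1 n)) z) \<le> e"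
proof -
  obtain C where C: "C > 0" "\<And>z. cmod z \<le> 1 \<Longrightarrow> cmod (poly P z) \<le> C"
    using poly_bounded_cball[of P] by blast
  obtain D where D: "D > 0" "\<And>z. cmod z \<le> 1 \<Longrightarrow> cmod (poly (pderiv P) z) \<le> D"
    using poly_bounded_cball[of "pderiv P"] by blast
  have r0: "(\<lambda>n. r ^ n) \<longlonglongrightarrow> 0"
    using assms by (intro LIMSEQ_power_zero) auto
  have "(\<lambda>n. of_nat n * r ^ n) \<longlonglongrightarrow> 0"
    using assms by (intro powser_times_n_limit_0) auto
  then have "(\<lambda>n. of_nat n * r ^ n + r ^ n) \<longlonglongrightarrow> 0 + 0"
    using r0 by (rule tendsto_add)
  moreover have "of_nat n * r ^ n + r ^ n = of_nat (Suc n) * r ^ (Suc n - 1)" for n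
    by (simp add: algebra_simps)
  ultimately have "(\<lambda>n. of_nat (Suc n) * r ^ (Suc n - 1)) \<longlonglongrightarrow> 0"
    by (simp only: add_0_left)
  then have "(\<lambda>n. of_nat n * r ^ (n - 1)) \<longlonglongrightarrow> 0"
    by (rule filterlim_sequentially_Suc[THEN iffD1])
  with r0 have "(\<lambda>n. D * r ^ n + C * (of_nat n * r ^ (n - 1))) \<longlonglongrightarrow> D * 0 + C * 0"
    by (intro tendsto_add tendsto_mult_left)
  then have "\<forall>\<^sub>F n in sequentially. D * r ^ n + C * (of_nat n * r ^ (n - 1)) < e"
    using assms by (intro order_tendstoD) auto
  then show ?thesis
  proof eventually_elim
    case (elim n)
    show ?case
    proof (intro allI impI)
      fix z :: complex assume z: "cmod z \<le> r"
      have "poly (pderiv (P * monom 1 n)) z = poly (pderiv P) z * z ^ n + poly P z * (of_nat n * z ^ (n - 1))"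
        by (simp add: pderiv_mult pderiv_monom poly_monom algebra_simps)
      also have "cmod \<dots> \<le> cmod (poly (pderiv P) z) * cmod z ^ n + cmod (poly P z) * (of_nat n * cmod z ^ (n - 1))"
        by (rule order_trans[OF norm_triangle_ineq]) (simp add: norm_mult norm_power)
      also have "\<dots> \<le> D * r ^ n + C * (of_nat n * r ^ (n - 1))"
        using C D z assms by (intro add_mono mult_mono power_mono) auto
      finally show "cmod (poly (pderiv (P * monom 1 n)) z) \<le> e"
        using elim by simp
    qed
  qed
qed

text \<open>The distances of the new point to \<open>1\<close> and \<open>-1\<close> factor as
  \<open>(1 - x) * (1 - t * (1 + x))\<close> and \<open>(1 + x) * (1 + t * (1 - x))\<close>, with
  nonnegative factors.\<close>

lemma step_in_unit_interval:
  fixes x t :: real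
  assumes "\<bar>x\<bar> \<le> 1" "\<bar>t\<bar> \<le> 1 / 2"
  shows "\<bar>x + t * (1 - x\<^sup>2)\<bar> \<le> 1"
proof -
  have "\<bar>t * (1 + x)\<bar> \<le> (1 / 2) * 2" "\<bar>t * (1 - x)\<bar> \<le> (1 / 2) * 2"
    unfolding abs_mult using assms by (intro mult_mono; linarith)+
  then have "0 \<le> (1 - x) * (1 - t * (1 + x))" "0 \<le> (1 + x) * (1 + t * (1 - x))"
    using assms by (intro mult_nonneg_nonneg; linarith)+
  then show ?thesis
    by (simp add: abs_le_iff algebra_simps power2_eq_square)
qed

text \<open>One step of the walk. The derivatives of \<open>\<psi>\<close> and of the increment are
  relevant in different regions of the disc, so the Bloch bound grows by \<open>e\<close> only and
  not by \<open>\<eta>\<close>. In the energy the terms of frequency \<open>M\<close> and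
  \<open>2 * M\<close> have mean zero.\<close>

lemma bloch_step:
  fixes \<psi> :: "complex poly"
  defines "u \<equiv> \<lambda>z. Re (poly \<psi> z)"
  assumes \<eta>: "0 < \<eta>" "\<eta> \<le> 1 / 2" and e: "e > 0"
    and u: "\<And>z. cmod z = 1 \<Longrightarrow> \<bar>u z\<bar> \<le> 1"
    and B: "\<And>z. cmod z < 1 \<Longrightarrow> (1 - cmod z) * cmod (poly (pderiv \<psi>) z) \<le> B" "2 * \<eta> \<le> B"
  shows "\<exists>\<psi>'. poly \<psi>' 0 = poly \<psi> 0 \<and> (\<forall>z. cmod z = 1 \<longrightarrow> \<bar>Re (poly \<psi>' z)\<bar> \<le> 1) \<and>
    (\<forall>z. cmod z < 1 \<longrightarrow> (1 - cmod z) * cmod (poly (pderiv \<psi>') z) \<le> B + e) \<and>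
    (\<integral>z. (Re (poly \<psi>' z))\<^sup>2 \<partial>circle_measure) =
      (\<integral>z. (u z)\<^sup>2 \<partial>circle_measure) + \<eta>\<^sup>2 / 2 * (\<integral>z. (1 - (u z)\<^sup>2)\<^sup>2 \<partial>circle_measure)"
proof -
  define q where "q = (\<lambda>z. complex_of_real (1 - (u z)\<^sup>2))"
  define q1 where "q1 = (\<lambda>z. complex_of_real (u z * (1 - (u z)\<^sup>2)))"
  define q2 where "q2 = (\<lambda>z. complex_of_real ((1 - (u z)\<^sup>2)\<^sup>2))"
  have tu: "trig_poly (\<lambda>z. of_real (u z))"
    unfolding u_def by (rule trig_poly_Re_poly)
  have "trig_poly (\<lambda>z. 1 + (-1) * (of_real (u z) * of_real (u z)))"
    by (rule trig_poly_add[OF trig_poly_const trig_poly_mult[OF trig_poly_const trig_poly_mult[OF tu tu]]])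
  then have tq: "trig_poly q"
    by (simp add: q_def power2_eq_square)
  have tq1: "trig_poly q1" and tq2: "trig_poly q2"
    using trig_poly_mult[OF tu tq] trig_poly_mult[OF tq tq]
    by (simp_all add: q_def q1_def q2_def power2_eq_square)
  have cont_u: "continuous_on UNIV u"
    unfolding u_def by (intro continuous_intros)
  have cont: "continuous_on UNIV q1" "continuous_on UNIV q2"
    unfolding q1_def q2_def by (intro continuous_intros cont_u)+
  obtain P d where P: "\<And>n z. cmod z = 1 \<Longrightarrow> q z * z ^ (n + d) = poly (P * monom 1 n) z"
    using trig_poly_times_power[OF tq] by blast
  obtain d1 where d1: "\<And>M. M > d1 \<Longrightarrow> integral\<^sup>L circle_measure (\<lambda>z. q1 z * z ^ M) = 0"
    using trig_poly_integral_eventually_0[OF tq1 cont(1)] by blast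
  obtain d2 where d2: "\<And>M. M > d2 \<Longrightarrow> integral\<^sup>L circle_measure (\<lambda>z. q2 z * z ^ M) = 0"
    using trig_poly_integral_eventually_0[OF tq2 cont(2)] by blast
  obtain C where C: "C > 0" "\<And>z. cmod z \<le> 1 \<Longrightarrow> cmod (poly (pderiv \<psi>) z) \<le> C"
    using poly_bounded_cball[of "pderiv \<psi>"] by blast
  \<comment> \<open>Since \<open>cmod (poly (pderiv \<psi>) z) \<le> C\<close>, the Bloch weight
    alone makes the contribution of \<open>\<psi>\<close> at most \<open>\<eta>\<close> beyond
    radius \<open>r\<close>.\<close>
  define r where "r = 1 - \<eta> / (C + 1)"
  have r: "0 \<le> r" "r < 1"
    using C \<eta> by (auto simp: r_def field_simps)
  \<comment> \<open>The condition \<open>n > d1 + d2\<close> kills both oscillating integrals, at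
    frequencies \<open>M\<close> and \<open>2 * M\<close>, and in particular \<open>n > 0\<close>
    makes the increment vanish at \<open>0\<close>.\<close>
  have "\<forall>\<^sub>F n in sequentially. (\<forall>z. cmod z \<le> r \<longrightarrow> cmod (poly (pderiv (P * monom 1 n)) z) \<le> e) \<and> n > d1 + d2"
    by (intro eventually_conj pderiv_high_frequency_small r e eventually_gt_at_top)
  then obtain n where n: "\<And>z. cmod z \<le> r \<Longrightarrow> cmod (poly (pderiv (P * monom 1 n)) z) \<le> e" "n > d1 + d2"
    unfolding eventually_sequentially by blast
  define M where "M = n + d"
  define g where "g = smult (of_real \<eta>) (P * monom 1 n)"
  have g_eq: "poly g z = of_real (\<eta> * (1 - (u z)\<^sup>2)) * z ^ M" if "cmod z = 1" for z
    using P[OF that, of n] by (simp add: g_def q_def M_def)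
  have g_le: "cmod (poly g z) \<le> \<eta>" if "cmod z = 1" for z
  proof -
    have "(u z)\<^sup>2 \<le> 1"
      using u[OF that] by (simp add: abs_square_le_1)
    then have "\<eta> * \<bar>1 - (u z)\<^sup>2\<bar> \<le> \<eta> * 1"
      using \<eta> by (intro mult_left_mono) auto
    then show ?thesis
      using that \<eta> by (simp only: g_eq[OF that] norm_mult norm_power norm_of_real abs_mult) simp
  qed
  have g_bloch: "(1 - cmod z) * cmod (poly (pderiv g) z) \<le> \<eta>" if "cmod z < 1" for z
    using bloch_bound_of_bounded[of "poly g" \<eta> z] g_le that by (simp add: deriv_poly holomorphic_intros)
  have g_small: "cmod (poly (pderiv g) z) \<le> e" if "cmod z \<le> r" for z
  proof -
    have "cmod (poly (pderiv g) z) = \<eta> * cmod (poly (pderiv (P * monom 1 n)) z)"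
      unfolding g_def using \<eta> by (simp only: pderiv_smult poly_smult norm_mult norm_of_real)
    also have "\<dots> \<le> 1 * e"
      using n(1)[OF that] \<eta> e by (intro mult_mono) auto
    finally show ?thesis
      by simp
  qed
  define c where "c = (\<lambda>z::complex. Re (z ^ M))"
  have c1: "\<bar>c z\<bar> \<le> 1" if "cmod z = 1" for z
    using abs_Re_le_cmod[of "z ^ M"] that by (simp add: c_def norm_power)
  have Re_eq: "Re (poly (\<psi> + g) z) = u z + \<eta> * c z * (1 - (u z)\<^sup>2)" if "cmod z = 1" for z
    by (simp only: poly_add plus_complex.sel g_eq[OF that] scaleR_conv_of_real[symmetric] scaleR_complex.sel u_def c_def)
       (simp add: mult_ac)
  show ?thesis
  proof (intro exI conjI allI impI)
    show "poly (\<psi> + g) 0 = poly \<psi> 0"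
      using n by (simp add: g_def poly_monom)
    show "\<bar>Re (poly (\<psi> + g) z)\<bar> \<le> 1" if z: "cmod z = 1" for z
    proof -
      have "\<bar>\<eta> * c z\<bar> \<le> (1 / 2) * 1"
        unfolding abs_mult using \<eta> c1[OF z] by (intro mult_mono) auto
      then show ?thesis
        using step_in_unit_interval[OF u[OF z], of "\<eta> * c z"] by (simp only: Re_eq[OF z])
    qed
    show "(1 - cmod z) * cmod (poly (pderiv (\<psi> + g)) z) \<le> B + e" if z: "cmod z < 1" for z
    proof -
      have tri: "(1 - cmod z) * cmod (poly (pderiv (\<psi> + g)) z) \<le>
          (1 - cmod z) * cmod (poly (pderiv \<psi>) z) + (1 - cmod z) * cmod (poly (pderiv g) z)"
        unfolding distrib_left[symmetric] using z
        by (intro mult_left_mono) (auto simp: pderiv_add norm_triangle_ineq)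
      show ?thesis
      \<comment> \<open>Inside, the increment costs at most \<open>e\<close>. Outside, the old and
        the new part contribute at most \<open>\<eta>\<close> each, which is covered by
        \<open>2 * \<eta> \<le> B\<close>.\<close>
      proof (cases "cmod z \<le> r")
        case True
        have "(1 - cmod z) * cmod (poly (pderiv g) z) \<le> 1 * e"
          using g_small[OF True] z by (intro mult_mono) auto
        then show ?thesis
          using tri B(1)[OF z] by simp
      next
        case False
        then have "(1 - cmod z) * cmod (poly (pderiv \<psi>) z) \<le> (\<eta> / (C + 1)) * C"
          using C z by (intro mult_mono) (auto simp: r_def)
        also have "\<dots> \<le> \<eta>"
          using C \<eta> by (simp add: field_simps)
        finally show ?thesis
          using tri g_bloch[OF z] B(2) e by simp
      qed
    qed
    let ?I = "integral\<^sup>L circle_measure"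
    have int: "integrable circle_measure f" if "continuous_on UNIV f" for f :: "complex \<Rightarrow> real"
      using that by (rule integrable_circle_continuous)
    have 1: "?I (\<lambda>z. u z * (1 - (u z)\<^sup>2) * c z) = 0"
    proof -
      have "?I (\<lambda>z. Re (q1 z * z ^ M)) = Re (?I (\<lambda>z. q1 z * z ^ M))"
        by (intro integral_Re integrable_circle_continuous continuous_intros cont)
      then show ?thesis
        using d1[of M] n(2) by (simp add: q1_def c_def M_def)
    qed
    have 2: "?I (\<lambda>z. (1 - (u z)\<^sup>2)\<^sup>2 * Re (z ^ (2 * M))) = 0"
    proof -
      have "?I (\<lambda>z. Re (q2 z * z ^ (2 * M))) = Re (?I (\<lambda>z. q2 z * z ^ (2 * M)))"
        by (intro integral_Re integrable_circle_continuous continuous_intros cont)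
      then show ?thesis
        using d2[of "2 * M"] n(2) by (simp add: q2_def M_def)
    qed
    have i1: "integrable circle_measure (\<lambda>z. (u z)\<^sup>2)"
      and i2: "integrable circle_measure (\<lambda>z. (2 * \<eta>) * (u z * (1 - (u z)\<^sup>2) * c z))"
      and i3: "integrable circle_measure (\<lambda>z. (\<eta>\<^sup>2 / 2) * (1 - (u z)\<^sup>2)\<^sup>2)"
      and i4: "integrable circle_measure (\<lambda>z. (\<eta>\<^sup>2 / 2) * ((1 - (u z)\<^sup>2)\<^sup>2 * Re (z ^ (2 * M))))"
      unfolding c_def by (intro int continuous_intros cont_u)+
    have "?I (\<lambda>z. (Re (poly (\<psi> + g) z))\<^sup>2) = ?I (\<lambda>z. (u z)\<^sup>2 + (2 * \<eta>) * (u z * (1 - (u z)\<^sup>2) * c z)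
        + (\<eta>\<^sup>2 / 2) * (1 - (u z)\<^sup>2)\<^sup>2 + (\<eta>\<^sup>2 / 2) * ((1 - (u z)\<^sup>2)\<^sup>2 * Re (z ^ (2 * M))))"
    proof (rule integral_cong_AE)
      have "(Re (poly (\<psi> + g) z))\<^sup>2 = (u z)\<^sup>2 + (2 * \<eta>) * (u z * (1 - (u z)\<^sup>2) * c z)
        + (\<eta>\<^sup>2 / 2) * (1 - (u z)\<^sup>2)\<^sup>2 + (\<eta>\<^sup>2 / 2) * ((1 - (u z)\<^sup>2)\<^sup>2 * Re (z ^ (2 * M)))"
        if z: "cmod z = 1" for z
      proof -
        have "(Re (z ^ M))\<^sup>2 + (Im (z ^ M))\<^sup>2 = 1"
          using z by (simp add: cmod_power2[symmetric] norm_power)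
        moreover have "Re (z ^ (2 * M)) = (Re (z ^ M))\<^sup>2 - (Im (z ^ M))\<^sup>2"
          by (simp add: mult.commute[of 2 M] power_mult power2_eq_square)
        \<comment> \<open>The double angle formula; it replaces the square of \<open>c z\<close> by
          the mean \<open>1 / 2\<close> and a term of frequency \<open>2 * M\<close>.\<close>
        ultimately have *: "Re (z ^ (2 * M)) = 2 * (c z)\<^sup>2 - 1"
          unfolding c_def by linarith
        show ?thesis
          unfolding Re_eq[OF z] * by (simp add: power2_eq_square algebra_simps)
      qed
      then show "AE z in circle_measure. (Re (poly (\<psi> + g) z))\<^sup>2 = (u z)\<^sup>2 + (2 * \<eta>) * (u z * (1 - (u z)\<^sup>2) * c z)
        + (\<eta>\<^sup>2 / 2) * (1 - (u z)\<^sup>2)\<^sup>2 + (\<eta>\<^sup>2 / 2) * ((1 - (u z)\<^sup>2)\<^sup>2 * Re (z ^ (2 * M)))"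
        using AE_sphere by (auto elim!: eventually_mono)
    qed (auto simp: c_def intro!: borel_measurable_circle_measure borel_measurable_continuous_onI continuous_intros cont_u)
    also have "\<dots> = ?I (\<lambda>z. (u z)\<^sup>2) + (2 * \<eta>) * ?I (\<lambda>z. u z * (1 - (u z)\<^sup>2) * c z)
        + (\<eta>\<^sup>2 / 2) * ?I (\<lambda>z. (1 - (u z)\<^sup>2)\<^sup>2) + (\<eta>\<^sup>2 / 2) * ?I (\<lambda>z. (1 - (u z)\<^sup>2)\<^sup>2 * Re (z ^ (2 * M)))"
      by (simp only: Bochner_Integration.integral_add Bochner_Integration.integrable_add i1 i2 i3 i4
          integral_mult_right_zero)
    finally show "?I (\<lambda>z. (Re (poly (\<psi> + g) z))\<^sup>2) = ?I (\<lambda>z. (u z)\<^sup>2) + \<eta>\<^sup>2 / 2 * ?I (\<lambda>z. (1 - (u z)\<^sup>2)\<^sup>2)"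
      by (simp add: 1 2)
  qed
qed

text \<open>As long as the defect \<open>F\<close> exceeds \<open>\<tau>\<close>, a step raises the
  energy \<open>G\<close> by at least \<open>h\<^sup>2 / 2 * \<tau>\<close>. As \<open>G\<close>
  never exceeds \<open>1\<close>, the defect must become small within \<open>N\<close>
  steps.\<close>

lemma bloch_two_valued:
  assumes "0 < \<eta>" "\<bar>m\<bar> \<le> 1" "0 < \<tau>"
  shows "\<exists>\<psi>. poly \<psi> 0 = of_real m \<and> (\<forall>z. cmod z = 1 \<longrightarrow> \<bar>Re (poly \<psi> z)\<bar> \<le> 1) \<and>
    (\<forall>z. cmod z < 1 \<longrightarrow> (1 - cmod z) * cmod (poly (pderiv \<psi>) z) \<le> \<eta>) \<and>
    (\<integral>z. (1 - (Re (poly \<psi> z))\<^sup>2)\<^sup>2 \<partial>circle_measure) \<le> \<tau>"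
proof -
  \<comment> \<open>A third of \<open>\<eta>\<close>, because the final Bloch bound is
    \<open>2 * h\<close> for the start plus \<open>h\<close> for all accumulated errors; the cap
    \<open>1 / 2\<close> keeps the walk in \<open>[-1, 1]\<close>.\<close>
  define h where "h = min (\<eta> / 3) (1 / 2)"
  have h: "0 < h" "h \<le> 1 / 2" "3 * h \<le> \<eta>"
    using assms by (auto simp: h_def)
  obtain N :: nat where N: "N > 2 / (h\<^sup>2 * \<tau>)"
    using reals_Archimedean2 by blast
  moreover have "0 < 2 / (h\<^sup>2 * \<tau>)"
    using assms h by simp
  ultimately have N0: "N > 0"
    by (metis of_nat_0_less_iff order_less_trans)
  define e where "e = h / N"
  have e: "e > 0" "N * e = h"
    using h N0 by (auto simp: e_def)
  define good where "good \<psi> B \<longleftrightarrow> poly \<psi> 0 = of_real m \<and> (\<forall>z. cmod z = 1 \<longrightarrow> \<bar>Re (poly \<psi> z)\<bar> \<le> 1) \<and>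
    (\<forall>z. cmod z < 1 \<longrightarrow> (1 - cmod z) * cmod (poly (pderiv \<psi>) z) \<le> B)" for \<psi> B
  define F where "F \<psi> = (\<integral>z. (1 - (Re (poly \<psi> z))\<^sup>2)\<^sup>2 \<partial>circle_measure)" for \<psi>
  define G where "G \<psi> = (\<integral>z. (Re (poly \<psi> z))\<^sup>2 \<partial>circle_measure)" for \<psi>
  \<comment> \<open>Induction with stopping: once \<open>F \<psi> \<le> \<tau>\<close> holds, the
    same polynomial is kept for all later \<open>k\<close>.\<close>
  have "\<exists>\<psi>. good \<psi> (2 * h + k * e) \<and> (F \<psi> \<le> \<tau> \<or> k * (h\<^sup>2 / 2 * \<tau>) \<le> G \<psi>)" for k :: nat
  proof (induction k)
    case 0
    have "good [:of_real m:] (2 * h)"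
      using assms h by (auto simp: good_def pderiv_pCons)
    moreover have "0 \<le> G [:of_real m:]"
      unfolding G_def by (intro integral_nonneg_AE) auto
    ultimately show ?case
      by auto
  next
    case (Suc k)
    then obtain \<psi> where \<psi>: "good \<psi> (2 * h + k * e)" "F \<psi> \<le> \<tau> \<or> k * (h\<^sup>2 / 2 * \<tau>) \<le> G \<psi>"
      by blast
    show ?case
    proof (cases "F \<psi> \<le> \<tau>")
      case True
      moreover have "good \<psi> (2 * h + Suc k * e)"
        using \<psi>(1) e(1) unfolding good_def by (smt (verit) mult_right_mono of_nat_Suc)
      ultimately show ?thesis
        by blast
    next
      case False
      have "\<exists>\<psi>'. poly \<psi>' 0 = poly \<psi> 0 \<and> (\<forall>z. cmod z = 1 \<longrightarrow> \<bar>Re (poly \<psi>' z)\<bar> \<le> 1) \<and>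
        (\<forall>z. cmod z < 1 \<longrightarrow> (1 - cmod z) * cmod (poly (pderiv \<psi>') z) \<le> 2 * h + k * e + e) \<and>
        G \<psi>' = G \<psi> + h\<^sup>2 / 2 * F \<psi>"
        unfolding G_def F_def using \<psi>(1) h e by (intro bloch_step) (auto simp: good_def)
      then obtain \<psi>' where \<psi>': "good \<psi>' (2 * h + k * e + e)" "G \<psi>' = G \<psi> + h\<^sup>2 / 2 * F \<psi>"
        using \<psi>(1) unfolding good_def by auto
      have "h\<^sup>2 / 2 * \<tau> \<le> h\<^sup>2 / 2 * F \<psi>"
        using False by (intro mult_left_mono) auto
      then have "Suc k * (h\<^sup>2 / 2 * \<tau>) \<le> G \<psi>'"
        using \<psi>' \<psi>(2) False by (simp add: algebra_simps)
      moreover have "good \<psi>' (2 * h + Suc k * e)"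
        using \<psi>'(1) by (simp add: algebra_simps)
      ultimately show ?thesis
        by blast
    qed
  qed
  from this[of N] obtain \<psi> where \<psi>: "good \<psi> (3 * h)" "F \<psi> \<le> \<tau> \<or> N * (h\<^sup>2 / 2 * \<tau>) \<le> G \<psi>"
    unfolding e(2) by auto
  have "G \<psi> \<le> (\<integral>z. 1 \<partial>circle_measure)"
    unfolding G_def
  proof (rule integral_mono_AE)
    show "AE z in circle_measure. (Re (poly \<psi> z))\<^sup>2 \<le> 1"
      using AE_sphere \<psi>(1) by (auto elim!: eventually_mono simp: good_def abs_square_le_1)
  qed (auto intro!: integrable_circle_continuous continuous_intros)
  then have "G \<psi> \<le> 1"
    by simp
  moreover have "N * (h\<^sup>2 / 2 * \<tau>) > 1"
    using N h assms by (simp add: field_simps)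
  ultimately have "F \<psi> \<le> \<tau>"
    using \<psi>(2) by linarith
  with \<psi>(1) h(3) show ?thesis
    unfolding good_def F_def by (meson order_trans)
qed

text \<open>Taylor polynomials converge uniformly on a disc slightly larger than the unit disc; the
  extra room turns this into convergence of the derivatives by Cauchy's estimate.\<close>

lemma holomorphic_poly_approx:
  assumes F: "F holomorphic_on ball 0 R" and R: "R > 1" and e: "e > 0"
  shows "\<exists>p. poly p 0 = F 0 \<and>
    (\<forall>z. cmod z \<le> 1 \<longrightarrow> cmod (F z - poly p z) \<le> e \<and> cmod (deriv F z - poly (pderiv p) z) \<le> e)"
proof -
  \<comment> \<open>Convergence at radius \<open>r2\<close> yields absolute, hence uniform,
    convergence on the closed disc of radius \<open>r1\<close>.\<close>
  define r1 r2 where "r1 = (1 + R) / 2" and "r2 = (r1 + R) / 2"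
  have r: "1 < r1" "r1 < r2" "r2 < R"
    using R by (auto simp: r1_def r2_def)
  define a where "a n = (deriv ^^ n) F 0 / fact n" for n
  have sums: "(\<lambda>n. a n * z ^ n) sums F z" if "cmod z < R" for z
    using holomorphic_power_series[OF F, of z] that by (simp add: a_def)
  have "summable (\<lambda>n. norm (a n * of_real r1 ^ n))"
  proof (rule powser_insidea)
    show "summable (\<lambda>n. a n * of_real r2 ^ n)"
      using sums[of "of_real r2"] r by (simp add: sums_iff)
    show "norm (of_real r1 :: complex) < norm (of_real r2 :: complex)"
      using r by simp
  qed
  then have unif: "uniform_limit (cball 0 r1) (\<lambda>n z. \<Sum>i<n. a i * z ^ i) (\<lambda>z. \<Sum>i. a i * z ^ i) sequentially"
  proof (intro Weierstrass_m_test)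
    show "norm (a n * z ^ n) \<le> norm (a n * of_real r1 ^ n)" if "z \<in> cball 0 r1" for n z
      using that r by (auto simp: norm_mult norm_power intro!: mult_left_mono power_mono)
  qed
  \<comment> \<open>The second entry compensates the factor \<open>1 / (r1 - 1)\<close> in Cauchy's
    estimate.\<close>
  define \<delta> where "\<delta> = min e (e * (r1 - 1))"
  have "\<delta> > 0"
    using e r by (simp add: \<delta>_def)
  with unif have "\<forall>\<^sub>F n in sequentially. \<forall>z\<in>cball 0 r1. dist (\<Sum>i<n. a i * z ^ i) (\<Sum>i. a i * z ^ i) < \<delta>"
    unfolding uniform_limit_iff by blast
  \<comment> \<open>With \<open>n > 0\<close> the partial sum contains the constant term, so the
    value at \<open>0\<close> is met exactly.\<close>
  then have "\<forall>\<^sub>F n in sequentially. n > 0 \<and> (\<forall>z\<in>cball 0 r1. dist (\<Sum>i<n. a i * z ^ i) (\<Sum>i. a i * z ^ i) < \<delta>)"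
    by (intro eventually_conj eventually_gt_at_top)
  then obtain n where n: "n > 0" "\<And>z. z \<in> cball 0 r1 \<Longrightarrow> dist (\<Sum>i<n. a i * z ^ i) (\<Sum>i. a i * z ^ i) < \<delta>"
    by (auto simp: eventually_sequentially)
  define p where "p = (\<Sum>i<n. monom (a i) i)"
  have p: "poly p z = (\<Sum>i<n. a i * z ^ i)" for z
    by (simp add: p_def poly_sum poly_monom)
  have close: "cmod (F z - poly p z) \<le> \<delta>" if "cmod z \<le> r1" for z
    using n(2)[of z] sums[of z] that r by (simp add: p dist_norm sums_iff norm_minus_commute)
  have hol: "(\<lambda>z. F z - poly p z) holomorphic_on ball 0 R"
    by (intro holomorphic_intros F)
  have "cmod (deriv F z - poly (pderiv p) z) \<le> e" if z: "cmod z \<le> 1" for z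
  proof -
    have sub: "cball z (r1 - 1) \<subseteq> ball 0 R"
    proof
      fix x assume "x \<in> cball z (r1 - 1)"
      then have "cmod x \<le> cmod z + (r1 - 1)"
        using norm_triangle_ineq2[of x z] by (simp add: dist_norm norm_minus_commute)
      then show "x \<in> ball 0 R"
        using z r by simp
    qed
    have "norm ((deriv ^^ 1) (\<lambda>z. F z - poly p z) z) \<le> fact 1 * \<delta> / (r1 - 1) ^ 1"
    proof (rule Cauchy_inequality)
      show "(\<lambda>z. F z - poly p z) holomorphic_on ball z (r1 - 1)"
        using hol by (rule holomorphic_on_subset) (use sub in auto)
      show "continuous_on (cball z (r1 - 1)) (\<lambda>z. F z - poly p z)"
        by (rule holomorphic_on_imp_continuous_on[OF holomorphic_on_subset[OF hol sub]])
      show "norm (F x - poly p x) \<le> \<delta>" if "norm (z - x) = r1 - 1" for x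
        using that z norm_triangle_ineq2[of x z] by (intro close) (simp add: norm_minus_commute)
    qed (use r in auto)
    moreover have "deriv (\<lambda>z. F z - poly p z) z = deriv F z - poly (pderiv p) z"
    proof (rule DERIV_imp_deriv)
      have "F field_differentiable at z"
        using F z R by (intro holomorphic_on_imp_differentiable_at[of _ "ball 0 R"]) auto
      then show "((\<lambda>z. F z - poly p z) has_field_derivative deriv F z - poly (pderiv p) z) (at z)"
        by (intro DERIV_diff poly_DERIV) (simp add: DERIV_deriv_iff_field_differentiable)
    qed
    ultimately have "cmod (deriv F z - poly (pderiv p) z) \<le> \<delta> / (r1 - 1)"
      by simp
    also have "\<dots> \<le> e"
      using r by (simp add: \<delta>_def field_simps min_le_iff_disj)
    finally show ?thesis .
  qed
  moreover have "cmod (F z - poly p z) \<le> e" if "cmod z \<le> 1" for z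
    using close[of z] that r by (simp add: \<delta>_def)
  moreover have "poly p 0 = F 0"
  proof -
    have "poly p 0 = (\<Sum>i<n. if i = 0 then a i else 0)"
      unfolding p by (intro sum.cong) auto
    also have "\<dots> = a 0"
      using n(1) by (simp add: sum.delta)
    finally show ?thesis
      by (simp add: a_def)
  qed
  ultimately show ?thesis
    by blast
qed

text \<open>
  If \<open>u = Re \<psi>\<close> starts at \<open>-1 + \<kappa>\<close> and is close to \<open>\<plusminus>1\<close> on most of the circle, then it is close
  to \<open>-1\<close> on most of the circle, and \<open>exp (c * (\<psi> - \<psi> 0))\<close> is small there for large \<open>c\<close>.
\<close>

lemma small_bloch_poly_near_one:
  assumes \<epsilon>: "0 < \<epsilon>" and \<delta>: "0 < \<delta>"
  shows "\<exists>S. poly S 0 = 0 \<and> (\<forall>z. cmod z < 1 \<longrightarrow> (1 - cmod z) * cmod (poly (pderiv S) z) \<le> \<epsilon>) \<and>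
    measure circle_measure {z \<in> sphere 0 1. \<epsilon> < cmod (poly S z - 1)} \<le> \<delta>"
proof -
  \<comment> \<open>The mean of \<open>1 + u\<close> will be \<open>\<kappa>\<close>, which pays for
    one half of \<open>\<delta>\<close>.\<close>
  define \<kappa> where "\<kappa> = min (\<delta> / 2) 1"
  have \<kappa>: "0 < \<kappa>" "\<kappa> \<le> 1" "\<kappa> \<le> \<delta> / 2"
    using \<delta> by (auto simp: \<kappa>_def)
  define s where "s = \<kappa> / 2"
  have s: "0 < s" "s \<le> 1 / 2"
    using \<kappa> by (auto simp: s_def)
  \<comment> \<open>Where \<open>u \<le> -1 + s\<close>, the exponential has modulus at most
    \<open>exp (- L)\<close> once \<open>c * s = L\<close>. The summand \<open>2\<close> makes
    \<open>L\<close> positive for every \<open>\<epsilon>\<close>.\<close>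
  define L where "L = ln (2 / \<epsilon> + 2)"
  have L: "L > 0" "exp (- L) \<le> \<epsilon> / 2"
    using \<epsilon> by (auto simp: L_def exp_minus field_simps add_pos_pos intro!: ln_gt_zero)
  define c where "c = L / s"
  have c: "c > 0" "c * s = L"
    using L s by (auto simp: c_def)
  \<comment> \<open>Differentiating the exponential costs a factor \<open>c\<close>, and its modulus
    on the disc is at most \<open>exp (2 * c)\<close>. This is why the Bloch bound of
    \<open>\<psi>\<close> is chosen after \<open>c\<close>.\<close>
  define \<eta> where "\<eta> = \<epsilon> / 2 / (c * exp (2 * c))"
  have \<eta>: "\<eta> > 0" "c * exp (2 * c) * \<eta> = \<epsilon> / 2"
    using c \<epsilon> by (auto simp: \<eta>_def)
  define \<tau> where "\<tau> = s\<^sup>2 * (\<delta> / 2)"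
  have \<tau>: "\<tau> > 0"
    using s \<delta> by (simp add: \<tau>_def)
  have "\<bar>- 1 + \<kappa>\<bar> \<le> 1"
    using \<kappa> by auto
  from bloch_two_valued[OF \<eta>(1) this \<tau>] obtain \<psi> where
    \<psi>0: "poly \<psi> 0 = of_real (- 1 + \<kappa>)" and
    \<psi>1: "\<And>z. cmod z = 1 \<Longrightarrow> \<bar>Re (poly \<psi> z)\<bar> \<le> 1" and
    \<psi>B: "\<And>z. cmod z < 1 \<Longrightarrow> (1 - cmod z) * cmod (poly (pderiv \<psi>) z) \<le> \<eta>" and
    \<psi>I: "(\<integral>z. (1 - (Re (poly \<psi> z))\<^sup>2)\<^sup>2 \<partial>circle_measure) \<le> \<tau>"
    by blast
  define u where "u z = Re (poly \<psi> z)" for z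
  define E where "E z = exp (of_real c * (poly \<psi> z - of_real (- 1 + \<kappa>)))" for z
  have norm_E: "cmod (E z) = exp (c * (u z + 1 - \<kappa>))" for z
    by (simp add: E_def u_def algebra_simps)
  have holE: "E holomorphic_on S" for S
    unfolding E_def by (intro holomorphic_intros)
  have E_sphere: "cmod (E z) \<le> exp (2 * c)" if "cmod z = 1" for z
  proof -
    have "c * (u z + 1 - \<kappa>) \<le> c * 2"
      using \<psi>1[OF that] \<kappa> c by (intro mult_left_mono) (auto simp: u_def)
    then show ?thesis
      by (simp add: norm_E mult.commute)
  qed
  have E_ball: "cmod (E z) \<le> exp (2 * c)" if "cmod z \<le> 1" for z
  proof (rule maximum_modulus_frontier[of E "cball 0 1"])
    show "continuous_on (closure (cball 0 1)) E"
      by (rule holomorphic_on_imp_continuous_on[OF holE])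
    show "norm (E w) \<le> exp (2 * c)" if "w \<in> frontier (cball 0 1)" for w
      using that E_sphere[of w] by simp
  qed (use holE that in \<open>auto simp: bounded_cball\<close>)
  define F where "F z = 1 - E z" for z
  have F: "F holomorphic_on ball 0 2"
    unfolding F_def by (intro holomorphic_intros holE)
  have derF: "deriv F z = - (of_real c * poly (pderiv \<psi>) z * E z)" for z
    unfolding F_def E_def
    by (rule DERIV_imp_deriv) (auto intro!: derivative_eq_intros poly_DERIV)
  obtain S where S0: "poly S 0 = F 0"
    and S: "\<And>z. cmod z \<le> 1 \<Longrightarrow> cmod (F z - poly S z) \<le> \<epsilon> / 2"
      "\<And>z. cmod z \<le> 1 \<Longrightarrow> cmod (deriv F z - poly (pderiv S) z) \<le> \<epsilon> / 2"
    using holomorphic_poly_approx[OF F, of "\<epsilon> / 2"] \<epsilon> by auto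
  show ?thesis
  proof (intro exI conjI allI impI)
    show "poly S 0 = 0"
      by (simp add: S0 F_def E_def \<psi>0)
    show "(1 - cmod z) * cmod (poly (pderiv S) z) \<le> \<epsilon>" if z: "cmod z < 1" for z
    proof -
      have "(1 - cmod z) * cmod (deriv F z) = c * ((1 - cmod z) * cmod (poly (pderiv \<psi>) z)) * cmod (E z)"
        using c by (simp add: derF norm_mult)
      also have "\<dots> \<le> c * \<eta> * exp (2 * c)"
        using \<psi>B[OF z] E_ball[of z] c z \<eta>(1) by (intro mult_mono) auto
      finally have "(1 - cmod z) * cmod (deriv F z) \<le> \<epsilon> / 2"
        using \<eta>(2) by (simp add: mult_ac)
      moreover have "(1 - cmod z) * cmod (deriv F z - poly (pderiv S) z) \<le> 1 * (\<epsilon> / 2)"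
        using S(2)[of z] z by (intro mult_mono) auto
      moreover have "(1 - cmod z) * cmod (poly (pderiv S) z) \<le>
          (1 - cmod z) * (cmod (deriv F z) + cmod (deriv F z - poly (pderiv S) z))"
        using z norm_triangle_ineq4[of "deriv F z" "deriv F z - poly (pderiv S) z"]
        by (intro mult_left_mono) auto
      ultimately show ?thesis
        by (simp add: distrib_left)
    qed
    define A where "A = {z \<in> sphere 0 1. \<epsilon> < cmod (poly S z - 1)}"
    have "open {z. \<epsilon> < cmod (poly S z - 1)}"
      by (intro open_Collect_less continuous_intros)
    moreover have "A = sphere 0 1 \<inter> {z. \<epsilon> < cmod (poly S z - 1)}"
      by (auto simp: A_def)
    ultimately have A: "A \<in> sets borel"
      by (simp add: sets.Int borel_open)
    have "measure circle_measure A = (\<integral>z. indicator A z \<partial>circle_measure)"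
      using A by simp
    \<comment> \<open>A Chebyshev bound. On \<open>A\<close> one has \<open>u > -1 + s\<close>, so
      either \<open>u\<close> is nonnegative and the first term is at least \<open>1\<close>, or
      \<open>(1 - u) * (1 + u) \<ge> s\<close> and the second one is. The two means are at most
      \<open>\<kappa>\<close> and \<open>\<delta> / 2\<close>.\<close>
    also have "\<dots> \<le> (\<integral>z. (1 + u z) + (1 - (u z)\<^sup>2)\<^sup>2 / s\<^sup>2 \<partial>circle_measure)"
    proof (rule integral_mono_AE)
      have "indicator A z \<le> (1 + u z) + (1 - (u z)\<^sup>2)\<^sup>2 / s\<^sup>2" if z: "cmod z = 1" for z
      proof (cases "z \<in> A")
        case False
        then show ?thesis
          using \<psi>1[OF z] by (auto simp: u_def)
      next
        case True_A: True
        have "\<epsilon> < cmod (poly S z - 1)"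
          using True_A by (simp add: A_def)
        also have "\<dots> \<le> cmod (F z - poly S z) + cmod (E z)"
          using norm_triangle_ineq[of "F z - poly S z" "E z"] by (simp add: F_def norm_minus_commute)
        also have "\<dots> \<le> \<epsilon> / 2 + exp (c * (u z + 1 - \<kappa>))"
          using S(1)[of z] z by (simp add: norm_E)
        finally have "exp (- L) < exp (c * (u z + 1 - \<kappa>))"
          using L(2) by linarith
        then have "c * (- s) < c * (u z + 1 - \<kappa>)"
          using c(2) by simp
        then have us: "s < 1 + u z"
          unfolding mult_less_cancel_left_pos[OF c(1)] by (simp add: s_def)
        show ?thesis
        proof (cases "u z \<ge> 0")
          case True
          then show ?thesis
            by (simp add: indicator_def add_nonneg_nonneg)
        next
          case False
          have "1 * s \<le> (1 - u z) * (1 + u z)"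
            using False us s by (intro mult_mono) auto
          then have "s\<^sup>2 \<le> (1 - (u z)\<^sup>2)\<^sup>2"
            using s by (intro power_mono) (auto simp: algebra_simps power2_eq_square)
          then have "1 \<le> (1 - (u z)\<^sup>2)\<^sup>2 / s\<^sup>2"
            using s by simp
          moreover have "indicator A z = (1::real)"
            using True_A by simp
          ultimately show ?thesis
            using us s(1) by linarith
        qed
      qed
      then show "AE z in circle_measure. indicator A z \<le> (1 + u z) + (1 - (u z)\<^sup>2)\<^sup>2 / s\<^sup>2"
        using AE_sphere by (auto elim!: eventually_mono)
      show "integrable circle_measure (indicator A :: complex \<Rightarrow> real)"
        using A by (intro integrable_real_indicator) (auto simp: circle.emeasure_finite less_top[symmetric])
    qed (use s in \<open>auto simp: u_def intro!: integrable_circle_continuous continuous_intros\<close>)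
    also have "\<dots> = (\<integral>z. 1 + u z \<partial>circle_measure) + (\<integral>z. (1 - (u z)\<^sup>2)\<^sup>2 \<partial>circle_measure) / s\<^sup>2"
      using s(1) by (subst Bochner_Integration.integral_add)
         (auto simp: u_def intro!: integrable_circle_continuous continuous_intros)
    also have "(\<integral>z. 1 + u z \<partial>circle_measure) = 1 + (\<integral>z. u z \<partial>circle_measure)"
      by (subst Bochner_Integration.integral_add)
         (auto simp: u_def intro!: integrable_circle_continuous continuous_intros)
    also have "(\<integral>z. u z \<partial>circle_measure) = Re (integral\<^sup>L circle_measure (poly \<psi>))"
      unfolding u_def by (intro integral_Re integrable_circle_continuous continuous_intros)
    also have "1 + Re (integral\<^sup>L circle_measure (poly \<psi>)) = \<kappa>"
      by (simp add: integral_circle_poly \<psi>0)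
    also have "\<kappa> + (\<integral>z. (1 - (u z)\<^sup>2)\<^sup>2 \<partial>circle_measure) / s\<^sup>2 \<le> \<kappa> + \<tau> / s\<^sup>2"
      using \<psi>I s by (intro add_left_mono divide_right_mono) (auto simp: u_def)
    also have "\<dots> \<le> \<delta>"
      using s(1)[THEN less_imp_neq] \<kappa>(3) by (simp add: \<tau>_def)
    finally show "measure circle_measure {z \<in> sphere 0 1. \<epsilon> < cmod (poly S z - 1)} \<le> \<delta>"
      by (simp add: A_def)
  qed
qed

section \<open>Density of polynomials; Bloch bounds of compositions and quotients\<close>

section \<open>Polynomials in the little Bloch space\<close>

lemma bloch_dist_le:
  assumes "f \<in> little_bloch" "g \<in> little_bloch"
    and "\<And>z. cmod z < 1 \<Longrightarrow> (1 - cmod z) * cmod (deriv f z - deriv g z) \<le> B"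
  shows "bloch_dist f g \<le> cmod (f 0 - g 0) + B"
proof -
  have "(SUP z\<in>ball 0 1. (1 - cmod z) * cmod (deriv (\<lambda>z. f z - g z) z)) \<le> B"
    using assms by (intro cSUP_least) (auto simp: bloch_deriv_diff)
  then show ?thesis
    using assms by (simp add: bloch_dist_def bloch_norm_def)
qed

lemma deriv_restrict_poly:
  assumes "cmod z < 1"
  shows "deriv (restrict (poly Q) (ball 0 1)) z = poly (pderiv Q) z"
proof (rule DERIV_imp_deriv)
  show "(restrict (poly Q) (ball 0 1) has_field_derivative poly (pderiv Q) z) (at z)"
    by (rule has_field_derivative_transform_within_open[OF poly_DERIV, of "ball 0 1"]) (use assms in auto)
qed

text \<open>The dilation \<open>f (r * z)\<close> is holomorphic beyond the unit disc and so
  approximable by polynomials. It is close to \<open>f\<close> for \<open>r\<close> near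
  \<open>1\<close>: by uniform continuity of \<open>deriv f\<close> inside, and because both
  weighted derivatives are small near the circle.\<close>

lemma little_bloch_poly_dense:
  assumes f: "f \<in> little_bloch" and e: "e > 0"
  shows "\<exists>p. poly p 0 = f 0 \<and> (\<forall>z. cmod z < 1 \<longrightarrow> (1 - cmod z) * cmod (deriv f z - poly (pderiv p) z) \<le> e)"
proof -
  have hol: "f holomorphic_on ball 0 1" and hol': "deriv f holomorphic_on ball 0 1"
    using f by (auto simp: little_bloch_def intro: holomorphic_deriv)
  have "\<forall>\<^sub>F z in filtercomap cmod (at_left 1). dist (of_real (1 - cmod z) * deriv f z) 0 < e / 4"
    using f e by (intro tendstoD) (auto simp: little_bloch_def)
  then obtain P where P: "eventually P (at_left (1::real))"
    and PQ: "\<And>z. P (cmod z) \<Longrightarrow> dist (of_real (1 - cmod z) * deriv f z) 0 < e / 4"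
    unfolding eventually_filtercomap by blast
  then obtain b0 where b0: "b0 < 1" "\<And>r. b0 < r \<Longrightarrow> r < 1 \<Longrightarrow> P r"
    unfolding eventually_at_left_field by blast
  define b where "b = max b0 0"
  have b: "0 \<le> b" "b < 1"
    using b0 by (auto simp: b_def)
  have near: "(1 - cmod z) * cmod (deriv f z) \<le> e / 4" if "b < cmod z" "cmod z < 1" for z
  proof -
    have "cmod (of_real (1 - cmod z) * deriv f z) < e / 4"
      using PQ[OF b0(2)[of "cmod z"]] that by (simp add: dist_norm b_def)
    then show ?thesis
      using that by (simp add: norm_mult del: of_real_diff)
  qed
  \<comment> \<open>A buffer: for \<open>r\<close> near \<open>1\<close> and
    \<open>cmod z > b'\<close>, the point \<open>r * z\<close> still lies outside radius
    \<open>b\<close>, where the weighted derivative is small.\<close>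
  define b' where "b' = (1 + b) / 2"
  have b': "b < b'" "b' < 1" "0 < b'"
    using b by (auto simp: b'_def)
  have cont: "continuous_on (cball 0 b') (deriv f)"
    using b' by (intro holomorphic_on_imp_continuous_on[OF holomorphic_on_subset[OF hol']]) auto
  then have "bounded (deriv f ` cball 0 b')"
    by (intro compact_imp_bounded compact_continuous_image compact_cball)
  then obtain C where "\<And>z. z \<in> cball 0 b' \<Longrightarrow> cmod (deriv f z) \<le> C"
    unfolding bounded_iff by blast
  then have C: "cmod (deriv f z) \<le> C" if "cmod z \<le> b'" for z
    using that by simp
  have "C \<ge> 0"
    using order_trans[OF norm_ge_zero, of "deriv f 0" C] C[of 0] b' by simp
  have "uniformly_continuous_on (cball 0 b') (deriv f)"
    using cont by (intro compact_uniformly_continuous) auto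
  then obtain d where d0: "d > 0"
    and "\<forall>z\<in>cball 0 b'. \<forall>w\<in>cball 0 b'. dist w z < d \<longrightarrow> dist (deriv f w) (deriv f z) < e / 4"
    unfolding uniformly_continuous_on_def using divide_pos_pos[OF e zero_less_numeral] by blast
  then have d: "cmod (deriv f z - deriv f w) < e / 4"
    if "cmod z \<le> b'" "cmod w \<le> b'" "cmod (z - w) < d" for z w
    using that by (simp add: dist_norm)
  \<comment> \<open>The entries ensure, in order, \<open>b < r * b'\<close>,
    \<open>cmod (z - r * z) < d\<close>, a small loss from the factor \<open>r\<close> in the
    derivative of the dilation, and \<open>r > 0\<close>.\<close>
  define r where "r = Max {(1 + b / b') / 2, 1 - d / 2, 1 - e / 4 / (C + 1), 1 / 2}"
  have bb': "b / b' < 1"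
    using b' by simp
  have "r < 1"
    unfolding r_def using bb' d0 e \<open>C \<ge> 0\<close> by (subst Max_less_iff) (auto simp: add_nonneg_pos)
  moreover have "(1 + b / b') / 2 \<le> r" "1 - d / 2 \<le> r" "1 - e / 4 / (C + 1) \<le> r" "1 / 2 \<le> r"
    unfolding r_def by (intro Max_ge; simp)+
  ultimately have r: "r > b / b'" "r > 0" "r > 1 - d" "r \<ge> 1 - e / 4 / (C + 1)" "r < 1"
    using bb' d0 by auto
  have rC: "(1 - r) * C \<le> e / 4"
  proof -
    have "(1 - r) * C \<le> (1 - r) * (C + 1)"
      using r by (intro mult_left_mono) auto
    also have "\<dots> \<le> e / 4"
      using r(4) \<open>C \<ge> 0\<close> by (simp add: field_simps)
    finally show ?thesis .
  qed
  define F where "F z = f (of_real r * z)" for z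
  have in_ball: "of_real r * z \<in> ball 0 1" if "z \<in> ball 0 (1 / r)" for z :: complex
    using that r by (simp add: norm_mult field_simps)
  have F: "F holomorphic_on ball 0 (1 / r)"
    unfolding F_def using in_ball
    by (intro holomorphic_on_compose_gen[OF _ hol, unfolded o_def] holomorphic_intros) auto
  have derF: "deriv F z = of_real r * deriv f (of_real r * z)" if "cmod z < 1" for z
  proof (rule DERIV_imp_deriv)
    have "cmod (of_real r * z) < 1"
      using that r mult_strict_mono[of r 1 "cmod z" 1] by (simp add: norm_mult)
    then have "(f has_field_derivative deriv f (of_real r * z)) (at (of_real r * z))"
      using holomorphic_derivI[OF hol open_ball, of "of_real r * z"] by simp
    moreover have "((\<lambda>z. of_real r * z) has_field_derivative of_real r) (at z)"
      by (auto intro!: derivative_eq_intros)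
    ultimately have "((\<lambda>z. f (of_real r * z)) has_field_derivative deriv f (of_real r * z) * of_real r) (at z)"
      by (rule DERIV_chain2)
    then show "(F has_field_derivative of_real r * deriv f (of_real r * z)) (at z)"
      unfolding F_def by (simp add: mult.commute)
  qed
  obtain p where p0: "poly p 0 = F 0"
    and p: "\<And>z. cmod z \<le> 1 \<Longrightarrow> cmod (deriv F z - poly (pderiv p) z) \<le> e / 4"
    using holomorphic_poly_approx[OF F, of "e / 4"] r e by auto
  show ?thesis
  proof (intro exI conjI allI impI)
    show "poly p 0 = f 0"
      by (simp add: p0 F_def)
    fix z assume z: "cmod z < 1"
    let ?w = "of_real r * z"
    have w: "cmod ?w = r * cmod z" "cmod ?w \<le> cmod z"
      using r mult_left_le_one_le[of "cmod z" r] by (auto simp: norm_mult)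
    have *: "(1 - cmod z) * cmod (deriv f z - deriv F z) \<le> e / 2"
    proof (cases "cmod z \<le> b'")
      case True
      have "cmod (z - ?w) = (1 - r) * cmod z"
      proof -
        have "z - ?w = of_real (1 - r) * z"
          by (simp add: algebra_simps)
        then show ?thesis
          using r by (simp only: norm_mult norm_of_real)
      qed
      also have "\<dots> \<le> 1 - r"
        using z r by (intro mult_left_le) auto
      finally have "cmod (deriv f z - deriv f ?w) < e / 4"
        using True w r by (intro d) auto
      moreover have "cmod (of_real (1 - r) * deriv f ?w) \<le> e / 4"
      proof -
        have "cmod (of_real (1 - r) * deriv f ?w) \<le> (1 - r) * C"
          unfolding norm_mult norm_of_real using C[of ?w] w True r by (intro mult_mono) auto
        then show ?thesis
          using rC by simp
      qed
      moreover have eq: "deriv f z - deriv F z = (deriv f z - deriv f ?w) + of_real (1 - r) * deriv f ?w"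
        by (simp add: derF[OF z] algebra_simps)
      ultimately have "cmod (deriv f z - deriv F z) \<le> e / 2"
        using norm_triangle_ineq[of "deriv f z - deriv f ?w" "of_real (1 - r) * deriv f ?w"]
        unfolding eq by linarith
      then show ?thesis
        using z mult_left_le_one_le[of "cmod (deriv f z - deriv F z)" "1 - cmod z"] by simp
    next
      case False
      have "b < r * b'"
        using r(1) b' by (simp add: field_simps)
      also have "\<dots> \<le> cmod ?w"
        using False r by (simp add: w)
      finally have "(1 - cmod ?w) * cmod (deriv f ?w) \<le> e / 4"
        using w z by (intro near) auto
      moreover have "(1 - cmod z) * cmod (deriv F z) \<le> (1 - cmod ?w) * cmod (deriv f ?w)"
        unfolding derF[OF z] norm_mult[of "of_real r" "deriv f ?w"]
        using w z r by (intro mult_mono mult_left_le_one_le) auto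
      moreover have "(1 - cmod z) * cmod (deriv f z) \<le> e / 4"
        using False z b' by (intro near) auto
      moreover have "(1 - cmod z) * cmod (deriv f z - deriv F z) \<le> (1 - cmod z) * (cmod (deriv f z) + cmod (deriv F z))"
        using z by (intro mult_left_mono norm_triangle_ineq4) auto
      ultimately show ?thesis
        by (simp add: distrib_left)
    qed
    have "(1 - cmod z) * cmod (deriv f z - poly (pderiv p) z) \<le>
        (1 - cmod z) * (cmod (deriv f z - deriv F z) + cmod (deriv F z - poly (pderiv p) z))"
      using z norm_triangle_ineq[of "deriv f z - deriv F z" "deriv F z - poly (pderiv p) z"]
      by (intro mult_left_mono) auto
    also have "\<dots> \<le> e / 2 + 1 * (e / 4)"
      unfolding distrib_left using p[of z] z by (intro add_mono * mult_mono) auto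
    also have "\<dots> \<le> e"
      using e by simp
    finally show "(1 - cmod z) * cmod (deriv f z - poly (pderiv p) z) \<le> e" .
  qed
qed

text \<open>The chain rule produces \<open>m * r ^ (m - 1)\<close> with \<open>r = cmod z\<close>,
  which is at most the geometric sum of the \<open>r ^ i\<close> for \<open>i < m\<close>. Hence the
  weight \<open>1 - r\<close> times this factor is at most \<open>1 - r ^ m\<close>, the weight at
  \<open>z ^ m\<close>.\<close>

lemma bloch_bound_pcompose_power:
  fixes S :: "complex poly"
  assumes S: "\<And>z. cmod z < 1 \<Longrightarrow> (1 - cmod z) * cmod (poly (pderiv S) z) \<le> \<epsilon>"
    and m: "m > 0" and z: "cmod z < 1"
  shows "(1 - cmod z) * cmod (poly (pderiv (pcompose S (monom 1 m))) z) \<le> \<epsilon>"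
proof -
  let ?r = "cmod z"
  have rm: "?r ^ m < 1"
    using z m by (simp add: power_less_one_iff)
  have "real m * ?r ^ (m - 1) = (\<Sum>i<m. ?r ^ (m - 1))"
    by simp
  also have "\<dots> \<le> (\<Sum>i<m. ?r ^ i)"
    using z by (intro sum_mono power_decreasing) auto
  finally have "(1 - ?r) * (real m * ?r ^ (m - 1)) \<le> (1 - ?r) * (\<Sum>i<m. ?r ^ i)"
    using z by (intro mult_left_mono) auto
  also have "\<dots> = 1 - ?r ^ m"
    by (simp add: one_diff_power_eq)
  finally have key: "(1 - ?r) * (real m * ?r ^ (m - 1)) \<le> 1 - ?r ^ m" .
  have "(1 - ?r) * cmod (poly (pderiv (pcompose S (monom 1 m))) z) =
      ((1 - ?r) * (real m * ?r ^ (m - 1))) * cmod (poly (pderiv S) (z ^ m))"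
    by (simp add: pderiv_pcompose pderiv_monom poly_monom poly_pcompose norm_mult norm_power)
  also have "\<dots> \<le> (1 - ?r ^ m) * cmod (poly (pderiv S) (z ^ m))"
    by (intro mult_right_mono key) auto
  also have "\<dots> \<le> \<epsilon>"
    using S[of "z ^ m"] rm by (simp add: norm_power)
  finally show ?thesis .
qed

text \<open>On the disc of radius \<open>cmod z\<close> the derivative is at most
  \<open>\<epsilon> / (1 - cmod z)\<close>, so the mean value inequality from \<open>0\<close>
  suffices.\<close>

lemma bloch_bound_imp_growth:
  fixes T :: "complex poly"
  assumes T0: "poly T 0 = 0"
    and T: "\<And>z. cmod z < 1 \<Longrightarrow> (1 - cmod z) * cmod (poly (pderiv T) z) \<le> \<epsilon>"
    and z: "cmod z < 1"
  shows "(1 - cmod z) * cmod (poly T z) \<le> \<epsilon>"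
proof -
  have "(1 - cmod 0) * cmod (poly (pderiv T) 0) \<le> \<epsilon>"
    by (rule T) simp
  then have "\<epsilon> \<ge> 0"
    by (simp only: norm_zero diff_zero mult_1) (rule order_trans[OF norm_ge_zero])
  have "cmod (poly T z - poly T 0) \<le> \<epsilon> / (1 - cmod z) * cmod (z - 0)"
  proof (rule field_differentiable_bound)
    show "convex (cball (0::complex) (cmod z))"
      by (rule convex_cball)
    show "z \<in> cball 0 (cmod z)" "0 \<in> cball 0 (cmod z)"
      by simp_all
    show "(poly T has_field_derivative poly (pderiv T) w) (at w within cball 0 (cmod z))" for w
      by (rule has_field_derivative_at_within[OF poly_DERIV])
    show "cmod (poly (pderiv T) w) \<le> \<epsilon> / (1 - cmod z)" if "w \<in> cball 0 (cmod z)" for w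
    proof -
      have "(1 - cmod z) * cmod (poly (pderiv T) w) \<le> (1 - cmod w) * cmod (poly (pderiv T) w)"
        using that by (intro mult_right_mono) auto
      also have "\<dots> \<le> \<epsilon>"
        using that z by (intro T) auto
      finally show ?thesis
        using z by (simp add: field_simps)
    qed
  qed
  then have "(1 - cmod z) * cmod (poly T z) \<le> \<epsilon> * cmod z"
    using z T0 by (simp add: field_simps)
  also have "\<dots> \<le> \<epsilon>"
    using z \<open>\<epsilon> \<ge> 0\<close> by (simp add: mult_left_le)
  finally show ?thesis .
qed

text \<open>The constant does not depend on \<open>T\<close>: dividing by \<open>z ^ d\<close> is harmless for \<open>cmod z \<ge> 1 / 2\<close>, and the
  maximum principle covers the smaller disc.\<close>

lemma bloch_bound_quotient:
  fixes P :: "complex poly"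
  shows "\<exists>C>0. \<forall>T R \<epsilon>. poly T 0 = 0 \<longrightarrow> (\<forall>z. cmod z < 1 \<longrightarrow> (1 - cmod z) * cmod (poly (pderiv T) z) \<le> \<epsilon>) \<longrightarrow>
    R * monom 1 d = P * T \<longrightarrow> (\<forall>z. cmod z < 1 \<longrightarrow> (1 - cmod z) * cmod (poly (pderiv R) z) \<le> C * \<epsilon>)"
proof -
  obtain A where A: "A > 0" "\<And>z. cmod z \<le> 1 \<Longrightarrow> cmod (poly P z) \<le> A"
    using poly_bounded_cball[of P] by blast
  obtain A' where A': "A' > 0" "\<And>z. cmod z \<le> 1 \<Longrightarrow> cmod (poly (pderiv P) z) \<le> A'"
    using poly_bounded_cball[of "pderiv P"] by blast
  \<comment> \<open>For \<open>cmod w \<ge> 1 / 2\<close> division by \<open>w ^ d\<close> costs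
    \<open>2 ^ d\<close>. In the bracket, \<open>A'\<close> and \<open>A\<close> come from the
    product rule for \<open>P * T\<close>, and the last summand from the term with \<open>R\<close>
    in the derivative of \<open>R * monom 1 d\<close>.\<close>
  define C where "C = 2 ^ d * (A' + A + A * 2 ^ d * d)"
  have C: "C > 0"
    using A(1) A'(1) by (simp add: C_def add_pos_nonneg)
  have "(1 - cmod z) * cmod (poly (pderiv R) z) \<le> 2 * C * \<epsilon>"
    if T0: "poly T 0 = 0" and T: "\<And>z. cmod z < 1 \<Longrightarrow> (1 - cmod z) * cmod (poly (pderiv T) z) \<le> \<epsilon>"
      and R: "R * monom 1 d = P * T" and z: "cmod z < 1" for T R \<epsilon> z
  proof -
    have "(1 - cmod 0) * cmod (poly (pderiv T) 0) \<le> \<epsilon>"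
      by (rule T) simp
    then have "\<epsilon> \<ge> 0"
      by (simp only: norm_zero diff_zero mult_1) (rule order_trans[OF norm_ge_zero])
    have outer: "(1 - cmod w) * cmod (poly (pderiv R) w) \<le> C * \<epsilon>" if w: "1 / 2 \<le> cmod w" "cmod w < 1" for w
    proof -
      have w0: "(1 / 2) ^ d \<le> cmod w ^ d"
        using w by (intro power_mono) auto
      have w0': "1 \<le> 2 ^ d * cmod w ^ d"
        using w0 by (simp add: power_one_over field_simps)
      let ?n = "1 - cmod w"
      have T1: "?n * cmod (poly T w) \<le> \<epsilon>"
        by (rule bloch_bound_imp_growth[OF T0 T w(2)])
      have "poly R w * w ^ d = poly P w * poly T w"
        using arg_cong[OF R, of "\<lambda>p. poly p w"] by (simp add: poly_monom)
      then have "cmod (poly R w) * cmod w ^ d = cmod (poly P w) * cmod (poly T w)"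
        by (metis norm_mult norm_power)
      then have "cmod (poly R w) \<le> 2 ^ d * (A * cmod (poly T w))"
      proof -
        have "cmod (poly R w) \<le> cmod (poly R w) * (2 ^ d * cmod w ^ d)"
          using w0' by (simp add: mult_le_cancel_left1)
        also have "\<dots> = 2 ^ d * (cmod (poly P w) * cmod (poly T w))"
          using \<open>cmod (poly R w) * cmod w ^ d = _\<close> by (simp add: mult_ac)
        also have "\<dots> \<le> 2 ^ d * (A * cmod (poly T w))"
          using A(2)[of w] w by (intro mult_left_mono mult_right_mono) auto
        finally show ?thesis .
      qed
      then have "?n * cmod (poly R w) \<le> ?n * (2 ^ d * (A * cmod (poly T w)))"
        using w by (intro mult_left_mono) auto
      also have "\<dots> = 2 ^ d * A * (?n * cmod (poly T w))"
        by simp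
      also have "\<dots> \<le> 2 ^ d * A * \<epsilon>"
        using T1 A(1) by (intro mult_left_mono) auto
      finally have R1: "?n * cmod (poly R w) \<le> 2 ^ d * A * \<epsilon>" .
      have "poly (pderiv R) w * w ^ d + poly R w * (of_nat d * w ^ (d - 1)) = poly (pderiv P) w * poly T w + poly P w * poly (pderiv T) w"
        using arg_cong[OF R, of "\<lambda>p. poly (pderiv p) w"] by (simp add: poly_monom pderiv_mult pderiv_monom mult_ac add_ac)
      then have "poly (pderiv R) w * w ^ d = poly (pderiv P) w * poly T w + poly P w * poly (pderiv T) w - poly R w * (of_nat d * w ^ (d - 1))"
        by (simp add: algebra_simps)
      moreover have pw: "real d * cmod w ^ (d - 1) \<le> real d * 1"
        using w by (intro mult_left_mono power_le_one) auto
      ultimately have "cmod (poly (pderiv R) w * w ^ d) \<le> cmod (poly (pderiv P) w * poly T w) + cmod (poly P w * poly (pderiv T) w) + cmod (poly R w * (of_nat d * w ^ (d - 1)))"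
        using norm_triangle_ineq[of "poly (pderiv P) w * poly T w" "poly P w * poly (pderiv T) w"]
          norm_triangle_ineq4[of "poly (pderiv P) w * poly T w + poly P w * poly (pderiv T) w" "poly R w * (of_nat d * w ^ (d - 1))"]
        by simp
      also have "\<dots> \<le> A' * cmod (poly T w) + A * cmod (poly (pderiv T) w) + cmod (poly R w) * (d * 1)"
        unfolding norm_mult norm_power norm_of_nat using A(1) A(2)[of w] A'(1) A'(2)[of w] w pw
        by (intro add_mono mult_mono) auto
      finally have "?n * (cmod (poly (pderiv R) w) * cmod w ^ d) \<le> ?n * (A' * cmod (poly T w) + A * cmod (poly (pderiv T) w) + cmod (poly R w) * d)"
        using w by (intro mult_left_mono) (auto simp: norm_mult norm_power)
      also have "\<dots> = A' * (?n * cmod (poly T w)) + A * (?n * cmod (poly (pderiv T) w)) + (?n * cmod (poly R w)) * d"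
        by (simp add: algebra_simps)
      also have "\<dots> \<le> A' * \<epsilon> + A * \<epsilon> + (2 ^ d * A * \<epsilon>) * d"
        using A(1) A'(1) T1 R1 T[OF w(2)] by (intro add_mono mult_left_mono mult_right_mono) auto
      finally have bd: "?n * (cmod (poly (pderiv R) w) * cmod w ^ d) \<le> A' * \<epsilon> + A * \<epsilon> + (2 ^ d * A * \<epsilon>) * d" .
      have "?n * cmod (poly (pderiv R) w) \<le> (?n * cmod (poly (pderiv R) w)) * (2 ^ d * cmod w ^ d)"
        using mult_left_mono[OF w0', of "?n * cmod (poly (pderiv R) w)"] w by simp
      also have "\<dots> = 2 ^ d * (?n * (cmod (poly (pderiv R) w) * cmod w ^ d))"
        by simp
      also have "\<dots> \<le> 2 ^ d * (A' * \<epsilon> + A * \<epsilon> + (2 ^ d * A * \<epsilon>) * d)"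
        using bd by (intro mult_left_mono) auto
      finally show ?thesis
        by (simp add: C_def algebra_simps)
    qed
    show ?thesis
    proof (cases "1 / 2 \<le> cmod z")
      case True
      then show ?thesis
        using outer[OF True z] C \<open>\<epsilon> \<ge> 0\<close> mult_nonneg_nonneg[of C \<epsilon>] by linarith
    next
      case False
      have "cmod (poly (pderiv R) z) \<le> 2 * C * \<epsilon>"
      \<comment> \<open>On the circle of radius \<open>1 / 2\<close> the weight is
        \<open>1 / 2\<close>; this produces the factor \<open>2\<close> in the final
        constant.\<close>
      proof (rule maximum_modulus_frontier[of "poly (pderiv R)" "cball 0 (1/2)"])
        show "norm (poly (pderiv R) w) \<le> 2 * C * \<epsilon>" if "w \<in> frontier (cball 0 (1/2))" for w
        proof -
          have w: "cmod w = 1 / 2"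
            using that by simp
          then have "(1 - cmod w) * cmod (poly (pderiv R) w) \<le> C * \<epsilon>"
            by (intro outer) auto
          then show ?thesis
            unfolding w by simp
        qed
        show "poly (pderiv R) holomorphic_on interior (cball 0 (1/2))"
          "continuous_on (closure (cball 0 (1/2))) (poly (pderiv R))"
          by (intro holomorphic_intros continuous_intros)+
      qed (use False in auto)
      moreover have "(1 - cmod z) * cmod (poly (pderiv R) z) \<le> 1 * cmod (poly (pderiv R) z)"
        by (intro mult_right_mono) auto
      ultimately show ?thesis
        by simp
    qed
  qed
  then show ?thesis
    using C by (intro exI[of _ "2 * C"]) auto
qed

section \<open>Approximation tested against finitely many integrable functions\<close>

section \<open>Weak-star density of the trigonometric polynomials\<close>

text \<open>Stone-Weierstrass for real polynomials in the two coordinates, which are trigonometric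
  polynomials on the circle.\<close>

lemma trig_poly_uniformly_dense:
  fixes f :: "complex \<Rightarrow> real"
  assumes "continuous_on UNIV f" "e > 0"
  shows "\<exists>q. trig_poly q \<and> continuous_on UNIV q \<and> (\<forall>z\<in>sphere 0 1. cmod (q z - of_real (f z)) < e)"
proof -
  have "continuous_on (sphere 0 1) f"
    using assms(1) by (rule continuous_on_subset) simp
  then obtain g where g: "real_polynomial_function g" "\<And>z. z \<in> sphere 0 1 \<Longrightarrow> \<bar>f z - g z\<bar> < e"
    using Stone_Weierstrass_real_polynomial_function[OF compact_sphere _ assms(2), of 0 1 f] by blast
  show ?thesis
  proof (intro exI conjI ballI)
    show "trig_poly (\<lambda>z. of_real (g z))"
      by (rule trig_poly_real_polynomial_function[OF g(1)])
    have "continuous_on UNIV g"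
      using g(1) by (intro continuous_on_polymonial_function) (simp add: real_polynomial_function_eq)
    then show "continuous_on UNIV (\<lambda>z. complex_of_real (g z))"
      by (intro continuous_intros)
    show "cmod (of_real (g z) - of_real (f z)) < e" if "z \<in> sphere 0 1" for z
      using g(2)[OF that] by (simp only: of_real_diff[symmetric] norm_of_real abs_minus_commute)
  qed
qed

text \<open>A basic weak-star neighbourhood constrains only finitely many functionals. Fixing the
  finite set \<open>G\<close> of their densities lets bounded pointwise limits be handled by
  dominated convergence.\<close>

locale finite_L1_family =
  fixes K :: "complex set" and G :: "(complex \<Rightarrow> complex) set"
  assumes K_borel: "K \<in> sets borel" and K_sphere: "K \<subseteq> sphere 0 1"
    and fin_G: "finite G" and G_L1: "G \<subseteq> L1_on K"
begin

abbreviation M :: "complex measure" where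
  "M \<equiv> restrict_space circle_measure K"

text \<open>Membership in the closure of the trigonometric polynomials for the seminorms given by
  \<open>G\<close>; continuity of \<open>q\<close> on the plane gives measurability and
  boundedness.\<close>

definition approx :: "(complex \<Rightarrow> complex) \<Rightarrow> bool" where
  "approx h \<longleftrightarrow> (\<forall>e>0. \<exists>q. trig_poly q \<and> continuous_on UNIV q \<and>
     (\<forall>g\<in>G. cmod ((\<integral>z. q z * g z \<partial>M) - (\<integral>z. h z * g z \<partial>M)) < e))"

text \<open>The bound holds at every point of \<open>K\<close>, not merely almost everywhere;
  essential bounds are reduced to it by truncation.\<close>

definition bdd :: "(complex \<Rightarrow> complex) \<Rightarrow> bool" where
  "bdd h \<longleftrightarrow> h \<in> borel_measurable M \<and> (\<exists>C. \<forall>z\<in>K. cmod (h z) \<le> C)"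

lemma space_M: "space M = K"
  by (simp add: space_restrict_space)

lemma measurable_M: "f \<in> borel_measurable borel \<Longrightarrow> f \<in> borel_measurable M"
  by (intro measurable_restrict_space1 borel_measurable_circle_measure)

lemma G_integrable: "g \<in> G \<Longrightarrow> integrable M g"
  using G_L1 by (auto simp: L1_on_def)

lemma bdd_continuous:
  assumes "continuous_on UNIV q"
  shows "bdd q"
proof -
  have "bounded (q ` sphere 0 1)"
    using assms by (intro compact_imp_bounded compact_continuous_image compact_sphere)
      (rule continuous_on_subset, auto)
  then obtain C where "\<And>z. z \<in> sphere 0 1 \<Longrightarrow> norm (q z) \<le> C"
    unfolding bounded_iff by blast
  then show ?thesis
    unfolding bdd_def using K_sphere measurable_M[OF borel_measurable_continuous_onI[OF assms]] by blast
qed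

lemma integrable_bdd_mult:
  assumes "bdd h" "g \<in> G"
  shows "integrable M (\<lambda>z. h z * g z)"
proof -
  obtain C where C: "\<And>z. z \<in> K \<Longrightarrow> cmod (h z) \<le> C" and h: "h \<in> borel_measurable M"
    using assms(1) unfolding bdd_def by blast
  have g: "integrable M g"
    by (rule G_integrable[OF assms(2)])
  have gm: "g \<in> borel_measurable M"
    by (rule borel_measurable_integrable[OF g])
  show ?thesis
  proof (rule Bochner_Integration.integrable_bound)
    show "integrable M (\<lambda>z. of_real C * g z)"
      by (intro integrable_mult_right g)
    show "(\<lambda>z. h z * g z) \<in> borel_measurable M"
      by (intro borel_measurable_times h gm)
    have "cmod (h z * g z) \<le> cmod (of_real C * g z)" if "z \<in> K" for z
      unfolding norm_mult norm_of_real using C[OF that] by (intro mult_right_mono) auto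
    then show "AE z in M. cmod (h z * g z) \<le> cmod (of_real C * g z)"
      by (intro AE_I2) (simp add: space_M)
  qed
qed

lemma bdd_add: "bdd h1 \<Longrightarrow> bdd h2 \<Longrightarrow> bdd (\<lambda>z. h1 z + h2 z)"
proof -
  assume h: "bdd h1" "bdd h2"
  then obtain C1 C2 where "\<And>z. z \<in> K \<Longrightarrow> cmod (h1 z) \<le> C1" "\<And>z. z \<in> K \<Longrightarrow> cmod (h2 z) \<le> C2"
    unfolding bdd_def by blast
  then have "\<forall>z\<in>K. cmod (h1 z + h2 z) \<le> C1 + C2"
    by (intro ballI order_trans[OF norm_triangle_ineq] add_mono)
  moreover have "(\<lambda>z. h1 z + h2 z) \<in> borel_measurable M"
    using h unfolding bdd_def by (intro borel_measurable_add) auto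
  ultimately show ?thesis
    unfolding bdd_def by blast
qed

lemma bdd_cmult: "bdd h \<Longrightarrow> bdd (\<lambda>z. c * h z)"
proof -
  assume h: "bdd h"
  then obtain C where "\<And>z. z \<in> K \<Longrightarrow> cmod (h z) \<le> C"
    unfolding bdd_def by blast
  then have "\<forall>z\<in>K. cmod (c * h z) \<le> cmod c * C"
    unfolding norm_mult by (intro ballI mult_left_mono) auto
  moreover have "(\<lambda>z. c * h z) \<in> borel_measurable M"
    using h unfolding bdd_def by (intro borel_measurable_times) auto
  ultimately show ?thesis
    unfolding bdd_def by blast
qed

lemma approx_cong_AE:
  assumes h: "approx h" "bdd h" "bdd h'" and eq: "AE z in M. h' z = h z"
  shows "approx h'"
proof -
  have "(\<integral>z. h' z * g z \<partial>M) = (\<integral>z. h z * g z \<partial>M)" if "g \<in> G" for g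
    using eq by (intro integral_cong_AE borel_measurable_integrable integrable_bdd_mult h that)
      (auto elim!: eventually_mono)
  then show ?thesis
    using h(1) unfolding approx_def by simp
qed

lemma approx_add:
  assumes "approx h1" "approx h2" "bdd h1" "bdd h2"
  shows "approx (\<lambda>z. h1 z + h2 z)"
  unfolding approx_def
proof (intro allI impI)
  fix e :: real assume "e > 0"
  then have e2: "e / 2 > 0"
    by simp
  obtain q1 where q1: "trig_poly q1" "continuous_on UNIV q1"
      "\<And>g. g \<in> G \<Longrightarrow> cmod ((\<integral>z. q1 z * g z \<partial>M) - (\<integral>z. h1 z * g z \<partial>M)) < e / 2"
    using assms(1) e2 unfolding approx_def by blast
  obtain q2 where q2: "trig_poly q2" "continuous_on UNIV q2"
      "\<And>g. g \<in> G \<Longrightarrow> cmod ((\<integral>z. q2 z * g z \<partial>M) - (\<integral>z. h2 z * g z \<partial>M)) < e / 2"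
    using assms(2) e2 unfolding approx_def by blast
  have "cmod ((\<integral>z. (q1 z + q2 z) * g z \<partial>M) - (\<integral>z. (h1 z + h2 z) * g z \<partial>M)) < e" if g: "g \<in> G" for g
  proof -
    note int = integrable_bdd_mult[OF _ g]
    have "(\<integral>z. (q1 z + q2 z) * g z \<partial>M) - (\<integral>z. (h1 z + h2 z) * g z \<partial>M) =
      ((\<integral>z. q1 z * g z \<partial>M) - (\<integral>z. h1 z * g z \<partial>M)) + ((\<integral>z. q2 z * g z \<partial>M) - (\<integral>z. h2 z * g z \<partial>M))"
      unfolding distrib_right
      using int[OF bdd_continuous[OF q1(2)]] int[OF bdd_continuous[OF q2(2)]] int[OF assms(3)] int[OF assms(4)]
      by (simp add: Bochner_Integration.integral_add)
    also have "cmod \<dots> < e / 2 + e / 2"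
      by (intro norm_triangle_lt add_strict_mono q1(3) q2(3) g)
    finally show ?thesis
      by simp
  qed
  then show "\<exists>q. trig_poly q \<and> continuous_on UNIV q \<and>
      (\<forall>g\<in>G. cmod ((\<integral>z. q z * g z \<partial>M) - (\<integral>z. (h1 z + h2 z) * g z \<partial>M)) < e)"
    using trig_poly_add[OF q1(1) q2(1)] continuous_on_add[OF q1(2) q2(2)] by blast
qed

lemma approx_cmult:
  assumes "approx h"
  shows "approx (\<lambda>z. c * h z)"
  unfolding approx_def
proof (intro allI impI)
  fix e :: real assume "e > 0"
  then have "e / (cmod c + 1) > 0"
    by (simp add: add_nonneg_pos)
  then obtain q where q: "trig_poly q" "continuous_on UNIV q"
      "\<And>g. g \<in> G \<Longrightarrow> cmod ((\<integral>z. q z * g z \<partial>M) - (\<integral>z. h z * g z \<partial>M)) < e / (cmod c + 1)"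
    using assms unfolding approx_def by blast
  have "cmod ((\<integral>z. (c * q z) * g z \<partial>M) - (\<integral>z. (c * h z) * g z \<partial>M)) < e" if g: "g \<in> G" for g
  proof -
    have "(\<integral>z. (c * q z) * g z \<partial>M) - (\<integral>z. (c * h z) * g z \<partial>M) = c * ((\<integral>z. q z * g z \<partial>M) - (\<integral>z. h z * g z \<partial>M))"
      by (simp add: mult.assoc right_diff_distrib)
    also have "cmod \<dots> \<le> (cmod c + 1) * cmod ((\<integral>z. q z * g z \<partial>M) - (\<integral>z. h z * g z \<partial>M))"
      unfolding norm_mult by (intro mult_right_mono) auto
    also have "\<dots> < (cmod c + 1) * (e / (cmod c + 1))"
      by (intro mult_strict_left_mono q(3) g) (simp add: add_nonneg_pos)
    also have "\<dots> = e"
      by (simp add: add_nonneg_eq_0_iff)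
    finally show ?thesis .
  qed
  then show "\<exists>q. trig_poly q \<and> continuous_on UNIV q \<and>
      (\<forall>g\<in>G. cmod ((\<integral>z. q z * g z \<partial>M) - (\<integral>z. (c * h z) * g z \<partial>M)) < e)"
    using trig_poly_mult[OF trig_poly_const[of c] q(1)] continuous_on_mult[OF continuous_on_const[of _ c] q(2)] by blast
qed

text \<open>Dominated convergence for each \<open>g\<close>; as \<open>G\<close> is finite, one
  index \<open>i\<close> serves all of them.\<close>

lemma approx_limit:
  assumes H: "\<And>i::nat. approx (H i)" "\<And>i. H i \<in> borel_measurable M" "\<And>i z. z \<in> K \<Longrightarrow> cmod (H i z) \<le> C"
    and h: "h \<in> borel_measurable M" "\<And>z. z \<in> K \<Longrightarrow> (\<lambda>i. H i z) \<longlonglongrightarrow> h z"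
  shows "approx h"
  unfolding approx_def
proof (intro allI impI)
  fix e :: real assume "e > 0"
  then have e2: "e / 2 > 0"
    by simp
  have "(\<lambda>i. \<integral>z. H i z * g z \<partial>M) \<longlonglongrightarrow> (\<integral>z. h z * g z \<partial>M)" if g: "g \<in> G" for g
  proof (rule integral_dominated_convergence)
    have gm: "g \<in> borel_measurable M"
      by (rule borel_measurable_integrable[OF G_integrable[OF g]])
    show "(\<lambda>z. h z * g z) \<in> borel_measurable M" "(\<lambda>z. H i z * g z) \<in> borel_measurable M" for i
      by (intro borel_measurable_times H h gm)+
    show "integrable M (\<lambda>z. C * norm (g z))"
      by (intro integrable_mult_right integrable_norm G_integrable g)
    show "AE z in M. (\<lambda>i. H i z * g z) \<longlonglongrightarrow> h z * g z"
      by (intro AE_I2 tendsto_mult_right h(2)) (simp add: space_M)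
    show "AE z in M. norm (H i z * g z) \<le> C * norm (g z)" for i
      unfolding norm_mult by (intro AE_I2 mult_right_mono H(3)) (auto simp: space_M)
  qed
  then have "\<forall>g\<in>G. \<forall>\<^sub>F i in sequentially. dist (\<integral>z. H i z * g z \<partial>M) (\<integral>z. h z * g z \<partial>M) < e / 2"
    using e2 by (intro ballI tendstoD)
  then have "\<forall>\<^sub>F i in sequentially. \<forall>g\<in>G. dist (\<integral>z. H i z * g z \<partial>M) (\<integral>z. h z * g z \<partial>M) < e / 2"
    using fin_G by (simp add: eventually_ball_finite)
  then obtain i where i: "\<And>g. g \<in> G \<Longrightarrow> cmod ((\<integral>z. H i z * g z \<partial>M) - (\<integral>z. h z * g z \<partial>M)) < e / 2"
    unfolding eventually_sequentially dist_norm by blast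
  obtain q where q: "trig_poly q" "continuous_on UNIV q"
      "\<And>g. g \<in> G \<Longrightarrow> cmod ((\<integral>z. q z * g z \<partial>M) - (\<integral>z. H i z * g z \<partial>M)) < e / 2"
    using H(1)[of i] e2 unfolding approx_def by blast
  have "cmod ((\<integral>z. q z * g z \<partial>M) - (\<integral>z. h z * g z \<partial>M)) < e" if "g \<in> G" for g
    using norm_diff_triangle_less[OF q(3)[OF that] i[OF that]] by simp
  then show "\<exists>q. trig_poly q \<and> continuous_on UNIV q \<and>
      (\<forall>g\<in>G. cmod ((\<integral>z. q z * g z \<partial>M) - (\<integral>z. h z * g z \<partial>M)) < e)"
    using q by blast
qed

text \<open>A uniform error on the circle is multiplied at most by an \<open>L1\<close> norm, and
  \<open>A\<close> exceeds the sum of all these norms.\<close>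

lemma approx_continuous:
  assumes f: "continuous_on UNIV f"
  shows "approx (\<lambda>z. of_real (f z))"
  unfolding approx_def
proof (intro allI impI)
  fix e :: real assume "e > 0"
  define A where "A = (\<Sum>g\<in>G. \<integral>z. cmod (g z) \<partial>M) + 1"
  have nn: "0 \<le> (\<integral>z. cmod (g z) \<partial>M)" for g
    by (intro integral_nonneg_AE) auto
  have "A > 0"
    unfolding A_def by (intro add_nonneg_pos sum_nonneg nn) simp
  with \<open>e > 0\<close> obtain q where q: "trig_poly q" "continuous_on UNIV q"
      "\<And>z. z \<in> sphere 0 1 \<Longrightarrow> cmod (q z - of_real (f z)) < e / A"
    using trig_poly_uniformly_dense[OF f, of "e / A"] by auto
  have "cmod ((\<integral>z. q z * g z \<partial>M) - (\<integral>z. of_real (f z) * g z \<partial>M)) < e" if g: "g \<in> G" for g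
  proof -
    have i1: "integrable M (\<lambda>z. q z * g z)" "integrable M (\<lambda>z. of_real (f z) * g z)"
      by (intro integrable_bdd_mult bdd_continuous q g continuous_intros f)+
    have "cmod ((\<integral>z. q z * g z \<partial>M) - (\<integral>z. of_real (f z) * g z \<partial>M)) = cmod (\<integral>z. q z * g z - of_real (f z) * g z \<partial>M)"
      by (simp only: Bochner_Integration.integral_diff[OF i1])
    also have "\<dots> \<le> (\<integral>z. cmod (q z * g z - of_real (f z) * g z) \<partial>M)"
      by (rule integral_norm_bound)
    also have "\<dots> \<le> (\<integral>z. e / A * cmod (g z) \<partial>M)"
    proof (rule integral_mono_AE)
      show "integrable M (\<lambda>z. cmod (q z * g z - of_real (f z) * g z))"
        by (intro integrable_norm Bochner_Integration.integrable_diff i1)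
      show "integrable M (\<lambda>z. e / A * cmod (g z))"
        by (intro integrable_mult_right integrable_norm G_integrable g)
      have "cmod (q z * g z - of_real (f z) * g z) \<le> e / A * cmod (g z)" if "z \<in> K" for z
        unfolding left_diff_distrib[symmetric] norm_mult
        using q(3)[of z] that K_sphere by (intro mult_right_mono) auto
      then show "AE z in M. cmod (q z * g z - of_real (f z) * g z) \<le> e / A * cmod (g z)"
        by (intro AE_I2) (simp add: space_M)
    qed
    also have "\<dots> = e / A * (\<integral>z. cmod (g z) \<partial>M)"
      by simp
    also have "\<dots> < e / A * A"
    proof (rule mult_strict_left_mono)
      have "(\<integral>z. cmod (g z) \<partial>M) \<le> (\<Sum>g\<in>G. \<integral>z. cmod (g z) \<partial>M)"
        by (rule member_le_sum[OF g nn fin_G])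
      then show "(\<integral>z. cmod (g z) \<partial>M) < A"
        by (simp add: A_def)
    qed (use \<open>A > 0\<close> \<open>e > 0\<close> in simp)
    also have "\<dots> = e"
      using \<open>A > 0\<close> by simp
    finally show ?thesis .
  qed
  then show "\<exists>q. trig_poly q \<and> continuous_on UNIV q \<and>
      (\<forall>g\<in>G. cmod ((\<integral>z. q z * g z \<partial>M) - (\<integral>z. of_real (f z) * g z \<partial>M)) < e)"
    using q by blast
qed

lemma approx_indicator_closed:
  assumes "closed C"
  shows "approx (indicator C)"
\<comment> \<open>The distance to the empty set is \<open>0\<close> by convention, so the cutoffs
  used below would then tend to \<open>1\<close>.\<close>
proof (cases "C = {}")
  case True
  then have "indicator C = (\<lambda>_::complex. complex_of_real 0)"
    by auto
  then show ?thesis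
    using approx_continuous[of "\<lambda>_. 0"] by simp
next
  case False
  \<comment> \<open>Continuous cutoffs equal to \<open>1\<close> on \<open>C\<close>. Off the closed
    set \<open>C\<close> the distance is positive, so they vanish there for large
    \<open>n\<close>.\<close>
  define f where "f n z = max 0 (1 - real n * infdist z C)" for n z
  have cont: "continuous_on UNIV (f n)" for n
    unfolding f_def by (intro continuous_intros)
  have bound: "\<bar>f n z\<bar> \<le> 1" for n z
    by (simp add: f_def infdist_nonneg)
  have lim: "(\<lambda>n. f n z) \<longlonglongrightarrow> indicator C z" for z
  proof (cases "z \<in> C")
    case True
    then show ?thesis
      by (simp add: f_def)
  next
    case z: False
    then have pos: "infdist z C > 0"
      using False assms infdist_pos_not_in_closed by blast
    then obtain N :: nat where N: "1 / infdist z C < N"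
      using reals_Archimedean2 by blast
    have "f n z = 0" if "n \<ge> N" for n
    proof -
      have "1 / infdist z C < n"
        using N that by linarith
      then show ?thesis
        using pos by (simp add: f_def field_simps)
    qed
    then have "\<forall>\<^sub>F n in sequentially. f n z = 0"
      by (auto simp: eventually_sequentially)
    then show ?thesis
      using z by (simp add: tendsto_eventually)
  qed
  show ?thesis
  proof (rule approx_limit)
    show "approx (\<lambda>z. of_real (f n z))" for n
      by (rule approx_continuous[OF cont])
    show "(\<lambda>z. complex_of_real (f n z)) \<in> borel_measurable M" for n
      by (intro measurable_M borel_measurable_continuous_onI continuous_intros cont)
    show "cmod (of_real (f n z)) \<le> 1" for n z
      using bound by simp
    show "indicator C \<in> borel_measurable M"
      using assms by (intro measurable_M borel_measurable_indicator) auto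
    show "(\<lambda>n. complex_of_real (f n z)) \<longlonglongrightarrow> indicator C z" for z
      using tendsto_of_real[OF lim[of z], where 'a = complex] by (cases "z \<in> C") simp_all
  qed
qed

lemma bdd_indicator: "A \<in> sets M \<Longrightarrow> bdd (indicator A)"
  unfolding bdd_def by (intro conjI borel_measurable_indicator exI[of _ 1]) (auto simp: indicator_def)

lemma bdd_indicator_borel: "A \<in> sets borel \<Longrightarrow> bdd (indicator A)"
  unfolding bdd_def by (intro conjI measurable_M borel_measurable_indicator exI[of _ 1]) (auto simp: indicator_def)

text \<open>Dynkin's argument: closed sets form an intersection-stable generator, complements follow
  by linearity, and disjoint unions are bounded limits of finite ones.\<close>

lemma approx_indicator_borel:
  assumes "A \<in> sets borel"
  shows "approx (indicator A)"
proof -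
  have borel: "B \<in> sets borel" if "B \<in> sigma_sets UNIV (Collect closed)" for B :: "complex set"
    using that by (simp add: borel_eq_closed)
  have "Int_stable (Collect closed :: complex set set)"
    by (auto simp: Int_stable_def)
  moreover have "Collect closed \<subseteq> Pow (UNIV :: complex set)"
    by simp
  moreover have "A \<in> sigma_sets UNIV (Collect closed)"
    using assms by (simp add: borel_eq_closed)
  ultimately show ?thesis
  proof (induction rule: sigma_sets_induct_disjoint)
    case (basic A)
    then show ?case
      by (simp add: approx_indicator_closed)
  next
    case empty
    then show ?case
      by (rule approx_indicator_closed) simp
  next
    case (compl A)
    have "approx (indicator UNIV)"
      by (rule approx_indicator_closed) simp
    then have "approx (\<lambda>z. indicator UNIV z + (- 1) * indicator A z)"
      by (intro approx_add approx_cmult bdd_cmult bdd_indicator_borel borel compl) auto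
    moreover have "(\<lambda>z. indicator UNIV z + (- 1) * indicator A z) = (indicator (UNIV - A) :: complex \<Rightarrow> complex)"
      by (auto simp: indicator_def fun_eq_iff)
    ultimately show ?case
      by simp
  next
    case (union A)
    have A: "A i \<in> sets borel" for i
      using union by (intro borel) auto
    have app: "approx (indicator (\<Union>i<n. A i))" for n
    proof (induction n)
      case 0
      then show ?case
        using approx_indicator_closed[of "{}"] by (simp only: lessThan_0 image_empty Union_empty closed_empty)
    next
      case (Suc n)
      have "approx (\<lambda>z. indicator (\<Union>i<n. A i) z + indicator (A n) z)"
        by (intro approx_add Suc union bdd_indicator_borel A sets.finite_UN) auto
      moreover have "A n \<inter> A i = {}" if "i < n" for i
        by (rule disjoint_family_onD[OF union(1)]) (use that in auto)
      then have "A n \<inter> (\<Union>i<n. A i) = {}"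
        by blast
      then have "(\<lambda>z. indicator (\<Union>i<n. A i) z + indicator (A n) z) = (indicator (\<Union>i<Suc n. A i) :: complex \<Rightarrow> complex)"
        by (auto simp: indicator_def fun_eq_iff lessThan_Suc)
      ultimately show ?case
        by simp
    qed
    show ?case
    proof (rule approx_limit[OF app])
      show "indicator (\<Union>i<n. A i) \<in> borel_measurable M" for n
        by (intro measurable_M borel_measurable_indicator sets.finite_UN A) auto
      show "indicator (\<Union>(range A)) \<in> borel_measurable M"
        by (intro measurable_M borel_measurable_indicator sets.countable_UN) (auto intro: A)
      show "cmod (indicator (\<Union>i<n. A i) z) \<le> 1" for n z
        by (simp add: indicator_def)
      show "(\<lambda>n. indicator (\<Union>i<n. A i) z) \<longlonglongrightarrow> (indicator (\<Union>(range A)) z :: complex)" for z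
        by (rule LIMSEQ_indicator_UN)
    qed
  qed
qed

text \<open>Sets of the completed measure differ from Borel sets by null sets, which the integrals
  do not see.\<close>

lemma approx_indicator:
  assumes "A \<in> sets M"
  shows "approx (indicator A)"
proof -
  obtain B where B: "B \<in> sets circle_measure" "A = K \<inter> B"
    using assms by (auto simp: sets_restrict_space)
  obtain S N N' where S: "B = S \<union> N" "N \<subseteq> N'"
      "N' \<in> null_sets (distr (restrict_space lborel {0..<1}) borel circ)" "S \<in> sets borel"
    using B(1) unfolding circle_measure_def by (elim sets_completionE) simp
  have "N' \<in> null_sets circle_measure"
    unfolding circle_measure_def using S(3) by (rule null_sets_completionI)
  then have "AE z in circle_measure. z \<notin> N'"
    by (rule AE_not_in)
  then have "AE z in M. z \<notin> N'"
    by (subst AE_restrict_space_iff) (auto intro: K_borel elim: eventually_mono)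
  moreover have "AE z in M. z \<in> K"
    by (intro AE_I2) (simp add: space_M)
  ultimately have "AE z in M. indicator A z = (indicator S z :: complex)"
    by eventually_elim (use S B in \<open>auto simp: indicator_def\<close>)
  then show ?thesis
    using approx_indicator_borel[OF S(4)] bdd_indicator_borel[OF S(4)] bdd_indicator[OF assms]
    by (intro approx_cong_AE[of "indicator S" "indicator A"])
qed

lemma approx_nonneg:
  fixes u :: "complex \<Rightarrow> real"
  assumes "u \<in> borel_measurable M" "\<And>z. 0 \<le> u z" "\<And>z. z \<in> K \<Longrightarrow> u z \<le> C"
  shows "approx (\<lambda>z. of_real (u z))"
proof -
  \<comment> \<open>The bound is quantified inside the induction since it changes: the scaling case
    applies the hypothesis with \<open>C / c\<close>.\<close>
  have "\<forall>C. (\<forall>z\<in>K. u z \<le> C) \<longrightarrow> approx (\<lambda>z. of_real (u z))"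
    using assms(1,2)
  proof (induction u rule: borel_measurable_induct_real)
    case (set A)
    have "(\<lambda>z. complex_of_real (indicator A z)) = indicator A"
      by (auto simp: indicator_def)
    then show ?case
      using approx_indicator[OF set] by simp
  next
    case (mult u c)
    show ?case
    proof (intro allI impI)
      fix C assume C: "\<forall>z\<in>K. c * u z \<le> C"
      show "approx (\<lambda>z. of_real (c * u z))"
      proof (cases "c = 0")
        case True
        then show ?thesis
          using approx_continuous[of "\<lambda>_. 0"] by simp
      next
        case False
        then have "\<forall>z\<in>K. u z \<le> C / c"
          using C mult.hyps(1) by (auto simp: field_simps)
        then have "approx (\<lambda>z. of_real (u z))"
          using mult.IH by blast
        then show ?thesis
          using approx_cmult[of "\<lambda>z. of_real (u z)" "of_real c"] by simp
      qed
    qed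
  next
    case (add u v)
    show ?case
    proof (intro allI impI)
      fix C assume C: "\<forall>z\<in>K. v z + u z \<le> C"
      have le: "u z \<le> C" "v z \<le> C" if "z \<in> K" for z
        using C[rule_format, OF that] add.hyps(2)[of z] add.hyps(4)[of z] by linarith+
      have "bdd (\<lambda>z. of_real (u z))" "bdd (\<lambda>z. of_real (v z))"
        unfolding bdd_def using le add.hyps(1-4) by (auto intro!: exI[of _ C])
      moreover have "approx (\<lambda>z. of_real (u z))" "approx (\<lambda>z. of_real (v z))"
        using le add.IH by blast+
      ultimately show "approx (\<lambda>z. of_real (v z + u z))"
        using approx_add[of "\<lambda>z. of_real (v z)" "\<lambda>z. of_real (u z)"] by simp
    qed
  next
    case (seq U)
    show ?case
    proof (intro allI impI)
      fix C assume C: "\<forall>z\<in>K. u z \<le> C"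
      have le: "U i z \<le> C" if "z \<in> K" for i z
      proof -
        have "incseq (\<lambda>i. U i z)"
          using seq.hyps(3) by (auto simp: incseq_def le_fun_def)
        then have "U i z \<le> u z"
          by (rule incseq_le) (use seq.hyps(4)[of z] that in \<open>simp add: space_M\<close>)
        then show ?thesis
          using C that by force
      qed
      show "approx (\<lambda>z. of_real (u z))"
      proof (rule approx_limit)
        show "approx (\<lambda>z. of_real (U i z))" for i
          using seq.IH[of i] le by blast
        show "(\<lambda>z. complex_of_real (U i z)) \<in> borel_measurable M" for i
          using seq.hyps(1)[of i] by simp
        show "cmod (of_real (U i z)) \<le> C" if "z \<in> K" for i z
          using le[OF that] seq.hyps(2)[of i z] by simp
        show "(\<lambda>z. complex_of_real (u z)) \<in> borel_measurable M"
          using assms(1) by simp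
        show "(\<lambda>i. complex_of_real (U i z)) \<longlonglongrightarrow> of_real (u z)" if "z \<in> K" for z
          using seq.hyps(4)[of z] that by (intro tendsto_of_real) (simp add: space_M)
      qed
    qed
  qed
  then show ?thesis
    using assms(3) by blast
qed

text \<open>After truncation to a bounded representative \<open>k\<close>, the positive and negative
  parts of \<open>Re\<close> and \<open>Im\<close> are treated separately and recombined
  linearly.\<close>

lemma approx_Linf:
  assumes "h \<in> Linf_on K"
  shows "approx h"
proof -
  obtain C where h: "h \<in> borel_measurable M" and C: "AE z in M. cmod (h z) \<le> C"
    using assms unfolding Linf_on_def by blast
  define k where "k z = (if cmod (h z) \<le> C then h z else 0)" for z
  have k: "k \<in> borel_measurable M"
    unfolding k_def using h by measurable
  have kC: "cmod (k z) \<le> max C 0" for z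
    by (auto simp: k_def)
  have part: "approx (\<lambda>z. of_real (max 0 (f (k z))))" "bdd (\<lambda>z. of_real (max 0 (f (k z))))"
    if f: "continuous_on UNIV f" "\<And>x. \<bar>f x\<bar> \<le> cmod x" for f :: "complex \<Rightarrow> real"
  proof -
    have fk: "(\<lambda>z. f (k z)) \<in> borel_measurable M"
      by (rule borel_measurable_continuous_on[OF f(1) k])
    have le: "max 0 (f (k z)) \<le> max C 0" for z
      using f(2)[of "k z"] kC[of z] by linarith
    show "approx (\<lambda>z. of_real (max 0 (f (k z))))"
      by (rule approx_nonneg[where C = "max C 0"]) (use fk le in auto)
    show "bdd (\<lambda>z. of_real (max 0 (f (k z))))"
      unfolding bdd_def using fk le by (intro conjI exI[of _ "max C 0"]) auto
  qed
  have real: "approx (\<lambda>z. of_real (f (k z)))" "bdd (\<lambda>z. of_real (f (k z)))"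
    if f: "continuous_on UNIV f" "\<And>x. \<bar>f x\<bar> \<le> cmod x" for f :: "complex \<Rightarrow> real"
  proof -
    have f': "continuous_on UNIV (\<lambda>x. - f x)" "\<bar>- f x\<bar> \<le> cmod x" for x
      using f by (auto intro: continuous_on_minus)
    have "(\<lambda>z. of_real (max 0 (f (k z))) + (-1) * of_real (max 0 (- f (k z)))) = (\<lambda>z. complex_of_real (f (k z)))"
      by (rule ext) (simp add: max_def)
    then show "approx (\<lambda>z. of_real (f (k z)))" "bdd (\<lambda>z. of_real (f (k z)))"
      using approx_add[OF part(1)[OF f] approx_cmult[OF part(1)[OF f']] part(2)[OF f] bdd_cmult[OF part(2)[OF f']], of "-1"]
        bdd_add[OF part(2)[OF f] bdd_cmult[OF part(2)[OF f']], of "-1"]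
      by simp_all
  qed
  have Re: "continuous_on UNIV Re" "\<bar>Re x\<bar> \<le> cmod x" and Im: "continuous_on UNIV Im" "\<bar>Im x\<bar> \<le> cmod x" for x
    by (auto intro: continuous_intros abs_Re_le_cmod abs_Im_le_cmod)
  have "approx (\<lambda>z. of_real (Re (k z)) + \<i> * of_real (Im (k z)))"
    by (rule approx_add[OF real(1)[OF Re] approx_cmult[OF real(1)[OF Im]] real(2)[OF Re] bdd_cmult[OF real(2)[OF Im]]])
  then have "approx k"
    by (simp only: complex_eq[symmetric])
  have eq: "AE z in M. h z = k z"
    using C by eventually_elim (simp add: k_def)
  show ?thesis
    unfolding approx_def
  proof (intro allI impI)
    fix e :: real assume "e > 0"
    then obtain q where q: "trig_poly q" "continuous_on UNIV q"
        "\<And>g. g \<in> G \<Longrightarrow> cmod ((\<integral>z. q z * g z \<partial>M) - (\<integral>z. k z * g z \<partial>M)) < e"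
      using \<open>approx k\<close> unfolding approx_def by blast
    have "(\<integral>z. h z * g z \<partial>M) = (\<integral>z. k z * g z \<partial>M)" if "g \<in> G" for g
      using eq borel_measurable_integrable[OF G_integrable[OF that]] h k
      by (intro integral_cong_AE) (auto elim!: eventually_mono)
    then show "\<exists>q. trig_poly q \<and> continuous_on UNIV q \<and>
        (\<forall>g\<in>G. cmod ((\<integral>z. q z * g z \<partial>M) - (\<integral>z. h z * g z \<partial>M)) < e)"
      using q by auto
  qed
qed

end

section \<open>From peak polynomials to the SA-property\<close>

section \<open>Simultaneous approximation\<close>

text \<open>The approximant is \<open>p + R\<close>: \<open>p\<close> approximates \<open>f\<close>
  in the Bloch norm, and \<open>R\<close> has small Bloch norm but repairs \<open>p\<close> on
  \<open>K\<close>. On the circle \<open>R\<close> is the Laurent polynomial \<open>q\<close> times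
  \<open>T\<close>, and the zero of \<open>T\<close> at \<open>0\<close> cancels the pole of
  \<open>q\<close>.\<close>

lemma simultaneous_poly_approx:
  assumes K: "compact K" "K \<subseteq> sphere 0 1"
    and peaks: "\<And>\<epsilon> d. \<epsilon> > 0 \<Longrightarrow> \<exists>S m. m > d \<and> poly S 0 = 0 \<and>
      (\<forall>z. cmod z < 1 \<longrightarrow> (1 - cmod z) * cmod (poly (pderiv S) z) \<le> \<epsilon>) \<and>
      (\<forall>z\<in>K. cmod (poly S (z ^ m) - 1) \<le> \<epsilon>)"
    and f: "f \<in> little_bloch" and h: "h \<in> Linf_on K" and G: "finite G" "G \<subseteq> L1_on K" and e: "e > 0"
  shows "\<exists>Q. bloch_dist f (restrict (poly Q) (ball 0 1)) < e \<and>
    (\<forall>g\<in>G. cmod ((\<integral>z. poly Q z * g z \<partial>restrict_space circle_measure K) -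
                   (\<integral>z. h z * g z \<partial>restrict_space circle_measure K)) < e)"
proof -
  interpret finite_L1_family K G
    by standard (use K G in \<open>auto intro: borel_compact\<close>)
  obtain p where p: "poly p 0 = f 0"
      "\<And>z. cmod z < 1 \<Longrightarrow> (1 - cmod z) * cmod (deriv f z - poly (pderiv p) z) \<le> e / 4"
    using little_bloch_poly_dense[OF f, of "e / 4"] e by auto
  have "e / 2 > 0"
    using e by simp
  then obtain q' where q': "trig_poly q'" "continuous_on UNIV q'"
      "\<And>g. g \<in> G \<Longrightarrow> cmod ((\<integral>z. q' z * g z \<partial>M) - (\<integral>z. h z * g z \<partial>M)) < e / 2"
    using approx_Linf[OF h] unfolding approx_def by blast
  \<comment> \<open>The correction on \<open>K\<close>: \<open>p + q\<close> equals the
    trigonometric polynomial \<open>q'\<close> approximating \<open>h\<close>.\<close>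
  define q where "q z = q' z + (- 1) * poly p z" for z
  have "trig_poly q"
    unfolding q_def by (rule trig_poly_add[OF q'(1) trig_poly_mult[OF trig_poly_const trig_poly_poly]])
  then obtain P d where P: "\<And>z. z \<in> sphere 0 1 \<Longrightarrow> q z = poly P z * cnj z ^ d"
    unfolding trig_poly_def by blast
  have cont_q: "continuous_on UNIV q"
    unfolding q_def by (intro continuous_intros q')
  obtain A where A: "A > 0" "\<And>z. cmod z \<le> 1 \<Longrightarrow> cmod (poly P z) \<le> A"
    using poly_bounded_cball[of P] by blast
  obtain C where C0: "C > 0" and C: "\<forall>T R \<epsilon>. poly T 0 = 0 \<longrightarrow>
      (\<forall>z. cmod z < 1 \<longrightarrow> (1 - cmod z) * cmod (poly (pderiv T) z) \<le> \<epsilon>) \<longrightarrow>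
      R * monom 1 d = P * T \<longrightarrow> (\<forall>z. cmod z < 1 \<longrightarrow> (1 - cmod z) * cmod (poly (pderiv R) z) \<le> C * \<epsilon>)"
    using bloch_bound_quotient[of d P] by blast
  define B where "B = (\<Sum>g\<in>G. \<integral>z. cmod (g z) \<partial>M) + 1"
  have nn: "0 \<le> (\<integral>z. cmod (g z) \<partial>M)" for g
    by (intro integral_nonneg_AE) auto
  have B: "B > 0"
    unfolding B_def by (intro add_nonneg_pos sum_nonneg nn) simp
  have B_ge: "(\<integral>z. cmod (g z) \<partial>M) \<le> B" if "g \<in> G" for g
    using member_le_sum[OF that, of "\<lambda>g. \<integral>z. cmod (g z) \<partial>M"] nn G(1) by (simp add: B_def)
  \<comment> \<open>The first entry controls the Bloch norm of \<open>R\<close>, the second the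
    integrals of \<open>R - q\<close> against the members of \<open>G\<close>.\<close>
  define \<epsilon> where "\<epsilon> = min (e / 4 / C) (e / 4 / (A * B))"
  have \<epsilon>: "\<epsilon> > 0" "C * \<epsilon> \<le> e / 4" "A * \<epsilon> * B \<le> e / 4"
  proof -
    show "\<epsilon> > 0"
      using A(1) B C0 e by (simp add: \<epsilon>_def)
    have "C * \<epsilon> \<le> C * (e / 4 / C)" "(A * B) * \<epsilon> \<le> (A * B) * (e / 4 / (A * B))"
      using A(1) B C0 by (intro mult_left_mono; simp add: \<epsilon>_def)+
    then show "C * \<epsilon> \<le> e / 4" "A * \<epsilon> * B \<le> e / 4"
      using A(1) B C0 by (simp_all add: mult_ac)
  qed
  obtain S m where m: "m > d" and S0: "poly S 0 = 0"
    and S: "\<And>z. cmod z < 1 \<Longrightarrow> (1 - cmod z) * cmod (poly (pderiv S) z) \<le> \<epsilon>"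
      "\<And>z. z \<in> K \<Longrightarrow> cmod (poly S (z ^ m) - 1) \<le> \<epsilon>"
    using peaks[OF \<epsilon>(1), of d] by blast
  \<comment> \<open>Splitting off \<open>z\<close> from \<open>S\<close> shows that
    \<open>T\<close>, which is \<open>S\<close> at \<open>z ^ m\<close>, is divisible by
    \<open>z ^ m\<close>. As \<open>m > d\<close>, the quotient \<open>R\<close> is a polynomial
    that still vanishes at \<open>0\<close>.\<close>
  have "[:- 0, 1:] dvd S"
    using S0 by (simp only: poly_eq_0_iff_dvd)
  then obtain S1 where S1: "S = [:0, 1:] * S1"
    by (auto elim: dvdE)
  define T where "T = pcompose S (monom 1 m)"
  define R where "R = P * monom 1 (m - d) * pcompose S1 (monom 1 m)"
  have "T = monom 1 m * pcompose S1 (monom 1 m)"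
    unfolding T_def S1 pcompose_mult by (simp add: pcompose_pCons)
  moreover have "monom 1 (m - d) * monom 1 d = (monom 1 m :: complex poly)"
    using m by (simp add: mult_monom)
  ultimately have RT: "R * monom 1 d = P * T"
    unfolding R_def by (metis mult.assoc mult.commute)
  have T0: "poly T 0 = 0"
    using m S0 by (cases m) (simp_all add: T_def poly_pcompose poly_monom)
  have R0: "poly R 0 = 0"
    using m by (cases "m - d") (simp_all add: R_def poly_monom)
  have TB: "(1 - cmod z) * cmod (poly (pderiv T) z) \<le> \<epsilon>" if "cmod z < 1" for z
    unfolding T_def by (rule bloch_bound_pcompose_power[OF S(1) _ that]) (use m in auto)
  have RB: "(1 - cmod z) * cmod (poly (pderiv R) z) \<le> C * \<epsilon>" if "cmod z < 1" for z
    using C T0 TB RT that by blast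
  have R_K: "cmod (poly R z - q z) \<le> A * \<epsilon>" if z: "z \<in> K" for z
  proof -
    have z1: "cmod z = 1"
      using z K by auto
    have "poly R z * z ^ d = poly P z * poly T z"
      using arg_cong[OF RT, of "\<lambda>p. poly p z"] by (simp add: poly_monom)
    then have "poly R z * (z ^ d * cnj z ^ d) = poly P z * cnj z ^ d * poly T z"
      by (simp add: mult_ac)
    then have "poly R z - q z = q z * (poly T z - 1)"
      using P[of z] z1 by (simp add: sphere_mult_cnj algebra_simps)
    also have "cmod \<dots> \<le> A * \<epsilon>"
      unfolding norm_mult
    proof (intro mult_mono)
      show "cmod (q z) \<le> A"
        using P[of z] A(2)[of z] z1 by (simp add: norm_mult norm_power)
      show "cmod (poly T z - 1) \<le> \<epsilon>"
        using S(2)[OF z] by (simp add: T_def poly_pcompose poly_monom)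
    qed (use A(1) in auto)
    finally show ?thesis .
  qed
  show ?thesis
  proof (intro exI conjI ballI)
    have "bloch_dist f (restrict (poly (p + R)) (ball 0 1)) \<le> cmod (f 0 - restrict (poly (p + R)) (ball 0 1) 0) + e / 2"
    proof (rule bloch_dist_le[OF f restrict_poly_in_little_bloch])
      fix z assume z: "cmod z < 1"
      have "(1 - cmod z) * cmod (deriv f z - deriv (restrict (poly (p + R)) (ball 0 1)) z) \<le>
          (1 - cmod z) * (cmod (deriv f z - poly (pderiv p) z) + cmod (poly (pderiv R) z))"
        unfolding deriv_restrict_poly[OF z] using z
          norm_triangle_ineq4[of "deriv f z - poly (pderiv p) z" "poly (pderiv R) z"]
        by (intro mult_left_mono) (auto simp: pderiv_add algebra_simps)
      also have "\<dots> \<le> e / 4 + e / 4"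
        unfolding distrib_left using p(2)[OF z] RB[OF z] \<epsilon>(2) by linarith
      finally show "(1 - cmod z) * cmod (deriv f z - deriv (restrict (poly (p + R)) (ball 0 1)) z) \<le> e / 2"
        by simp
    qed
    also have "\<dots> < e"
      using p(1) R0 e by simp
    finally show "bloch_dist f (restrict (poly (p + R)) (ball 0 1)) < e" .
    fix g assume g: "g \<in> G"
    have cont: "continuous_on UNIV (poly r)" for r :: "complex poly"
      by (intro continuous_intros)
    note int = integrable_bdd_mult[OF bdd_continuous g]
    have "(\<integral>z. poly (p + R) z * g z \<partial>M) = (\<integral>z. poly p z * g z \<partial>M) + (\<integral>z. poly R z * g z \<partial>M)"
      by (simp only: poly_add distrib_right Bochner_Integration.integral_add[OF int[OF cont] int[OF cont]])
    moreover have "(\<integral>z. q' z * g z \<partial>M) = (\<integral>z. poly p z * g z \<partial>M) + (\<integral>z. q z * g z \<partial>M)"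
    proof -
      have "q' z * g z = poly p z * g z + q z * g z" for z
        by (simp add: q_def algebra_simps)
      then show ?thesis
        by (simp only: Bochner_Integration.integral_add[OF int[OF cont] int[OF cont_q]])
    qed
    moreover have "cmod ((\<integral>z. poly R z * g z \<partial>M) - (\<integral>z. q z * g z \<partial>M)) \<le> e / 4"
    proof -
      have "cmod ((\<integral>z. poly R z * g z \<partial>M) - (\<integral>z. q z * g z \<partial>M)) = cmod (\<integral>z. poly R z * g z - q z * g z \<partial>M)"
        by (simp only: Bochner_Integration.integral_diff[OF int[OF cont] int[OF cont_q]])
      also have "\<dots> \<le> (\<integral>z. cmod (poly R z * g z - q z * g z) \<partial>M)"
        by (rule integral_norm_bound)
      also have "\<dots> \<le> (\<integral>z. (A * \<epsilon>) * cmod (g z) \<partial>M)"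
      proof (rule integral_mono_AE)
        show "integrable M (\<lambda>z. cmod (poly R z * g z - q z * g z))"
          by (intro integrable_norm Bochner_Integration.integrable_diff int cont cont_q)
        show "integrable M (\<lambda>z. (A * \<epsilon>) * cmod (g z))"
          by (intro integrable_mult_right integrable_norm G_integrable g)
        have "cmod (poly R z * g z - q z * g z) \<le> (A * \<epsilon>) * cmod (g z)" if "z \<in> K" for z
          unfolding left_diff_distrib[symmetric] norm_mult by (intro mult_right_mono R_K that) auto
        then show "AE z in M. cmod (poly R z * g z - q z * g z) \<le> (A * \<epsilon>) * cmod (g z)"
          by (intro AE_I2) (simp add: space_M)
      qed
      also have "\<dots> = (A * \<epsilon>) * (\<integral>z. cmod (g z) \<partial>M)"
        by simp
      also have "\<dots> \<le> (A * \<epsilon>) * B"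
        using A(1) \<epsilon>(1) by (intro mult_left_mono B_ge g) auto
      finally show ?thesis
        using \<epsilon>(3) by simp
    qed
    ultimately have "cmod ((\<integral>z. poly (p + R) z * g z \<partial>M) - (\<integral>z. q' z * g z \<partial>M)) < e / 2"
      using e by simp
    then show "cmod ((\<integral>z. poly (p + R) z * g z \<partial>M) - (\<integral>z. h z * g z \<partial>M)) < e"
      using norm_diff_triangle_less[OF _ q'(3)[OF g], of _ "e / 2"] by fastforce
  qed
qed

text \<open>A neighbourhood in the product contains a Bloch ball times a set given by finitely many
  functionals, so the preceding simultaneous approximation meets it. The other inclusion is the
  bound by the whole space.\<close>

lemma SA_propertyI:
  assumes K: "compact K" "K \<subseteq> sphere 0 1"
    and peaks: "\<And>\<epsilon> d. \<epsilon> > 0 \<Longrightarrow> \<exists>S m. m > d \<and> poly S 0 = 0 \<and>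
      (\<forall>z. cmod z < 1 \<longrightarrow> (1 - cmod z) * cmod (poly (pderiv S) z) \<le> \<epsilon>) \<and>
      (\<forall>z\<in>K. cmod (poly S (z ^ m) - 1) \<le> \<epsilon>)"
  shows "SA_property K"
proof -
  let ?X = "prod_topology bloch_topology (weak_star_topology K)"
  let ?S = "{(restrict (poly Q) (ball 0 1), poly Q) | Q. True}"
  let ?M = "restrict_space circle_measure K"
  define \<Phi> where "\<Phi> = (\<lambda>f. \<lambda>g\<in>L1_on K. \<integral>z. f z * g z \<partial>?M)"
  interpret B: Metric_space little_bloch bloch_dist
    by (rule Metric_space_little_bloch)
  have "(f, h) \<in> ?X closure_of ?S" if f: "f \<in> little_bloch" and h: "h \<in> Linf_on K" for f h
    unfolding in_closure_of
  proof (intro conjI allI impI)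
    show "(f, h) \<in> topspace ?X"
      using f h by simp
    fix T assume "(f, h) \<in> T \<and> openin ?X T"
    then obtain U V where U: "openin bloch_topology U" "f \<in> U" and V: "openin (weak_star_topology K) V" "h \<in> V"
      and UV: "U \<times> V \<subseteq> T"
      unfolding openin_prod_topology_alt by blast
    obtain r where r: "r > 0" "B.mball f r \<subseteq> U"
      using U unfolding bloch_topology_def B.openin_mtopology by blast
    obtain W where W: "openin (product_topology (\<lambda>_. euclidean) (L1_on K)) W" "V = \<Phi> -` W \<inter> Linf_on K"
      using V(1) unfolding weak_star_topology_def openin_pullback_topology \<Phi>_def by blast
    have "\<Phi> h \<in> W"
      using V(2) W(2) by blast
    from product_topology_open_contains_basis[OF W(1) this] obtain X where
      X: "\<Phi> h \<in> (\<Pi>\<^sub>E g\<in>L1_on K. X g)" "\<And>g. open (X g)" "finite {g. X g \<noteq> UNIV}"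
        "(\<Pi>\<^sub>E g\<in>L1_on K. X g) \<subseteq> W"
      by auto
    define G where "G = {g \<in> L1_on K. X g \<noteq> UNIV}"
    have G: "finite G" "G \<subseteq> L1_on K"
      using X(3) by (auto simp: G_def)
    have "\<exists>e>0. \<forall>y. dist y (\<Phi> h g) < e \<longrightarrow> y \<in> X g" if "g \<in> G" for g
      using X(1) X(2)[of g] that unfolding open_dist G_def PiE_def Pi_def by blast
    then obtain E where E: "\<And>g. g \<in> G \<Longrightarrow> E g > 0" "\<And>g y. g \<in> G \<Longrightarrow> dist y (\<Phi> h g) < E g \<Longrightarrow> y \<in> X g"
      by metis
    \<comment> \<open>Inserting the radius \<open>r\<close> keeps the minimum meaningful even if
      \<open>G\<close> is empty.\<close>
    define e where "e = Min (insert r (E ` G))"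
    have e: "e > 0" "e \<le> r" "\<And>g. g \<in> G \<Longrightarrow> e \<le> E g"
      using G r E(1) by (auto simp: e_def)
    obtain Q where Q: "bloch_dist f (restrict (poly Q) (ball 0 1)) < e"
      "\<And>g. g \<in> G \<Longrightarrow> cmod ((\<integral>z. poly Q z * g z \<partial>?M) - (\<integral>z. h z * g z \<partial>?M)) < e"
      using simultaneous_poly_approx[OF K peaks f h G e(1)] by blast
    have "restrict (poly Q) (ball 0 1) \<in> B.mball f r"
      using Q(1) e(2) f restrict_poly_in_little_bloch by simp
    then have inU: "restrict (poly Q) (ball 0 1) \<in> U"
      using r(2) by blast
    have "\<Phi> (poly Q) \<in> (\<Pi>\<^sub>E g\<in>L1_on K. X g)"
    proof (rule PiE_I)
      fix g assume g: "g \<in> L1_on K"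
      show "\<Phi> (poly Q) g \<in> X g"
      proof (cases "g \<in> G")
        case True
        then have "dist (\<Phi> (poly Q) g) (\<Phi> h g) < E g"
          using Q(2)[OF True] e(3)[OF True] g by (simp add: \<Phi>_def dist_norm)
        then show ?thesis
          by (rule E(2)[OF True])
      next
        case False
        then show ?thesis
          using g by (simp add: G_def)
      qed
    qed (simp add: \<Phi>_def)
    then have "poly Q \<in> V"
      using W(2) X(4) poly_in_Linf_on[OF K(2)] by blast
    then show "\<exists>y. y \<in> ?S \<and> y \<in> T"
      using inU UV by blast
  qed
  then have "little_bloch \<times> Linf_on K \<subseteq> poly_closure K"
    unfolding poly_closure_def by blast
  moreover have "poly_closure K \<subseteq> little_bloch \<times> Linf_on K"
    unfolding poly_closure_def using closure_of_subset_topspace[of ?X ?S] by simp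
  ultimately show ?thesis
    unfolding SA_property_def by blast
qed

section \<open>Short complementary arcs and their entropy\<close>

section \<open>Complementary arcs and entropy\<close>

text \<open>The points \<open>circ a\<close> and \<open>circ b\<close> cut the circle into two
  closed arcs meeting only there. A connected set avoiding both points lies in one of the arcs, and
  \<open>t\<close> decides which.\<close>

lemma connected_within_arc:
  assumes ab: "a < b" "b < a + 1" and I: "connected I" "I \<subseteq> sphere 0 1" "circ a \<notin> I" "circ b \<notin> I"
    and t: "t \<in> {a<..<b}" "circ t \<in> I"
  shows "I \<subseteq> circ ` {a<..<b}"
proof -
  let ?A = "circ ` {a..b}" and ?B = "circ ` {b..a + 1}"
  have "compact ?A" "compact ?B"
    by (intro compact_continuous_image continuous_intros compact_Icc)+
  then have closed: "closed ?A" "closed ?B"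
    by (simp_all add: compact_imp_closed)
  have disj: "?A \<inter> ?B \<inter> I = {}"
  proof -
    have False if xy: "circ x \<in> I" "circ x = circ y" "x \<in> {a..b}" "y \<in> {b..a + 1}" for x y
    proof -
      obtain n :: int where n: "x = y + of_int n"
        using xy(2) unfolding circ_eq_iff by blast
      then have "of_int n \<le> (0::real)" "- 1 \<le> real_of_int n"
        using xy(3,4) by auto
      then have "n = 0 \<or> n = - 1"
        by linarith
      then have "x = b \<or> x = a"
        using n xy(3,4) by auto
      then show False
        using xy(1) I(3,4) by blast
    qed
    then show ?thesis
      by blast
  qed
  have cover: "I \<subseteq> ?A \<union> ?B"
  proof
    fix z assume "z \<in> I"
    then obtain s where s: "z = circ s"
      using I(2) circ_surj by blast
    define s' where "s' = s + of_int (- \<lfloor>s - a\<rfloor>)"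
    have "z = circ s'"
      unfolding s'_def circ_add_int by (rule s)
    moreover have "a \<le> s'" "s' < a + 1"
      unfolding s'_def by linarith+
    ultimately show "z \<in> ?A \<union> ?B"
      by (cases "s' \<le> b") auto
  qed
  have "circ t \<in> ?A"
    using t(1) by (intro imageI) simp
  then have "?A \<inter> I \<noteq> {}"
    using t(2) by blast
  then have "?B \<inter> I = {}"
    using connected_closedD[OF I(1) disj cover closed] by blast
  then have "I \<subseteq> ?A"
    using cover by blast
  show ?thesis
  proof
    fix z assume z: "z \<in> I"
    then obtain s where s: "z = circ s" "s \<in> {a..b}"
      using \<open>I \<subseteq> ?A\<close> by blast
    then have "s \<noteq> a" "s \<noteq> b"
      using z I(3,4) by auto
    then show "z \<in> circ ` {a<..<b}"
      using s by auto
  qed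
qed

text \<open>Two parameters of the same point differ by an integer; with one in \<open>[0, 1)\<close>
  and the other in \<open>(a, b)\<close>, inside \<open>(0, 1)\<close>, that integer is
  \<open>0\<close>.\<close>

lemma measure_subset_arc:
  assumes ab: "0 \<le> a" "a \<le> b" "b \<le> 1" and I: "I \<in> sets borel" "I \<subseteq> circ ` {a<..<b}"
  shows "measure circle_measure I \<le> b - a"
proof -
  have "{t \<in> {0..<1}. circ t \<in> I} \<subseteq> {a<..<b}"
  proof safe
    fix t :: real assume t: "t \<in> {0..<1}" "circ t \<in> I"
    then obtain x where x: "circ t = circ x" "x \<in> {a<..<b}"
      using I(2) by blast
    then obtain n :: int where n: "t = x + of_int n"
      unfolding circ_eq_iff by blast
    have "- 1 < real_of_int n" "real_of_int n < 1"
      using n t x ab by auto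
    then have "n = 0"
      by linarith
    then show "t \<in> {a<..<b}"
      using n x by simp
  qed
  then have "measure lborel {t \<in> {0..<1}. circ t \<in> I} \<le> measure lborel {a<..<b}"
    using I(1) ab by (intro measure_mono_fmeasurable) (auto simp: sets_circ_preimage fmeasurable_def)
  then show ?thesis
    using ab by (simp add: measure_circle_measure[OF I(1)])
qed

text \<open>The circle is locally connected, so components of its open subsets are open. This makes
  complementary arcs and arbitrary unions of them Borel.\<close>

lemma open_arc_component:
  assumes "compact K'" "I \<in> components (sphere 0 1 - K')"
  shows "openin (top_of_set (sphere 0 1)) (I :: complex set)"
proof -
  have op: "openin (top_of_set (sphere 0 1)) (sphere 0 1 - K')"
    unfolding Diff_eq using assms(1) by (intro openin_open_Int open_Compl compact_imp_closed)
  then have "locally connected (sphere 0 1 - K')"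
    by (rule locally_open_subset[OF locally_connected_sphere])
  then have "openin (top_of_set (sphere 0 1 - K')) I"
    using assms(2) by (rule openin_components_locally_connected)
  then show ?thesis
    using op by (rule openin_trans)
qed

lemma borel_openin_sphere:
  "openin (top_of_set (sphere 0 1)) I \<Longrightarrow> I \<in> sets borel" for I :: "complex set"
  by (auto simp: openin_open)

text \<open>
  The circle is cut into \<open>M\<close> arcs. In each of them, the points between the first and the last point of
  \<open>K'\<close> that are outside \<open>K'\<close> lie in complementary arcs of length at most \<open>1 / M\<close>.
\<close>

lemma small_components_measure:
  fixes M m :: nat
  assumes K': "compact K'" "K' \<subseteq> sphere 0 1" and A: "A \<in> sets borel" and M: "2 \<le> M" and m: "0 < m"
    and null: "{z \<in> sphere 0 1. z ^ m \<in> A} \<inter> K' \<in> null_sets circle_measure"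
  shows "measure circle_measure A * (measure circle_measure K' - 2 * M / m) \<le>
    measure circle_measure (\<Union>{I \<in> components (sphere 0 1 - K'). measure circle_measure I \<le> 1 / M})"
proof -
  define V where "V = \<Union>{I \<in> components (sphere 0 1 - K'). measure circle_measure I \<le> 1 / M}"
  define N where "N = {z \<in> sphere 0 1. z ^ m \<in> A} \<inter> K'"
  let ?a = "measure circle_measure A"
  have "openin (top_of_set (sphere 0 1)) V"
    unfolding V_def using open_arc_component[OF K'(1)] by (intro openin_Union) auto
  then have V: "V \<in> sets borel"
    by (rule borel_openin_sphere)
  have K'b: "K' \<in> sets borel"
    using K'(1) by (rule borel_compact)
  have "(\<lambda>z::complex. z ^ m) -` A \<in> sets borel"
    using measurable_sets_borel[OF borel_measurable_continuous_onI A, of "\<lambda>z. z ^ m"]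
    by (simp add: continuous_intros)
  then have "sphere 0 1 \<inter> (\<lambda>z. z ^ m) -` A \<inter> K' \<in> sets borel"
    using K'b by (intro sets.Int) auto
  moreover have N_eq: "N = sphere 0 1 \<inter> (\<lambda>z. z ^ m) -` A \<inter> K'"
    by (auto simp: N_def)
  ultimately have Nb: "N \<in> sets borel"
    by simp
  have N0: "measure lborel {t \<in> {0..<1}. circ t \<in> N} = 0"
    unfolding measure_circle_measure[OF Nb, symmetric] using null unfolding N_def
    by (rule measure_eq_0_null_sets)
  define P where "P i = {t \<in> {real i / M..(real i + 1) / M}. circ t \<in> K'}" for i :: nat
  define W where "W i = {t \<in> {real i / M<..<(real i + 1) / M}. circ t \<in> V}" for i :: nat
  have fm: "{t \<in> S. circ t \<in> B} \<in> fmeasurable lborel" if "B \<in> sets borel" "S \<in> sets borel" "bounded S" for B S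
    using fmeasurable_circ_preimage(1)[OF that] .
  have Pfm: "P i \<in> fmeasurable lborel" and Wfm: "W i \<in> fmeasurable lborel" for i
    unfolding P_def W_def by (intro fm K'b V; simp)+
  \<comment> \<open>In one arc: between the first and last points \<open>a\<close> and
    \<open>b\<close> of \<open>K'\<close>, the preimage of \<open>A\<close> has measure at least
    that of \<open>A\<close> times \<open>b - a - 2 / m\<close>, and up to a null set it lies in
    short complementary arcs.\<close>
  have step: "?a * (measure lborel (P i) - 2 / m) \<le> measure lborel (W i)" if i: "i < M" for i
  proof (cases "P i = {}")
    case True
    have "?a * (0 - 2 / m) \<le> 0"
      by (intro mult_nonneg_nonpos) auto
    also have "0 \<le> measure lborel (W i)"
      by simp
    finally show ?thesis
      using True by simp
  next
    case False
    have "closed (circ -` K')"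
      using K'(1) by (intro closed_vimage continuous_intros) (simp add: compact_imp_closed)
    then have "compact ({real i / M..(real i + 1) / M} \<inter> circ -` K')"
      by (intro compact_Int_closed compact_Icc)
    moreover have "P i = {real i / M..(real i + 1) / M} \<inter> circ -` K'"
      by (auto simp: P_def)
    ultimately have cP: "compact (P i)"
      by simp
    obtain a where a: "a \<in> P i" "\<And>t. t \<in> P i \<Longrightarrow> a \<le> t"
      using compact_attains_inf[OF cP False] by blast
    obtain b where b: "b \<in> P i" "\<And>t. t \<in> P i \<Longrightarrow> t \<le> b"
      using compact_attains_sup[OF cP False] by blast
    have ab: "a \<le> b"
      using a b by blast
    have range: "real i / M \<le> a" "b \<le> (real i + 1) / M"
      using a(1) b(1) by (auto simp: P_def)
    have len: "b - a \<le> 1 / M"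
      using range by (simp add: add_divide_distrib)
    \<comment> \<open>This is where \<open>2 \<le> M\<close> enters: \<open>b < a + 1\<close>, as
      required for \<open>circ a\<close> and \<open>circ b\<close> to bound a proper arc.\<close>
    have M1: "1 / real M < 1"
      using M by simp
    have a0: "0 \<le> a"
      by (rule order_trans[OF _ range(1)]) simp
    have "(real i + 1) / M \<le> 1"
      using i by simp
    then have b1: "b \<le> 1"
      using range(2) by linarith
    have "measure lborel (P i) \<le> measure lborel {a..b}"
      using a(2) b(2) Pfm ab by (intro measure_mono_fmeasurable) (auto simp: fmeasurable_def)
    then have "measure lborel (P i) \<le> b - a"
      using ab by simp
    then have "?a * (measure lborel (P i) - 2 / m) \<le> ?a * (b - a - 2 / m)"
      by (intro mult_left_mono) auto
    also have "\<dots> \<le> measure lborel {t \<in> {a<..<b}. circ (real m * t) \<in> A}"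
      by (rule measure_circ_scaled_ge[OF A m])
    also have "\<dots> \<le> measure lborel (W i \<union> {t \<in> {0..<1}. circ t \<in> N})"
    proof (intro measure_mono_fmeasurable)
      show "{t \<in> {a<..<b}. circ (real m * t) \<in> A} \<in> sets lborel"
        using A by (simp add: sets_circ_preimage)
      show "W i \<union> {t \<in> {0..<1}. circ t \<in> N} \<in> fmeasurable lborel"
        by (intro fmeasurable.Un Wfm fm Nb) auto
      show "{t \<in> {a<..<b}. circ (real m * t) \<in> A} \<subseteq> W i \<union> {t \<in> {0..<1}. circ t \<in> N}"
      proof
        fix t assume "t \<in> {t \<in> {a<..<b}. circ (real m * t) \<in> A}"
        then have t: "a < t" "t < b" "circ (real m * t) \<in> A"
          by auto
        have t01: "t \<in> {0..<1}"
          using t a0 b1 by auto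
        have pw: "circ t ^ m = circ (real m * t)"
          by (simp add: Complex.DeMoivre mult_ac)
        show "t \<in> W i \<union> {t \<in> {0..<1}. circ t \<in> N}"
        proof (cases "circ t \<in> K'")
          case True
          then have "circ t \<in> N"
            using t(3) pw by (simp add: N_def)
          then show ?thesis
            using t01 by blast
        next
          case False
          \<comment> \<open>The component through \<open>circ t\<close> avoids \<open>circ a\<close>
            and \<open>circ b\<close>, which lie in \<open>K'\<close>. It is trapped between them,
            so its length is at most \<open>b - a \<le> 1 / M\<close>.\<close>
          define I where "I = connected_component_set (sphere 0 1 - K') (circ t)"
          have tS: "circ t \<in> sphere 0 1 - K'"
            using False by simp
          then have I: "I \<in> components (sphere 0 1 - K')" "circ t \<in> I"
            by (auto simp: I_def components_def)
          have I_sub: "I \<subseteq> sphere 0 1 - K'"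
            unfolding I_def by (rule connected_component_subset)
          have "circ a \<in> K'" "circ b \<in> K'"
            using a(1) b(1) by (auto simp: P_def)
          then have "I \<subseteq> circ ` {a<..<b}"
            using t len M1 I_sub I(2)
            by (intro connected_within_arc[of a b I t]) (auto simp: I_def)
          then have "measure circle_measure I \<le> b - a"
            using a0 ab b1 borel_openin_sphere[OF open_arc_component[OF K'(1) I(1)]]
            by (intro measure_subset_arc) auto
          then have "circ t \<in> V"
            using I len unfolding V_def by fastforce
          then show ?thesis
            using t range by (auto simp: W_def)
        qed
      qed
    qed
    also have "\<dots> \<le> measure lborel (W i) + measure lborel {t \<in> {0..<1}. circ t \<in> N}"
      using Wfm fm[OF Nb, of "{0..<1}"] by (intro measure_Un_le) (auto simp: fmeasurable_def)
    finally show ?thesis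
      using N0 by simp
  qed
  have "measure circle_measure K' \<le> measure lborel (\<Union>i<M. P i)"
    unfolding measure_circle_measure[OF K'b]
  proof (intro measure_mono_fmeasurable)
    show "{t \<in> {0..<1}. circ t \<in> K'} \<in> sets lborel"
      using K'b by (simp add: sets_circ_preimage)
    show "(\<Union>i<M. P i) \<in> fmeasurable lborel"
      by (intro fmeasurable.finite_UN Pfm) auto
    show "{t \<in> {0..<1}. circ t \<in> K'} \<subseteq> (\<Union>i<M. P i)"
    proof safe
      fix t :: real assume t: "t \<in> {0..<1}" "circ t \<in> K'"
      define i where "i = nat \<lfloor>M * t\<rfloor>"
      have "real i = of_int \<lfloor>M * t\<rfloor>"
        using t by (simp add: i_def)
      then have i: "real i \<le> M * t" "M * t < real i + 1"
        by linarith+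
      have "real M * t < real M * 1"
        using t M by (intro mult_strict_left_mono) auto
      then have "i < M"
        using i by linarith
      moreover have "t \<in> P i"
        using i M t by (simp add: P_def field_simps)
      ultimately show "t \<in> (\<Union>i<M. P i)"
        by blast
    qed
  qed
  also have "\<dots> \<le> (\<Sum>i<M. measure lborel (P i))"
    using Pfm by (intro measure_UNION_le) (auto simp: fmeasurable_def)
  finally have KP: "measure circle_measure K' \<le> (\<Sum>i<M. measure lborel (P i))" .
  have disj: "disjoint_family_on W {..<M}"
    unfolding disjoint_family_on_def
  proof (intro ballI impI)
    fix i j :: nat assume "i \<noteq> j"
    have False if "t \<in> W i" "t \<in> W j" for t
    proof -
      have "real i < M * t" "M * t < real i + 1" "real j < M * t" "M * t < real j + 1"
        using that M by (auto simp: W_def field_simps)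
      then show False
        using \<open>i \<noteq> j\<close> by linarith
    qed
    then show "W i \<inter> W j = {}"
      by blast
  qed
  have "(\<Sum>i<M. measure lborel (W i)) = measure lborel (\<Union>i<M. W i)"
    using Wfm disj by (intro measure_finite_Union[symmetric]) (auto simp: fmeasurable_def less_top[symmetric])
  also have "\<dots> \<le> measure lborel {t \<in> {0..<1}. circ t \<in> V}"
  proof (intro measure_mono_fmeasurable fm V)
    show "(\<Union>i<M. W i) \<in> sets lborel"
      using Wfm by (intro sets.finite_UN) (auto simp: fmeasurable_def)
    show "(\<Union>i<M. W i) \<subseteq> {t \<in> {0..<1}. circ t \<in> V}"
    proof
      fix t assume "t \<in> (\<Union>i<M. W i)"
      then obtain i where i: "i < M" and t: "t \<in> W i"
        by blast
      have "0 \<le> real i / M" "(real i + 1) / M \<le> 1"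
        using i by auto
      moreover have "real i / M < t" "t < (real i + 1) / M" "circ t \<in> V"
        using t by (auto simp: W_def)
      ultimately have "0 \<le> t" "t < 1"
        by linarith+
      then show "t \<in> {t \<in> {0..<1}. circ t \<in> V}"
        using \<open>circ t \<in> V\<close> by simp
    qed
  qed auto
  finally have WV: "(\<Sum>i<M. measure lborel (W i)) \<le> measure circle_measure V"
    by (simp add: measure_circle_measure[OF V])
  \<comment> \<open>Each of the \<open>M\<close> arcs loses \<open>2 / m\<close>, in total
    \<open>2 * M / m\<close>.\<close>
  have "?a * (measure circle_measure K' - 2 * M / m) \<le> ?a * ((\<Sum>i<M. measure lborel (P i)) - 2 * M / m)"
    using KP by (intro mult_left_mono) auto
  also have "\<dots> = (\<Sum>i<M. ?a * (measure lborel (P i) - 2 / m))"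
    by (simp add: sum_distrib_left[symmetric] sum_subtractf mult.commute)
  also have "\<dots> \<le> (\<Sum>i<M. measure lborel (W i))"
    by (intro sum_mono step) simp
  finally show ?thesis
    using WV by (simp add: V_def)
qed

text \<open>By monotonicity of \<open>w\<close>, a complementary arc of length
  \<open>x \<le> 1 / M\<close> contributes at least \<open>x\<close> times
  \<open>- ln (w (1 / M))\<close> to the absolute entropy sum. Finite subfamilies are summed first,
  then exhausted.\<close>

lemma small_components_entropy:
  fixes M :: nat
  assumes K': "compact K'"
    and w: "mono_on {0..1} w" "\<And>t. t \<in> {0<..1} \<Longrightarrow> 0 < w t"
    and M: "0 < M" "w (1 / M) \<le> 1"
    and sum: "(\<lambda>I. measure circle_measure I * ln (w (measure circle_measure I))) summable_on components (sphere 0 1 - K')"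
  shows "measure circle_measure (\<Union>{I \<in> components (sphere 0 1 - K'). measure circle_measure I \<le> 1 / M}) * (- ln (w (1 / M)))
    \<le> (\<Sum>\<^sub>\<infinity>I\<in>components (sphere 0 1 - K'). \<bar>measure circle_measure I * ln (w (measure circle_measure I))\<bar>)"
proof -
  define f where "f I = measure circle_measure I * ln (w (measure circle_measure I))" for I
  define L where "L = - ln (w (1 / M))"
  define B where "B = (\<Sum>\<^sub>\<infinity>I\<in>components (sphere 0 1 - K'). \<bar>f I\<bar>)"
  define \<F> where "\<F> = {I \<in> components (sphere 0 1 - K'). measure circle_measure I \<le> 1 / M}"
  have sum': "(\<lambda>I. \<bar>f I\<bar>) summable_on components (sphere 0 1 - K')"
    using summable_on_iff_abs_summable_on_real[THEN iffD1, OF sum] by (simp add: f_def)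
  have M': "1 / real M \<in> {0<..1}"
    using M by auto
  have L: "L \<ge> 0"
    using M w(2)[OF M'] by (simp add: L_def)
  have op: "openin (top_of_set (sphere 0 1)) I" if "I \<in> \<F>" for I
    using open_arc_component[OF K'] that by (auto simp: \<F>_def)
  then have b: "I \<in> sets borel" if "I \<in> \<F>" for I
    using that borel_openin_sphere by blast
  have le: "measure circle_measure I * L \<le> \<bar>f I\<bar>" if I: "I \<in> \<F>" for I
  proof (cases "measure circle_measure I = 0")
    case False
    define x where "x = measure circle_measure I"
    have x: "0 < x" "x \<le> 1 / M"
      using False I measure_nonneg[of circle_measure I] by (auto simp: x_def \<F>_def less_le)
    have "x \<le> 1"
      using x(2) M'[unfolded greaterThanAtMost_iff] by linarith
    then have "x \<in> {0..1}" "x \<in> {0<..1}" "1 / real M \<in> {0..1}"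
      using x(1) M' by auto
    then have "w x \<le> w (1 / M)" "0 < w x"
      using mono_onD[OF w(1) _ _ x(2)] w(2) by blast+
    then have "L \<le> - ln (w x)"
      by (simp add: L_def)
    then have "x * L \<le> x * \<bar>ln (w x)\<bar>"
      using x by (intro mult_left_mono) auto
    then show ?thesis
      using x by (simp add: f_def x_def[symmetric] abs_mult)
  qed simp
  have fin: "measure circle_measure (\<Union>\<H>) * L \<le> B" if \<H>: "finite \<H>" "\<H> \<subseteq> \<F>" for \<H>
  proof -
    have "measure circle_measure (\<Union>I\<in>\<H>. I) \<le> (\<Sum>I\<in>\<H>. measure circle_measure I)"
      using \<H> b by (intro measure_UNION_le) auto
    then have "measure circle_measure (\<Union>\<H>) * L \<le> (\<Sum>I\<in>\<H>. measure circle_measure I) * L"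
      using L by (intro mult_right_mono) auto
    also have "\<dots> = (\<Sum>I\<in>\<H>. measure circle_measure I * L)"
      by (rule sum_distrib_right)
    also have "\<dots> \<le> (\<Sum>I\<in>\<H>. \<bar>f I\<bar>)"
      using \<H>(2) by (intro sum_mono le) auto
    also have "\<dots> \<le> B"
      unfolding B_def using \<H> by (intro finite_sum_le_infsum sum') (auto simp: \<F>_def)
    finally show ?thesis .
  qed
  \<comment> \<open>Lindelof's theorem gives a countable subfamily with the same union, so
    continuity of the measure from below applies.\<close>
  obtain \<F>' where \<F>': "\<F>' \<subseteq> \<F>" "countable \<F>'" "\<Union>\<F>' = \<Union>\<F>"
    using Lindelof_openin[of \<F> "sphere 0 1"] op by blast
  have "measure circle_measure (\<Union>\<F>) * L \<le> B"
  proof (cases "\<F>' = {}")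
    case True
    then have eq: "\<Union>\<F> = {}"
      using \<F>'(3) by blast
    have "measure circle_measure (\<Union>{}) * L \<le> B"
      by (rule fin) auto
    then show ?thesis
      by (simp only: eq Union_empty)
  next
    case False
    define F where "F = from_nat_into \<F>'"
    have F: "range F = \<F>'"
      unfolding F_def using False \<F>'(2) by (rule range_from_nat_into)
    have FF: "F i \<in> \<F>" for i
      using F \<F>'(1) by auto
    have "(\<lambda>n. measure circle_measure (\<Union>i<n. F i)) \<longlonglongrightarrow> measure circle_measure (\<Union>n. \<Union>i<n. F i)"
    proof (rule circle.finite_Lim_measure_incseq)
      show "range (\<lambda>n. \<Union>i<n. F i) \<subseteq> sets circle_measure"
        using b[OF FF] by (auto intro!: sets.finite_UN)
      show "incseq (\<lambda>n. \<Union>i<n. F i)"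
        by (rule incseq_SucI) (auto simp: lessThan_Suc)
    qed
    moreover have "(\<Union>n. \<Union>i<n. F i) = \<Union>\<F>"
      unfolding \<F>'(3)[symmetric] F[symmetric] by auto
    ultimately have "(\<lambda>n. measure circle_measure (\<Union>i<n. F i) * L) \<longlonglongrightarrow> measure circle_measure (\<Union>\<F>) * L"
      by (intro tendsto_mult_right) simp
    moreover have "measure circle_measure (\<Union>i<n. F i) * L \<le> B" for n
      using fin[of "F ` {..<n}"] FF by auto
    ultimately show ?thesis
      by (intro LIMSEQ_le_const2) auto
  qed
  then show ?thesis
    by (simp add: \<F>_def L_def B_def f_def)
qed

section \<open>Auxiliary facts on the weight and the exceptional sets\<close>

section \<open>Construction of the set\<close>

text \<open>If \<open>w\<close> stayed above \<open>e\<close>, the integrand would dominate a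
  positive multiple of \<open>1 / t\<close>, whose integral over \<open>[x, 1]\<close> is unbounded
  as \<open>x\<close> tends to \<open>0\<close>.\<close>

lemma integrable_weight_arbitrarily_small:
  fixes w :: "real \<Rightarrow> real"
  assumes fin: "(\<integral>\<^sup>+t\<in>{0<..1}. ennreal (w t powr \<gamma> / t) \<partial>lborel) < \<infinity>" and "\<gamma> > 0" "e > 0"
  shows "\<exists>t\<in>{0<..1}. w t < e"
proof (rule ccontr)
  assume "\<not> ?thesis"
  then have w: "e \<le> w t" if "t \<in> {0<..1}" for t
    using that by force
  define c where "c = e powr \<gamma>"
  have c: "c > 0"
    using \<open>e > 0\<close> by (simp add: c_def)
  have le: "ennreal (c * ln (1 / x)) \<le> (\<integral>\<^sup>+t\<in>{0<..1}. ennreal (w t powr \<gamma> / t) \<partial>lborel)" if x: "0 < x" "x \<le> 1" for x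
  proof -
    have "(\<integral>\<^sup>+t. ennreal (c / t) * indicator {x..1} t \<partial>lborel) = c * ln 1 - c * ln x"
      using x c by (intro nn_integral_FTC_Icc) (auto intro!: derivative_eq_intros)
    then have "ennreal (c * ln (1 / x)) = (\<integral>\<^sup>+t. ennreal (c / t) * indicator {x..1} t \<partial>lborel)"
      using x by (simp add: ln_div)
    also have "\<dots> \<le> (\<integral>\<^sup>+t\<in>{0<..1}. ennreal (w t powr \<gamma> / t) \<partial>lborel)"
    proof (rule nn_integral_mono)
      fix t :: real
      show "ennreal (c / t) * indicator {x..1} t \<le> ennreal (w t powr \<gamma> / t) * indicator {0<..1} t"
      proof (cases "t \<in> {x..1}")
        case True
        then have t: "t \<in> {0<..1}"
          using x by auto
        then have "c / t \<le> w t powr \<gamma> / t"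
          unfolding c_def using w[OF t] assms by (intro divide_right_mono powr_mono2) auto
        then show ?thesis
          using True t by (simp add: ennreal_leI)
      qed simp
    qed
    finally show ?thesis .
  qed
  obtain R where R: "(\<integral>\<^sup>+t\<in>{0<..1}. ennreal (w t powr \<gamma> / t) \<partial>lborel) = ennreal R" "R \<ge> 0"
    using fin by (cases "\<integral>\<^sup>+t\<in>{0<..1}. ennreal (w t powr \<gamma> / t) \<partial>lborel") auto
  \<comment> \<open>This \<open>x\<close> is chosen so that the logarithmic lower bound equals
    \<open>R + 1\<close>.\<close>
  have "ennreal (c * ln (1 / exp (- ((R + 1) / c)))) \<le> ennreal R"
    using le[of "exp (- ((R + 1) / c))"] R c by simp
  then have "c * ((R + 1) / c) \<le> R"
    using R(2) by (simp add: ln_div)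
  then show False
    using c by simp
qed

text \<open>Otherwise \<open>S - 1\<close> is at most \<open>\<epsilon>\<close> in modulus almost
  everywhere, whereas its mean is \<open>-1\<close> by the mean value property. Positivity is needed
  because the scale is chosen by dividing by this measure.\<close>

lemma measure_far_from_one_pos:
  assumes S: "poly S 0 = 0" and \<epsilon>: "\<epsilon> < 1"
  shows "0 < measure circle_measure {z \<in> sphere 0 1. \<epsilon> < cmod (poly S z - 1)}"
proof (rule ccontr)
  define A where "A = {z \<in> sphere 0 1. \<epsilon> < cmod (poly S z - 1)}"
  assume "\<not> ?thesis"
  then have "measure circle_measure A = 0"
    using measure_nonneg[of circle_measure A] unfolding A_def by linarith
  moreover have "open {z. \<epsilon> < cmod (poly S z - 1)}"
    by (intro open_Collect_less continuous_intros)
  then have "A \<in> sets borel"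
    unfolding A_def Collect_conj_eq by (intro sets.Int) auto
  ultimately have "A \<in> null_sets circle_measure"
    by (auto simp: null_sets_def circle.emeasure_eq_measure)
  then have "AE z in circle_measure. z \<notin> A"
    by (rule AE_not_in)
  with AE_sphere have "AE z in circle_measure. cmod (poly S z - 1) \<le> \<epsilon>"
    by eventually_elim (auto simp: A_def)
  then have "(\<integral>z. cmod (poly S z - 1) \<partial>circle_measure) \<le> (\<integral>z. \<epsilon> \<partial>circle_measure)"
    by (intro integral_mono_AE integrable_circle_continuous continuous_intros)
  then have "(\<integral>z. cmod (poly S z - 1) \<partial>circle_measure) \<le> \<epsilon>"
    by simp
  moreover have "cmod (integral\<^sup>L circle_measure (poly (S - 1))) \<le> (\<integral>z. cmod (poly (S - 1) z) \<partial>circle_measure)"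
    by (rule integral_norm_bound)
  ultimately show False
    using S \<epsilon> by (simp add: integral_circle_poly)
qed

section \<open>The compact set and its two properties\<close>

theorem theorem2p8:
  fixes w :: "real \<Rightarrow> real"
  assumes "majorant w"
    and "(\<integral>\<^sup>+t\<in>{0<..1}. ennreal ((w t)\<^sup>2 / t) \<partial>lborel) = \<infinity>"
    and "\<exists>\<gamma>>2. (\<integral>\<^sup>+t\<in>{0<..1}. ennreal (w t powr \<gamma> / t) \<partial>lborel) < \<infinity>"
  shows "\<exists>K. compact K \<and> K \<subseteq> sphere 0 1 \<and> 0 < measure circle_measure K \<and>
           SA_property K \<and>
           \<not> (\<exists>K'. finite_entropy_set w K' \<and> almost_contained K' K)"
proof -
  have w_mono: "mono_on {0..1} w" and w_pos: "\<And>t. t \<in> {0<..1} \<Longrightarrow> 0 < w t"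
    using assms(1) by (auto simp: majorant_def)
  have w_small: "\<exists>t\<in>{0<..1}. w t < e" if "e > 0" for e
    using assms(3) that integrable_weight_arbitrarily_small[of w] by force
  define \<epsilon> where "\<epsilon> n = 1 / real (n + 2)" for n :: nat
  \<comment> \<open>These bounds add up to \<open>1 / 2\<close>, so at least half of the circle
    survives the removals.\<close>
  define \<delta> :: "nat \<Rightarrow> real" where "\<delta> n = (1 / 2) ^ (n + 2)" for n :: nat
  have \<epsilon>: "0 < \<epsilon> n" "\<epsilon> n < 1" for n
    by (auto simp: \<epsilon>_def)
  define good where "good n S \<longleftrightarrow> poly S 0 = 0 \<and>
      (\<forall>z. cmod z < 1 \<longrightarrow> (1 - cmod z) * cmod (poly (pderiv S) z) \<le> \<epsilon> n) \<and>
      measure circle_measure {z \<in> sphere 0 1. \<epsilon> n < cmod (poly S z - 1)} \<le> \<delta> n" for n S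
  have "\<exists>S. good n S" for n
    unfolding good_def by (intro small_bloch_poly_near_one \<epsilon>(1)) (simp add: \<delta>_def)
  then obtain S where S: "\<And>n. good n (S n)"
    by metis
  have S0: "poly (S n) 0 = 0"
    and SB: "cmod z < 1 \<Longrightarrow> (1 - cmod z) * cmod (poly (pderiv (S n)) z) \<le> \<epsilon> n"
    and SA: "measure circle_measure {z \<in> sphere 0 1. \<epsilon> n < cmod (poly (S n) z - 1)} \<le> \<delta> n" for n z
    using S[of n] unfolding good_def by blast+
  define A where "A n = {z \<in> sphere 0 1. \<epsilon> n < cmod (poly (S n) z - 1)}" for n
  define a where "a n = measure circle_measure (A n)" for n
  have a: "0 < a n" "a n \<le> \<delta> n" for n
    using measure_far_from_one_pos[OF S0 \<epsilon>(2)] SA by (auto simp: a_def A_def)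
  have A: "A n \<in> sets borel" for n
  proof -
    have "open {z. \<epsilon> n < cmod (poly (S n) z - 1)}"
      by (intro open_Collect_less continuous_intros)
    then show ?thesis
      unfolding A_def Collect_conj_eq by (intro sets.Int) auto
  qed
  have "\<exists>M. n + 2 \<le> M \<and> w (1 / real M) \<le> 1 \<and> real n \<le> a n * (- ln (w (1 / real M)))" for n
  proof -
    \<comment> \<open>The scale \<open>1 / M n\<close> is chosen after \<open>S n\<close>, when
      \<open>a n\<close> is already fixed: from \<open>w (1 / M n) < exp (- n / a n)\<close>, a
      proportion \<open>a n\<close> of short arcs forces entropy of order \<open>n\<close>.\<close>
    define e where "e = exp (- (real n / a n))"
    obtain t where t: "t \<in> {0<..1}" "w t < e"
      using w_small[of e] by (auto simp: e_def)
    obtain N :: nat where N: "1 / t < N"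
      using reals_Archimedean2 by blast
    define M where "M = max N (n + 2)"
    have M: "0 < M" "N \<le> M" "n + 2 \<le> M"
      by (auto simp: M_def)
    have "1 < real N * t"
      using N t by (simp add: field_simps)
    also have "\<dots> \<le> real M * t"
      using M t by (intro mult_right_mono) auto
    finally have "1 / real M \<le> t"
      using M by (simp add: field_simps)
    moreover have M1: "1 / real M \<in> {0<..1}"
      using M by auto
    ultimately have we: "w (1 / real M) < e"
      using mono_onD[OF w_mono, of "1 / real M" t] t by auto
    moreover have w0: "0 < w (1 / real M)"
      by (rule w_pos[OF M1])
    moreover have "e \<le> 1"
      using a(1)[of n] by (simp add: e_def)
    ultimately have "w (1 / real M) \<le> 1"
      by linarith
    moreover have "ln (w (1 / real M)) \<le> ln e"
      using we w0 by simp
    then have "real n / a n \<le> - ln (w (1 / real M))"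
      by (simp add: e_def)
    then have "real n \<le> a n * (- ln (w (1 / real M)))"
      using a(1)[of n] by (simp add: pos_divide_le_eq mult.commute)
    ultimately show ?thesis
      using M by blast
  qed
  then obtain M where M: "\<And>n. n + 2 \<le> M n" "\<And>n. w (1 / real (M n)) \<le> 1"
      "\<And>n. real n \<le> a n * (- ln (w (1 / real (M n))))"
    by metis
  \<comment> \<open>With the square, the loss \<open>2 * M n / m n\<close> in the count of short
    arcs is \<open>2 / M n\<close>, which tends to \<open>0\<close>. Also \<open>m n > n\<close>,
    which provides the high order of vanishing at \<open>0\<close>.\<close>
  define m where "m n = (M n)\<^sup>2" for n
  have M0: "0 < M n" "2 \<le> M n" for n
    using M(1)[of n] by auto
  have m: "0 < m n" "n < m n" for n
  proof -
    show "0 < m n"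
      using M0[of n] by (simp add: m_def)
    have "M n * 1 \<le> M n * M n"
      using M0[of n] by (intro mult_left_mono) auto
    then have "n < M n * M n"
      using M(1)[of n] by linarith
    then show "n < m n"
      by (simp only: m_def power2_eq_square)
  qed
  define D where "D n = {z \<in> sphere 0 1. z ^ m n \<in> A n}" for n
  define K where "K = sphere 0 1 - (\<Union>n. D n)"
  have D_eq: "D n = sphere 0 1 \<inter> {z. \<epsilon> n < cmod (poly (S n) (z ^ m n) - 1)}" for n
    by (auto simp: D_def A_def norm_power)
  have open_D: "open {z. \<epsilon> n < cmod (poly (S n) (z ^ m n) - 1)}" for n
    by (intro open_Collect_less continuous_intros)
  have D: "D n \<in> sets borel" for n
    unfolding D_eq using open_D by (intro sets.Int) auto
  have measure_D: "measure circle_measure (D n) = a n" for n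
  proof -
    have "{t \<in> {0..<1}. circ t \<in> D n} = {t \<in> {0..<1}. circ (real (m n) * t) \<in> A n}"
      by (auto simp: D_def Complex.DeMoivre mult_ac)
    then show ?thesis
      using measure_circ_scaled[OF A m(1)] by (simp only: measure_circle_measure[OF D] a_def)
  qed
  have K_eq: "K = sphere 0 1 \<inter> (\<Inter>n. - {z. \<epsilon> n < cmod (poly (S n) (z ^ m n) - 1)})"
    by (auto simp: K_def D_eq)
  have K: "compact K" "K \<subseteq> sphere 0 1"
  proof -
    show "compact K"
      unfolding K_eq using open_D by (intro compact_Int_closed closed_INT ballI) auto
  qed (auto simp: K_def)
  have "1 / 2 \<le> measure circle_measure K"
  proof -
    have sums: "\<delta> sums (1 / 2)"
    proof -
      have "\<delta> = (\<lambda>n. 1 / 4 * (1 / 2) ^ n)"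
        by (rule ext) (simp add: \<delta>_def)
      then show ?thesis
        using sums_mult[OF geometric_sums[of "1 / 2 :: real"], of "1 / 4"] by simp
    qed
    have summ: "summable a"
      using a by (intro summable_comparison_test'[OF sums_summable[OF sums]]) (simp add: less_imp_le)
    have "measure circle_measure (\<Union>n. D n) \<le> (\<Sum>n. measure circle_measure (D n))"
      using D summ by (intro circle.finite_measure_subadditive_countably) (auto simp: measure_D)
    also have "\<dots> \<le> (\<Sum>n. \<delta> n)"
      unfolding measure_D using a(2) summ sums_summable[OF sums] by (intro suminf_le) auto
    also have "\<dots> = 1 / 2"
      using sums by (simp add: sums_iff)
    finally have "measure circle_measure (\<Union>n. D n) \<le> 1 / 2" .
    moreover have "measure circle_measure K = measure circle_measure (sphere 0 1) - measure circle_measure (\<Union>n. D n)"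
      unfolding K_def using D by (intro circle.finite_measure_Diff) (auto simp: D_def)
    moreover have "measure circle_measure (sphere 0 1) = 1"
      by (simp add: measure_def emeasure_circle_measure_sphere)
    ultimately show ?thesis
      by simp
  qed
  then have K_pos: "0 < measure circle_measure K"
    by simp
  have "SA_property K"
  proof (rule SA_propertyI[OF K])
    fix e :: real and d :: nat assume "e > 0"
    obtain n0 :: nat where n0: "1 / e < n0"
      using reals_Archimedean2 by blast
    \<comment> \<open>The entry \<open>n0\<close> makes \<open>\<epsilon> n \<le> e\<close>, and
      \<open>d\<close> makes \<open>m n > d\<close>.\<close>
    define n where "n = max n0 d"
    have "1 / e < real (n + 2)"
      using n0 by (simp add: n_def)
    then have \<epsilon>e: "\<epsilon> n \<le> e"
      using \<open>e > 0\<close> by (simp add: \<epsilon>_def field_simps)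
    show "\<exists>S m. m > d \<and> poly S 0 = 0 \<and>
        (\<forall>z. cmod z < 1 \<longrightarrow> (1 - cmod z) * cmod (poly (pderiv S) z) \<le> e) \<and>
        (\<forall>z\<in>K. cmod (poly S (z ^ m) - 1) \<le> e)"
    proof (intro exI conjI allI impI ballI)
      show "d < m n"
        using m(2)[of n] by (simp add: n_def)
      show "poly (S n) 0 = 0"
        by (rule S0)
      show "(1 - cmod z) * cmod (poly (pderiv (S n)) z) \<le> e" if "cmod z < 1" for z
        using SB[OF that, of n] \<epsilon>e by linarith
      show "cmod (poly (S n) (z ^ m n) - 1) \<le> e" if "z \<in> K" for z
      proof -
        have "cmod (poly (S n) (z ^ m n) - 1) \<le> \<epsilon> n"
          using that unfolding K_eq by (auto simp: not_less)
        then show ?thesis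
          using \<epsilon>e by linarith
      qed
    qed
  qed
  moreover have False if K': "finite_entropy_set w K'" "almost_contained K' K" for K'
  proof -
    have c: "compact K'" "K' \<subseteq> sphere 0 1" "0 < measure circle_measure K'"
      and sum: "(\<lambda>I. measure circle_measure I * ln (w (measure circle_measure I)))
        summable_on components (sphere 0 1 - K')"
      using K'(1) by (auto simp: finite_entropy_set_def)
    define c where "c = measure circle_measure K'"
    define B where "B = (\<Sum>\<^sub>\<infinity>I\<in>components (sphere 0 1 - K'). \<bar>measure circle_measure I * ln (w (measure circle_measure I))\<bar>)"
    \<comment> \<open>The factor \<open>a n\<close> in the measure of the short arcs cancels against
      the choice of \<open>M n\<close>, leaving a lower bound linear in \<open>n\<close> for the
      fixed entropy sum \<open>B\<close>.\<close>
    have bound: "real n * (c - 2 / M n) \<le> B" if n: "2 / M n \<le> c" for n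
    proof -
      let ?V = "\<Union>{I \<in> components (sphere 0 1 - K'). measure circle_measure I \<le> 1 / M n}"
      let ?L = "- ln (w (1 / M n))"
      \<comment> \<open>The removed set \<open>D n\<close> misses \<open>K\<close>, so a set almost
        contained in \<open>K\<close> meets \<open>D n\<close> only in a null set.\<close>
      have "{z \<in> sphere 0 1. z ^ m n \<in> A n} \<inter> K' \<subseteq> K' - K"
        by (auto simp: K_def D_def)
      moreover have "{z \<in> sphere 0 1. z ^ m n \<in> A n} \<inter> K' \<in> sets circle_measure"
        using D[of n] borel_compact[OF c(1)] unfolding D_def
        by (intro borel_sets_circle_measure sets.Int)
      ultimately have "{z \<in> sphere 0 1. z ^ m n \<in> A n} \<inter> K' \<in> null_sets circle_measure"
        using K'(2) unfolding almost_contained_def by (blast intro: null_sets_subset)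
      then have "a n * (c - 2 * M n / m n) \<le> measure circle_measure ?V"
        unfolding a_def c_def by (intro small_components_measure c A M0 m)
      moreover have "2 * M n / m n = 2 / M n"
        using M0[of n] by (simp add: m_def power2_eq_square)
      ultimately have "a n * (c - 2 / M n) \<le> measure circle_measure ?V"
        by simp
      moreover have "0 \<le> ?L"
        using M(2)[of n] w_pos[of "1 / M n"] M0[of n] by simp
      ultimately have "(a n * (c - 2 / M n)) * ?L \<le> measure circle_measure ?V * ?L"
        by (rule mult_right_mono)
      also have "\<dots> \<le> B"
        unfolding B_def by (intro small_components_entropy c w_mono w_pos M0 M sum)
      finally have "(a n * ?L) * (c - 2 / M n) \<le> B"
        by (simp add: mult_ac)
      moreover have "real n * (c - 2 / M n) \<le> (a n * ?L) * (c - 2 / M n)"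
        using M(3)[of n] n by (intro mult_right_mono) auto
      ultimately show ?thesis
        by linarith
    qed
    \<comment> \<open>The bound \<open>n1\<close> leaves at least \<open>c / 2\<close> after the
      loss \<open>2 / M n\<close>; then \<open>n2\<close> makes \<open>n * (c / 2)\<close> exceed
      \<open>B\<close>.\<close>
    obtain n1 :: nat where n1: "4 / c < n1"
      using reals_Archimedean2 by blast
    obtain n2 :: nat where n2: "2 * B / c < n2"
      using reals_Archimedean2 by blast
    define n where "n = max n1 n2"
    have c0: "c > 0"
      using c by (simp add: c_def)
    have "real n \<le> real (M n)"
      using M(1)[of n] by simp
    moreover have "4 / c < real n"
      using n1 by (simp add: n_def)
    ultimately have "4 / c < real (M n)"
      by linarith
    then have half: "2 / M n \<le> c / 2"
      using c0 M0[of n] by (simp add: field_simps)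
    have "real n * (c / 2) \<le> real n * (c - 2 / M n)"
      using half by (intro mult_left_mono) auto
    also have "\<dots> \<le> B"
      using half c0 by (intro bound) linarith
    finally have "real n * (c / 2) \<le> B" .
    moreover have "2 * B / c < real n"
      using n2 by (simp add: n_def)
    ultimately show False
      using c0 by (simp add: field_simps)
  qed
  ultimately show ?thesis
    using K K_pos by blast
qed

end
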